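(* Let $\mathbf{A}$ be a commutative ring with an explicit divisibility test. Let $E$ and $F$ be two finitely generated projective $\mathbf{A}$-modules generated by $n$ elements (or fewer), and let $\varphi:E\to F$ and $\varphi^\bullet:F\to E$ be two linear maps. Then one can decide, with $O(n^4)$ arithmetic operations in $\mathbf{A}$ and $O(n^3)$ tests "$x\in\langle y\rangle\,?$", whether $\varphi$ and $\varphi^\bullet$ are crossed, and in case of a positive answer compute the generalized inverses $\mathrm{Ig}(\varphi,\varphi^\bullet)$ and $\mathrm{Ig}(\varphi^\bullet,\varphi)$ with $O(n^4)$ arithmetic operations.
   Context: Two linear maps $\varphi:E\to F$ and $\varphi^\bullet:F\to E$ are called crossed if $\operatorname{Im}\varphi\oplus\operatorname{Ker}\varphi^\bullet=F$ and $\operatorname{Ker}\varphi\oplus\operatorname{Im}\varphi^\bullet=E$. If they are crossed, $\mathrm{Ig}(\varphi,\varphi^\bullet)$ denotes the unique linear map $\psi:F\to E$ such that $\varphi\psi$ is the projection onto $\operatorname{Im}\varphi$ along $\operatorname{Ker}\varphi^\bullet$ and $\psi\varphi$ is the projection onto $\operatorname{Im}\varphi^\bullet$ along $\operatorname{Ker}\varphi$ (in particular $\varphi\psi\varphi=\varphi$ and $\psi\varphi\psi=\psi$). Input convention: $E$ and $F$ are given by projection (idempotent) matrices $P_E$, $P_F$ (of size at most $n$) of which they are the images, and $\varphi,\varphi^\bullet$ are given by matrices $A$, $A^\bullet$ satisfying $P_FAP_E=A$ and $P_EA^\bullet P_F=A^\bullet$. Complexity model: an arithmetic operation is a basic ring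 operation of $\mathbf{A}$ (usual, not fast, multiplication of matrices and polynomials is allowed). The divisibility test "$x\in\langle y\rangle\,?$" takes $x,y\in\mathbf{A}$, decides whether $x\in y\mathbf{A}$, and in the positive case returns $z$ with $x=zy$ (with $y=0$ it gives an equality test). *)

theory Defs
  imports
    Jordan_Normal_Form.VS_Connect
    "HOL-Algebra.AbelCoset"
    "HOL-Library.Landau_Symbols"
begin

section \<open>Crossed linear maps and their generalized inverses\<close>

definition internal_direct_sum :: "('a, 'v, 'x) module_scheme \<Rightarrow> 'v set \<Rightarrow> 'v set \<Rightarrow> bool" where
  "internal_direct_sum M U V \<longleftrightarrow> U <+>\<^bsub>M\<^esub> V = carrier M \<and> U \<inter> V = {\<zero>\<^bsub>M\<^esub>}"

definition projection_onto_along ::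
  "('a, 'v, 'x) module_scheme \<Rightarrow> 'v set \<Rightarrow> 'v set \<Rightarrow> ('v \<Rightarrow> 'v) \<Rightarrow> bool" where
  "projection_onto_along M U V p \<longleftrightarrow> (\<forall>u\<in>U. \<forall>v\<in>V. p (u \<oplus>\<^bsub>M\<^esub> v) = u)"

definition crossed ::
  "('a, 'e, 'x) module_scheme \<Rightarrow> ('a, 'f, 'y) module_scheme \<Rightarrow> ('e \<Rightarrow> 'f) \<Rightarrow> ('f \<Rightarrow> 'e) \<Rightarrow> bool" where
  "crossed E F f g \<longleftrightarrow>
     internal_direct_sum F (f ` carrier E) (a_kernel F E g) \<and>
     internal_direct_sum E (a_kernel E F f) (g ` carrier F)"

text \<open>
  \<open>is_Ig R E F f g h\<close> says that \<open>h\<close> is \<open>Ig(f, g)\<close>.  The two projection conditions alone do not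
  determine \<open>h\<close> (for \<open>f = 0\<close> and \<open>g = 0\<close> every linear map satisfies them), so the last equation
  is an essential part of the definition; the one before it is redundant.
\<close>

definition is_Ig ::
  "('a, 'r) ring_scheme \<Rightarrow> ('a, 'e, 'x) module_scheme \<Rightarrow> ('a, 'f, 'y) module_scheme \<Rightarrow>
   ('e \<Rightarrow> 'f) \<Rightarrow> ('f \<Rightarrow> 'e) \<Rightarrow> ('f \<Rightarrow> 'e) \<Rightarrow> bool" where
  "is_Ig R E F f g h \<longleftrightarrow>
     h \<in> LinearCombinations.module_hom R F E \<and>
     projection_onto_along F (f ` carrier E) (a_kernel F E g) (f \<circ> h) \<and>
     projection_onto_along E (g ` carrier F) (a_kernel E F f) (h \<circ> f) \<and>
     (\<forall>x\<in>carrier E. f (h (f x)) = f x) \<and>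
     (\<forall>y\<in>carrier F. h (f (h y)) = h y)"

lemma is_Ig_unique:
  assumes E: "abelian_group E" and g: "g \<in> carrier F \<rightarrow> carrier E" and cr: "crossed E F f g"
    and h: "is_Ig R E F f g h" and h': "is_Ig R E F f g h'"
    and y: "y \<in> carrier F"
  shows "h y = h' y"
proof -
  have eq_im: "h (f x) = h' (f x)" if x: "x \<in> carrier E" for x
  proof -
    have "x \<in> set_add E (a_kernel E F f) (g ` carrier F)"
      using cr x by (simp add: crossed_def internal_direct_sum_def)
    then obtain v u where v: "v \<in> a_kernel E F f" and u: "u \<in> g ` carrier F"
      and xvu: "x = v \<oplus>\<^bsub>E\<^esub> u"
      by (auto simp: set_add_def set_mult_def)
    have vE: "v \<in> carrier E" using v by (simp add: a_kernel_def')
    have uE: "u \<in> carrier E" using u g by blast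
    have "x = u \<oplus>\<^bsub>E\<^esub> v"
      using xvu uE vE E by (simp add: abelian_group.axioms(1) abelian_monoid.a_comm)
    then show ?thesis
      using h h' u v by (auto simp: is_Ig_def projection_onto_along_def)
  qed
  have "y \<in> set_add F (f ` carrier E) (a_kernel F E g)"
    using cr y by (simp add: crossed_def internal_direct_sum_def)
  then obtain u v where u: "u \<in> f ` carrier E" and v: "v \<in> a_kernel F E g"
    and yuv: "y = u \<oplus>\<^bsub>F\<^esub> v"
    by (auto simp: set_add_def set_mult_def)
  have "f (h y) = u" "f (h' y) = u"
    using h h' u v yuv by (auto simp: is_Ig_def projection_onto_along_def)
  then have "h y = h u" "h' y = h' u"
    using h h' y unfolding is_Ig_def by metis+
  with u eq_im show ?thesis by auto
qed

text \<open>
  The class \<open>comm_ring_1\<close> excludes the trivial ring.  The sort \<open>{comm_ring, comm_monoid_mult}\<close>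
  used below is that of commutative rings with unit, without the axiom \<open>0 \<noteq> 1\<close>.
  \<open>image_module P\<close> is the image of \<open>P\<close>, as a submodule of a free module of column vectors;
  \<open>mult\<close> and \<open>one\<close> are unused fields that module records inherit from ring records.
\<close>

definition image_module :: "'a :: {comm_ring, comm_monoid_mult} mat \<Rightarrow> ('a, 'a vec) module" where
  "image_module P =
     \<lparr>carrier = (\<lambda>v. P *\<^sub>v v) ` carrier_vec (dim_col P), mult = undefined, one = undefined,
      zero = 0\<^sub>v (dim_row P), add = (+), smult = (\<cdot>\<^sub>v)\<rparr>"

text \<open>Linear maps between images of projection matrices are given by matrices, as follows.\<close>

definition projection_mat :: "nat \<Rightarrow> 'a :: {comm_ring, comm_monoid_mult} mat \<Rightarrow> bool" where
  "projection_mat k P \<longleftrightarrow> P \<in> carrier_mat k k \<and> P * P = P"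

definition represents_map ::
  "'a :: {comm_ring, comm_monoid_mult} mat \<Rightarrow> 'a mat \<Rightarrow> 'a mat \<Rightarrow> bool" where
  "represents_map P Q A \<longleftrightarrow> A \<in> carrier_mat (dim_row Q) (dim_row P) \<and> Q * A * P = A"


section \<open>Arithmetic programs with divisibility tests\<close>

definition explicit_divisibility_test ::
  "('a :: {comm_ring, comm_monoid_mult} \<Rightarrow> 'a \<Rightarrow> 'a option) \<Rightarrow> bool" where
  "explicit_divisibility_test dt \<longleftrightarrow>
     (\<forall>x y. case dt x y of None \<Rightarrow> \<not> y dvd x | Some z \<Rightarrow> x = z * y)"

text \<open>
  Programs compute with ring elements, stored in an array \<open>mem\<close> whose addresses \<open>(k, i, j)\<close> are
  read as entry \<open>(i, j)\<close> of the matrix number \<open>k\<close>, and with natural numbers, stored in \<open>idx\<close> and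
  used for loop bounds and addresses.  A program is a finite text that mentions neither the ring nor
  the dimensions of the input; ring elements can influence the control flow only through
  divisibility tests.  Every ring addition, subtraction and multiplication adds one to the counter
  \<open>ops\<close> and every divisibility test adds one to \<open>tests\<close>; programs cannot read these counters.
  Copies, the constants 0 and 1, and arithmetic on indices are not counted.
\<close>

datatype iexp = INum nat | IVar nat | IAdd iexp iexp | ISub iexp iexp | IMul iexp iexp

datatype rexp = RZero | ROne | RCell nat iexp iexp
  | RAdd rexp rexp | RSub rexp rexp | RMul rexp rexp

datatype com =
    Skip
  | Seq com com
  | ISet nat iexp
  | IfLess iexp iexp com com
  | For nat iexp com
  | RSet nat iexp iexp rexp
  | IfDivides rexp rexp nat iexp iexp com com

record 'a state =
  idx :: "nat \<Rightarrow> nat"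
  mem :: "nat \<times> nat \<times> nat \<Rightarrow> 'a"
  ops :: nat
  tests :: nat

primrec ieval :: "iexp \<Rightarrow> (nat \<Rightarrow> nat) \<Rightarrow> nat" where
  "ieval (INum c) v = c"
| "ieval (IVar x) v = v x"
| "ieval (IAdd a b) v = ieval a v + ieval b v"
| "ieval (ISub a b) v = ieval a v - ieval b v"
| "ieval (IMul a b) v = ieval a v * ieval b v"

primrec reval :: "rexp \<Rightarrow> 'a :: {comm_ring, comm_monoid_mult} state \<Rightarrow> 'a" where
  "reval RZero s = 0"
| "reval ROne s = 1"
| "reval (RCell k i j) s = mem s (k, ieval i (idx s), ieval j (idx s))"
| "reval (RAdd a b) s = reval a s + reval b s"
| "reval (RSub a b) s = reval a s - reval b s"
| "reval (RMul a b) s = reval a s * reval b s"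

primrec rcost :: "rexp \<Rightarrow> nat" where
  "rcost RZero = 0"
| "rcost ROne = 0"
| "rcost (RCell k i j) = 0"
| "rcost (RAdd a b) = rcost a + rcost b + 1"
| "rcost (RSub a b) = rcost a + rcost b + 1"
| "rcost (RMul a b) = rcost a + rcost b + 1"

definition store :: "nat \<Rightarrow> iexp \<Rightarrow> iexp \<Rightarrow> 'a \<Rightarrow> 'a state \<Rightarrow> 'a state" where
  "store k i j x s = s\<lparr>mem := (mem s)((k, ieval i (idx s), ieval j (idx s)) := x)\<rparr>"

text \<open>
  \<open>IfDivides a b k i j c d\<close> asks whether \<open>a \<in> \<langle>b\<rangle>\<close>.  If so, it stores the quotient
  returned by the test at \<open>(k, i, j)\<close> and continues with \<open>c\<close>, otherwise with \<open>d\<close>.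
  The bound of a \<open>For\<close> loop is evaluated once, on entry, so every program terminates.
\<close>

primrec exec ::
  "('a :: {comm_ring, comm_monoid_mult} \<Rightarrow> 'a \<Rightarrow> 'a option) \<Rightarrow> com \<Rightarrow> 'a state \<Rightarrow> 'a state" where
  "exec dt Skip = (\<lambda>s. s)"
| "exec dt (Seq c d) = (\<lambda>s. exec dt d (exec dt c s))"
| "exec dt (ISet x e) = (\<lambda>s. s\<lparr>idx := (idx s)(x := ieval e (idx s))\<rparr>)"
| "exec dt (IfLess a b c d) =
     (\<lambda>s. if ieval a (idx s) < ieval b (idx s) then exec dt c s else exec dt d s)"
| "exec dt (For x e c) =
     (\<lambda>s. fold (\<lambda>i s'. exec dt c (s'\<lparr>idx := (idx s')(x := i)\<rparr>)) [0..<ieval e (idx s)] s)"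
| "exec dt (RSet k i j e) = (\<lambda>s. (store k i j (reval e s) s)\<lparr>ops := ops s + rcost e\<rparr>)"
| "exec dt (IfDivides a b k i j c d) =
     (\<lambda>s. let s' = s\<lparr>ops := ops s + rcost a + rcost b, tests := tests s + 1\<rparr>
          in case dt (reval a s) (reval b s) of
               None \<Rightarrow> exec dt d s'
             | Some z \<Rightarrow> exec dt c (store k i j z s'))"

definition holds_mat :: "'a state \<Rightarrow> nat \<Rightarrow> 'a mat \<Rightarrow> bool" where
  "holds_mat s k M \<longleftrightarrow> (\<forall>i<dim_row M. \<forall>j<dim_col M. mem s (k, i, j) = M $$ (i, j))"

text \<open>
  Input: \<open>idx 0\<close> and \<open>idx 1\<close> are the sizes of \<open>P\<close> and \<open>Q\<close>, and the matrices number 0 to 3 are \<open>P\<close>,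
  \<open>Q\<close>, \<open>A\<close>, \<open>B\<close>, where \<open>A\<close> represents the map from the image of \<open>P\<close> to that of \<open>Q\<close> and \<open>B\<close> the map in the
  opposite direction.  The remaining contents of the memory are arbitrary.
\<close>

definition input_state :: "'a state \<Rightarrow> 'a mat \<Rightarrow> 'a mat \<Rightarrow> 'a mat \<Rightarrow> 'a mat \<Rightarrow> bool" where
  "input_state s P Q A B \<longleftrightarrow>
     idx s 0 = dim_row P \<and> idx s 1 = dim_row Q \<and>
     holds_mat s 0 P \<and> holds_mat s 1 Q \<and> holds_mat s 2 A \<and> holds_mat s 3 B \<and>
     ops s = 0 \<and> tests s = 0"

text \<open>Output: the decision is read off from \<open>idx 2\<close>, the computed maps from matrices number 4 and 5.\<close>

definition accepts :: "'a state \<Rightarrow> bool" where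
  "accepts s \<longleftrightarrow> idx s 2 = 1"

definition result_mat :: "'a state \<Rightarrow> nat \<Rightarrow> nat \<Rightarrow> nat \<Rightarrow> 'a mat" where
  "result_mat s k nr nc = mat nr nc (\<lambda>(i, j). mem s (k, i, j))"

end

theory Submission
  imports Defs "Jordan_Normal_Form.Char_Poly"
begin

text \<open>
  Write \<open>u = B A\<close>.  The decision rests on a certificate: a matrix \<open>e = \<Sum>\<^sub>i a\<^sub>i u\<^sup>i\<^sup>+\<^sup>1\<close>, a polynomial
  in \<open>u\<close> without constant term, with \<open>A e = A\<close> and \<open>e B = B\<close>.  If there is one, the maps are
  crossed: \<open>e\<close> is the projection onto the image of \<open>B\<close> along the kernel of \<open>A\<close>, the matrix
  \<open>x = \<Sum>\<^sub>i a\<^sub>i u\<^sup>i e\<close> satisfies \<open>u x = x u = e\<close>, and the two generalized inverses are \<open>x B\<close> and \<open>A x\<close>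
  (\<open>certificate_sound\<close>).  Both equations are checked entry by entry with tests \<open>z \<in> \<langle>0\<rangle>\<close>.  Whatever the
  coefficients are, a positive answer is therefore right, and what remains is to compute
  coefficients that work whenever the maps are crossed (\<open>poly_act_crossed\<close>).

  If they are crossed, then \<open>u = u\<^sup>2 w = u w u\<close> for some matrix \<open>w\<close>.  With the idempotent
  \<open>f = u w\<close>, the characteristic polynomial factors as \<open>det (s - u) = R(s) C(s)\<close>, where
  \<open>R(s) = det (f + s (1 - f))\<close> and \<open>C(s) = det (1 - f + s f - u)\<close>.  The value \<open>d = C(0)\<close> is a unit, and
  the coefficients \<open>r\<^sub>0, r\<^sub>1, \<dots>\<close> of \<open>R\<close> are orthogonal idempotents with sum 1, because
  \<open>R(s) R(t) = R(s t)\<close> and \<open>R(1) = 1\<close>.  On the component of the ring cut out by \<open>r\<^sub>j\<close> the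
  characteristic polynomial is \<open>s\<^sup>j C(s)\<close>, so its coefficients satisfy \<open>r\<^sub>j c\<^sub>k = 0\<close> for \<open>k < j\<close> and
  \<open>r\<^sub>j c\<^sub>j = r\<^sub>j d\<close>.  By Cayley-Hamilton, and since \<open>u\<^sup>2\<close> can be cancelled to \<open>u\<close>,
  \<open>r\<^sub>j (c\<^sub>j u + c\<^sub>j\<^sub>+\<^sub>1 u\<^sup>2 + \<dots>) = 0\<close> (\<open>group_invertible_idempotents\<close>).  Hence
  \<open>e = - \<Sum>\<^sub>j r\<^sub>j d\<^sup>-\<^sup>1 (c\<^sub>j\<^sub>+\<^sub>1 u + c\<^sub>j\<^sub>+\<^sub>2 u\<^sup>2 + \<dots>)\<close> satisfies \<open>u e = u\<close>, and it is a certificate.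
  The products \<open>r\<^sub>j d\<^sup>-\<^sup>1\<close> are found one after the other: \<open>(1 - r\<^sub>0 - \<dots> - r\<^sub>j\<^sub>-\<^sub>1) c\<^sub>j = r\<^sub>j d\<close>, and one
  test \<open>y \<in> \<langle>y\<^sup>2\<rangle>\<close> for this element \<open>y\<close> returns an inverse of it on the component \<open>r\<^sub>j\<close>
  (\<open>greedy_step\<close>).  So the search uses \<open>p + 1\<close> tests and the verification \<open>2 p q\<close>.

  The characteristic polynomial is computed without divisions.  The entry \<open>(k, k)\<close> of the adjugate
  of \<open>s - L\<close>, where \<open>L\<close> is the leading block of size \<open>k + 1\<close>, is the characteristic polynomial of the
  leading block of size \<open>k\<close>, and the coefficients of this adjugate are combinations of powers of
  \<open>L\<close>.  This relates consecutive blocks by a triangular linear system (\<open>char_coeff_leading_block\<close>),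
  and only one column of each power is needed.  Each of the \<open>p\<close> blocks thus costs \<open>O(p\<^sup>3)\<close>
  operations, and so does each of the \<open>p\<close> steps of the Horner scheme that evaluates \<open>e\<close> and \<open>x\<close>.
\<close>

section \<open>Characteristic polynomials of leading blocks\<close>

text \<open>
  Powers are described by their entries, so that they also make sense over the zero ring.
\<close>

primrec mat_power_entry :: "'a :: {comm_ring, comm_monoid_mult} mat \<Rightarrow> nat \<Rightarrow> nat \<Rightarrow> nat \<Rightarrow> 'a" where
  "mat_power_entry A 0 i j = (if i = j then 1 else 0)"
| "mat_power_entry A (Suc l) i j = (\<Sum>k<dim_row A. A $$ (i, k) * mat_power_entry A l k j)"

definition leading_block :: "'a mat \<Rightarrow> nat \<Rightarrow> 'a mat" where
  "leading_block A k = mat k k (\<lambda>(i, j). A $$ (i, j))"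

lemma leading_block_simps [simp]:
  "dim_row (leading_block A k) = k" "dim_col (leading_block A k) = k"
  "leading_block A k \<in> carrier_mat k k"
  "i < k \<Longrightarrow> j < k \<Longrightarrow> leading_block A k $$ (i, j) = A $$ (i, j)"
  by (simp_all add: leading_block_def)

lemma leading_block_full: "A \<in> carrier_mat n n \<Longrightarrow> leading_block A n = A"
  by (rule eq_matI) auto

definition char_coeff :: "'a :: comm_ring_1 mat \<Rightarrow> nat \<Rightarrow> 'a" where
  "char_coeff A k = coeff (char_poly A) k"

lemma char_coeff_beyond: "A \<in> carrier_mat n n \<Longrightarrow> n < k \<Longrightarrow> char_coeff A k = 0"
  unfolding char_coeff_def using degree_monic_char_poly coeff_eq_0 by metis

lemma char_coeff_top: "A \<in> carrier_mat n n \<Longrightarrow> char_coeff A n = 1"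
  unfolding char_coeff_def using degree_monic_char_poly by metis

text \<open>
  The equation \<open>(s - A) M = det (s - A)\<close> for the adjugate \<open>M\<close>, at the entry \<open>(i, j)\<close>.  Comparing
  coefficients of powers of \<open>s\<close> in it gives the next two lemmas.
\<close>

lemma adj_char_poly_entry:
  fixes A :: "'a :: comm_ring_1 mat"
  assumes A: "A \<in> carrier_mat n n" and ij: "i < n" "j < n"
  defines "B \<equiv> adj_mat (char_poly_matrix A)"
  shows "pCons 0 (B $$ (i, j)) - (\<Sum>k<n. Polynomial.smult (A $$ (i, k)) (B $$ (k, j)))
    = (if i = j then char_poly A else 0)"
proof -
  have C: "char_poly_matrix A \<in> carrier_mat n n" using A by simp
  have B: "B \<in> carrier_mat n n" unfolding B_def by (rule adj_mat(1)[OF C])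
  have "(char_poly_matrix A * B) $$ (i, j) = (if i = j then char_poly A else 0)"
    unfolding B_def adj_mat(2)[OF C] char_poly_def using ij by simp
  moreover have "(char_poly_matrix A * B) $$ (i, j)
      = (\<Sum>k<n. char_poly_matrix A $$ (i, k) * B $$ (k, j))"
    using C B ij by (auto simp: scalar_prod_def intro!: sum.cong)
  moreover have "\<dots> = (\<Sum>k<n. (if i = k then pCons 0 (B $$ (k, j)) else 0)
      - Polynomial.smult (A $$ (i, k)) (B $$ (k, j)))"
    using A ij by (intro sum.cong) (auto simp: char_poly_matrix_def algebra_simps)
  moreover have "\<dots> = pCons 0 (B $$ (i, j)) - (\<Sum>k<n. Polynomial.smult (A $$ (i, k)) (B $$ (k, j)))"
    using ij by (simp add: sum_subtractf)
  ultimately show ?thesis by simp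
qed

text \<open>
  The comparison gives \<open>M\<^sub>l = c\<^sub>l\<^sub>+\<^sub>1 + A M\<^sub>l\<^sub>+\<^sub>1\<close> for the coefficient matrices \<open>M\<^sub>l\<close> of the adjugate.  As
  \<open>M\<^sub>l = 0\<close> for large \<open>l\<close>, the formula follows by descending induction.
\<close>

lemma coeff_adj_char_poly:
  fixes A :: "'a :: comm_ring_1 mat"
  assumes A: "A \<in> carrier_mat n n" and ij: "i < n" "j < n"
  shows "coeff (adj_mat (char_poly_matrix A) $$ (i, j)) l
    = (\<Sum>m<n - l. char_coeff A (Suc (l + m)) * mat_power_entry A m i j)"
proof -
  define B where "B = adj_mat (char_poly_matrix A)"
  have rec: "coeff (B $$ (i, j)) l = (if i = j then char_coeff A (Suc l) else 0)
      + (\<Sum>k<n. A $$ (i, k) * coeff (B $$ (k, j)) (Suc l))" if "i < n" for i l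
  proof -
    have "coeff (pCons 0 (B $$ (i, j)) - (\<Sum>k<n. Polynomial.smult (A $$ (i, k)) (B $$ (k, j)))) (Suc l)
      = coeff (if i = j then char_poly A else 0) (Suc l)"
      using adj_char_poly_entry[OF A that ij(2)] by (simp add: B_def)
    then show ?thesis by (auto simp: coeff_sum char_coeff_def algebra_simps split: if_splits)
  qed
  \<comment> \<open>A bound for the degrees of the entries of column \<open>j\<close>, and also above \<open>n\<close> and \<open>l\<close>.\<close>
  define N where "N = Suc (n + l + Max ((\<lambda>i. degree (B $$ (i, j))) ` {..<n}))"
  have big: "coeff (B $$ (i, j)) N = 0" if "i < n" for i
  proof (rule coeff_eq_0)
    have "degree (B $$ (i, j)) \<le> Max ((\<lambda>i. degree (B $$ (i, j))) ` {..<n})"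
      using that by (intro Max_ge) auto
    then show "degree (B $$ (i, j)) < N" by (simp add: N_def)
  qed
  have "\<forall>i<n. coeff (B $$ (i, j)) l
      = (\<Sum>m<N - l. char_coeff A (Suc (l + m)) * mat_power_entry A m i j)"
    if "l \<le> N" for l
    using that
  proof (induction rule: inc_induct)
    case base
    then show ?case using big by simp
  next
    case (step l)
    then have N: "N - l = Suc (N - Suc l)" by simp
    show ?case
    proof (intro allI impI)
      fix i assume i: "i < n"
      have "(\<Sum>k<n. A $$ (i, k) * coeff (B $$ (k, j)) (Suc l))
        = (\<Sum>k<n. \<Sum>m<N - Suc l. char_coeff A (Suc (Suc l + m)) * (A $$ (i, k) * mat_power_entry A m k j))"
        using step.IH by (intro sum.cong) (auto simp: sum_distrib_left algebra_simps)
      also have "\<dots> = (\<Sum>m<N - Suc l. char_coeff A (Suc (l + Suc m)) * mat_power_entry A (Suc m) i j)"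
        using A by (subst sum.swap) (simp add: sum_distrib_left)
      finally show "coeff (B $$ (i, j)) l
          = (\<Sum>m<N - l. char_coeff A (Suc (l + m)) * mat_power_entry A m i j)"
        unfolding N sum.lessThan_Suc_shift using rec[OF i, of l] by (simp del: mat_power_entry.simps(2))
    qed
  qed
  then have "coeff (B $$ (i, j)) l
      = (\<Sum>m<N - l. char_coeff A (Suc (l + m)) * mat_power_entry A m i j)"
    using ij by (simp add: N_def)
  also have "\<dots> = (\<Sum>m<n - l. char_coeff A (Suc (l + m)) * mat_power_entry A m i j)"
    by (rule sum.mono_neutral_right) (auto simp: N_def char_coeff_beyond[OF A])
  finally show ?thesis by (simp add: B_def)
qed

lemma Cayley_Hamilton_entry:
  fixes A :: "'a :: comm_ring_1 mat"
  assumes A: "A \<in> carrier_mat n n" and ij: "i < n" "j < n"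
  shows "(\<Sum>m\<le>n. char_coeff A m * mat_power_entry A m i j) = 0"
proof -
  define B where "B = adj_mat (char_poly_matrix A)"
  have "coeff (pCons 0 (B $$ (i, j)) - (\<Sum>k<n. Polynomial.smult (A $$ (i, k)) (B $$ (k, j)))) 0
      = coeff (if i = j then char_poly A else 0) 0"
    using adj_char_poly_entry[OF A ij] by (simp add: B_def)
  then have c0: "(if i = j then char_coeff A 0 else 0) = - (\<Sum>k<n. A $$ (i, k) * coeff (B $$ (k, j)) 0)"
    by (simp add: coeff_sum char_coeff_def split: if_splits)
  have "0 = (if i = j then char_coeff A 0 else 0) + (\<Sum>k<n. A $$ (i, k) * coeff (B $$ (k, j)) 0)"
    unfolding c0 by simp
  also have "(\<Sum>k<n. A $$ (i, k) * coeff (B $$ (k, j)) 0)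
      = (\<Sum>k<n. \<Sum>m<n. char_coeff A (Suc m) * (A $$ (i, k) * mat_power_entry A m k j))"
    unfolding B_def
    by (intro sum.cong) (auto simp: coeff_adj_char_poly[OF A _ ij(2)] sum_distrib_left algebra_simps)
  also have "\<dots> = (\<Sum>m<n. char_coeff A (Suc m) * mat_power_entry A (Suc m) i j)"
    using A by (subst sum.swap) (simp add: sum_distrib_left)
  finally show ?thesis
    unfolding lessThan_Suc_atMost[symmetric] sum.lessThan_Suc_shift
    by (simp del: mat_power_entry.simps(2) split: if_splits)
qed

text \<open>
  Deleting the last row and column of \<open>s - L\<close> leaves the matrix for the smaller block, which gives
  the case \<open>m \<le> k\<close>.  The case \<open>m = k + 1\<close> is the Cayley-Hamilton equation at the entry \<open>(k, k)\<close>, and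
  the value \<open>0\<close> on its left is what a zero-initialised array contains there.
\<close>

lemma char_coeff_leading_block:
  fixes A :: "'a :: comm_ring_1 mat"
  assumes m: "m \<le> Suc k"
  defines "L \<equiv> leading_block A (Suc k)"
  shows "(if m \<le> k then char_coeff (leading_block A k) (k - m) else 0)
    = (\<Sum>l\<le>m. char_coeff L (Suc k - (m - l)) * mat_power_entry L l k k)"
proof (cases "m \<le> k")
  case True
  have L: "L \<in> carrier_mat (Suc k) (Suc k)" by (simp add: L_def)
  have "mat_delete (char_poly_matrix L) k k = char_poly_matrix (leading_block A k)"
    by (rule eq_matI) (auto simp: mat_delete_def char_poly_matrix_def L_def)
  then have "adj_mat (char_poly_matrix L) $$ (k, k) = char_poly (leading_block A k)"
    by (simp add: adj_mat_def cofactor_def char_poly_def L_def char_poly_matrix_def)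
  then have "char_coeff (leading_block A k) (k - m)
    = (\<Sum>l<Suc k - (k - m). char_coeff L (Suc (k - m + l)) * mat_power_entry L l k k)"
    using coeff_adj_char_poly[OF L, of k k "k - m"] by (simp add: char_coeff_def)
  also have "\<dots> = (\<Sum>l\<le>m. char_coeff L (Suc k - (m - l)) * mat_power_entry L l k k)"
    using True by (intro sum.cong) (auto simp: Suc_diff_le)
  finally show ?thesis using True by simp
next
  case False
  then have m': "m = Suc k" using m by simp
  have "(\<Sum>l\<le>Suc k. char_coeff L l * mat_power_entry L l k k) = 0"
    by (rule Cayley_Hamilton_entry) (simp_all add: L_def)
  then show ?thesis using m' by (simp del: mat_power_entry.simps(2))
qed

section \<open>Orthogonal idempotents of a group invertible matrix\<close>

text \<open>
  The hypothesis allows \<open>A\<^sup>l\<^sup>+\<^sup>2 W = A\<^sup>l\<^sup>+\<^sup>1\<close>: powers can be cancelled down to exponent 1, but not to 0.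
\<close>

lemma mat_power_entry_cancel:
  assumes A: "A \<in> carrier_mat n n" and V: "V \<in> carrier_mat n n" and W: "W \<in> carrier_mat n n"
    and cancel: "A * (A * W) = A" and i: "i < n" and j: "j < n"
  shows "(\<Sum>k<n. mat_power_entry A (Suc (Suc l)) i k * W $$ (k, j)) = mat_power_entry A (Suc l) i j"
  using i
proof (induction l arbitrary: i)
  case 0
  have one: "mat_power_entry A (Suc 0) i k = A $$ (i, k)" if "k < n" "i < n" for i k
    using A that by (simp add: if_distrib[of "\<lambda>x. _ * x"] sum.delta cong: if_cong)
  have "(A * (A * W)) $$ (i, j) = (\<Sum>k<n. \<Sum>l<n. A $$ (i, l) * (A $$ (l, k) * W $$ (k, j)))"
    using A W 0 j by (subst sum.swap) (auto simp: scalar_prod_def sum_distrib_left atLeast0LessThan intro!: sum.cong)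
  also have "\<dots> = (\<Sum>k<n. mat_power_entry A (Suc (Suc 0)) i k * W $$ (k, j))"
    using A one by (intro sum.cong) (auto simp: mat_power_entry.simps(2)[of _ "Suc 0"] sum_distrib_left ac_simps simp del: mat_power_entry.simps(2))
  finally show ?case using cancel one[OF j 0] by simp
next
  case (Suc l)
  have "(\<Sum>k<n. mat_power_entry A (Suc (Suc (Suc l))) i k * W $$ (k, j))
    = (\<Sum>m<n. A $$ (i, m) * (\<Sum>k<n. mat_power_entry A (Suc (Suc l)) m k * W $$ (k, j)))"
    unfolding mat_power_entry.simps(2)[of A "Suc (Suc l)"] sum_distrib_left sum_distrib_right
    using A by (subst sum.swap) (simp only: carrier_matD mult.assoc)
  also have "\<dots> = (\<Sum>m<n. A $$ (i, m) * mat_power_entry A (Suc l) m j)"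
    using Suc.IH by simp
  also have "\<dots> = mat_power_entry A (Suc (Suc l)) i j"
    using A by (subst mat_power_entry.simps(2)[of A "Suc l"]) simp
  finally show ?case .
qed

text \<open>
  Two independent variables \<open>s\<close> and \<open>t\<close> in \<open>R(s) R(t) = R(s t)\<close> would identify the coefficients at
  once.  One variable is enough with \<open>s = X\<close> and \<open>t = X\<^sup>N\<close> for \<open>N\<close> above the degree, because then
  every exponent has at most one expression \<open>i + N j\<close> with \<open>i < N\<close>.
\<close>

lemma idempotent_coeffs:
  fixes R :: "'a :: comm_ring_1 poly"
  assumes mult: "\<And>x y :: 'a poly. pcompose R x * pcompose R y = pcompose R (x * y)"
  shows "coeff R i * coeff R j = (if i = j then coeff R i else 0)"
proof -
  define N where "N = Suc (degree R + i + j)"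
  have comp: "pcompose R (monom 1 d) = (\<Sum>k<N. monom (coeff R k) (d * k))" for d
  proof -
    have "pcompose R (monom 1 d) = (\<Sum>k\<le>degree R. monom (coeff R k) (d * k))"
      by (simp add: pcompose_altdef poly_altdef coeff_map_poly degree_map_poly monom_power smult_monom)
    also have "\<dots> = (\<Sum>k<N. monom (coeff R k) (d * k))"
      by (rule sum.mono_neutral_left) (auto simp: N_def coeff_eq_0)
    finally show ?thesis .
  qed
  have uniq: "a + N * b = i + N * j \<longleftrightarrow> a = i \<and> b = j" if "a < N" for a b
  proof -
    have i: "i < N" by (simp add: N_def)
    have "(a + N * b) mod N = a" "(i + N * j) mod N = i" using that i by simp_all
    moreover have "(a + N * b) div N = b" "(i + N * j) div N = j" using that i by simp_all
    ultimately show ?thesis by metis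
  qed
  have "pcompose R (monom 1 1) * pcompose R (monom 1 N) = pcompose R (monom 1 (Suc N))"
    using mult[of "monom 1 1" "monom 1 N"] by (simp add: mult_monom)
  then have "coeff ((\<Sum>a<N. monom (coeff R a) (1 * a)) * (\<Sum>b<N. monom (coeff R b) (N * b))) (i + N * j)
    = coeff (\<Sum>k<N. monom (coeff R k) (Suc N * k)) (i + N * j)"
    unfolding comp by simp
  moreover have "coeff ((\<Sum>a<N. monom (coeff R a) (1 * a)) * (\<Sum>b<N. monom (coeff R b) (N * b))) (i + N * j)
    = (\<Sum>a<N. \<Sum>b<N. if a + N * b = i + N * j then coeff R a * coeff R b else 0)"
    by (simp add: sum_product mult_monom coeff_sum)
  moreover have "\<dots> = (\<Sum>a<N. \<Sum>b<N. if a = i then if b = j then coeff R a * coeff R b else 0 else 0)"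
    using uniq by (intro sum.cong) auto
  moreover have "\<dots> = (\<Sum>a<N. if a = i then (\<Sum>b<N. if b = j then coeff R a * coeff R b else 0) else 0)"
    by (intro sum.cong) auto
  moreover have "\<dots> = coeff R i * coeff R j"
    by (simp add: N_def)
  moreover have "coeff (\<Sum>k<N. monom (coeff R k) (Suc N * k)) (i + N * j)
    = (\<Sum>k<N. if k = i then if i = j then coeff R i else 0 else 0)"
    unfolding coeff_sum using uniq by (intro sum.cong) auto
  moreover have "\<dots> = (if i = j then coeff R i else 0)" by (simp add: N_def)
  ultimately show ?thesis by presburger
qed

text \<open>
  This makes \<open>x \<mapsto> e + x (1 - e)\<close> multiplicative, and so is its determinant \<open>R\<close>.
\<close>

lemma scaling_along_idempotent_mult:
  fixes e :: "'a :: comm_ring_1 mat" and x y :: 'a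
  assumes e: "e \<in> carrier_mat n n" and ee: "e * e = e"
  shows "(e + x \<cdot>\<^sub>m (1\<^sub>m n - e)) * (e + y \<cdot>\<^sub>m (1\<^sub>m n - e)) = e + (x * y) \<cdot>\<^sub>m (1\<^sub>m n - e)"
proof -
  define f where "f = 1\<^sub>m n - e"
  have f: "f \<in> carrier_mat n n" using e by (simp add: f_def minus_carrier_mat)
  have ef: "e * f = 0\<^sub>m n n" using e by (simp add: f_def mult_minus_distrib_mat[OF e _ e] ee)
  have fe: "f * e = 0\<^sub>m n n" using e by (simp add: f_def minus_mult_distrib_mat[OF _ e e] ee)
  have ff: "f * f = f" 
  proof -
    have "f * f = f * 1\<^sub>m n - f * e" unfolding f_def[of]
      by (rule mult_minus_distrib_mat[of _ n n]) (use e in auto)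
    moreover have "f - 0\<^sub>m n n = f" using f by (intro eq_matI) auto
    ultimately show ?thesis using f fe by simp
  qed
  define N where "N = e + y \<cdot>\<^sub>m f"
  have N: "N \<in> carrier_mat n n" using e f by (simp add: N_def)
  have expand: "M * N = M * e + y \<cdot>\<^sub>m (M * f)" if "M \<in> carrier_mat n n" for M
    unfolding N_def using mult_add_distrib_mat[OF that e, of "y \<cdot>\<^sub>m f"] mult_smult_distrib[OF that f] f by simp
  have "(e + x \<cdot>\<^sub>m f) * N = e * N + x \<cdot>\<^sub>m (f * N)"
    using add_mult_distrib_mat[of e n n "x \<cdot>\<^sub>m f" N n] mult_smult_assoc_mat[OF f N] e f N by simp
  also have "\<dots> = e + (x * y) \<cdot>\<^sub>m f"
    unfolding expand[OF e] expand[OF f] ee ef fe ff using e f by (intro eq_matI) (auto simp: mult.assoc)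
  finally show ?thesis by (simp add: N_def f_def)
qed

text \<open>
  On the component \<open>r j\<close>, the kernel of \<open>u\<close> has rank \<open>j\<close>: the lowest coefficient of the
  characteristic polynomial \<open>\<Sum>\<^sub>k c k s\<^sup>k\<close> there is the unit \<open>d\<close> at degree \<open>j\<close>, and Cayley-Hamilton
  holds with \<open>u\<^sup>j\<close> reduced to \<open>u\<close>.
\<close>

definition rank_idempotents ::
  "'a :: {comm_ring, comm_monoid_mult} mat \<Rightarrow> nat \<Rightarrow> (nat \<Rightarrow> 'a) \<Rightarrow> (nat \<Rightarrow> 'a) \<Rightarrow> 'a \<Rightarrow> 'a \<Rightarrow> bool" where
  "rank_idempotents u n c r d d' \<longleftrightarrow> d * d' = 1 \<and> (\<Sum>j\<le>n. r j) = 1 \<and>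
    (\<forall>i j. r i * r j = (if i = j then r i else 0)) \<and>
    (\<forall>j k. k < j \<longrightarrow> k \<le> n \<longrightarrow> r j * c k = 0) \<and> (\<forall>j\<le>n. r j * c j = r j * d) \<and>
    (\<forall>j\<le>n. \<forall>a<n. \<forall>b<n. (\<Sum>m\<le>n - j. r j * c (j + m) * mat_power_entry u (Suc m) a b) = 0)"

lemma group_invertible_idempotents:
  fixes U W :: "'a :: comm_ring_1 mat"
  assumes U: "U \<in> carrier_mat n n" and W: "W \<in> carrier_mat n n"
    and UUW: "U * (U * W) = U" and UWU: "U * W * U = U"
  defines "c \<equiv> char_coeff U"
  shows "\<exists>r d d'. rank_idempotents U n c r d d'"
proof -
  define e where "e = U * W"
  have e: "e \<in> carrier_mat n n" using U W by (simp add: e_def)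
  have Ue: "U * e = U" and eU: "e * U = U" using UUW UWU by (simp_all add: e_def)
  note [simp] = carrier_matD[OF e] carrier_matD[OF U] carrier_matD[OF W]
  have ee: "e * e = e"
    using assoc_mult_mat[OF e U W] unfolding e_def[symmetric] eU by simp
  interpret cst: comm_ring_hom "\<lambda>a :: 'a. [:a:]"
    by unfold_locales (auto simp: one_pCons)
  define E where "E = map_mat (\<lambda>a. [:a:]) e"
  define V where "V = map_mat (\<lambda>a. [:a:]) U"
  define X :: "'a poly" where "X = [:0, 1:]"
  define f where "f = 1\<^sub>m n - E"
  define Q where "Q = (\<lambda>x. E + x \<cdot>\<^sub>m (1\<^sub>m n - E))"
  define F where "F = f + X \<cdot>\<^sub>m E - V"
  have carr [simp]: "E \<in> carrier_mat n n" "V \<in> carrier_mat n n" "f \<in> carrier_mat n n"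
      "Q x \<in> carrier_mat n n" "F \<in> carrier_mat n n" for x
    using e U by (simp_all add: E_def V_def f_def Q_def F_def minus_carrier_mat)
  note [simp] = carr[THEN carrier_matD(1)] carr[THEN carrier_matD(2)]
  have EE: "E * E = E" unfolding E_def cst.mat_hom_mult[OF e e, symmetric] ee ..
  have EV: "E * V = V" unfolding E_def V_def cst.mat_hom_mult[OF e U, symmetric] eU ..
  have zero: "A - A = 0\<^sub>m n n" if "A \<in> carrier_mat n n" for A :: "'a poly mat"
    using that by (intro eq_matI) auto
  have Ef: "E * f = 0\<^sub>m n n" unfolding f_def
    using mult_minus_distrib_mat[of E n n "1\<^sub>m n" n E] by (simp add: EE zero)
  have fM: "f * M = M - E * M" if "M \<in> carrier_mat n n" for M
    unfolding f_def using minus_mult_distrib_mat[of "1\<^sub>m n" n n E M n] that by simp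
  have fE: "f * E = 0\<^sub>m n n" and fV: "f * V = 0\<^sub>m n n" and ff: "f * f = f"
    by (simp_all add: fM EE EV Ef zero) (rule eq_matI, auto simp: f_def E_def e)
  \<comment> \<open>The factorisation \<open>s - u = (e + s (1 - e)) (1 - e + s e - u)\<close>.\<close>
  have factor: "Q X * F = char_poly_matrix U"
  proof -
    have "Q X * F = E * F + X \<cdot>\<^sub>m (f * F)"
      unfolding Q_def f_def[symmetric]
      using add_mult_distrib_mat[of E n n "X \<cdot>\<^sub>m f" F n] mult_smult_assoc_mat[of f n n F n X] by simp
    moreover have "E * F = X \<cdot>\<^sub>m E - V" "f * F = f"
    proof -
      have expand: "M * F = M * f + X \<cdot>\<^sub>m (M * E) - M * V" if "M \<in> carrier_mat n n" for M
        unfolding F_def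
        using mult_minus_distrib_mat[of M n n "f + X \<cdot>\<^sub>m E" n V] mult_add_distrib_mat[of M n n f n "X \<cdot>\<^sub>m E"]
          mult_smult_distrib[of M n n E n X] that by simp
      show "E * F = X \<cdot>\<^sub>m E - V" "f * F = f"
        unfolding expand[OF carr(1)] expand[OF carr(3)] EE EV Ef ff fE fV
        by (intro eq_matI, auto)+
    qed
    moreover have "X \<cdot>\<^sub>m E - V + X \<cdot>\<^sub>m f = char_poly_matrix U"
      using e U by (intro eq_matI)
        (auto simp: char_poly_matrix_def X_def E_def V_def f_def algebra_simps)
    ultimately show ?thesis by simp
  qed
  define R where "R = det (Q X)"
  define C where "C = det F"
  have chi: "char_poly U = R * C"
    unfolding char_poly_def factor[symmetric] R_def C_def by (rule det_mult) auto
  have comp: "pcompose R y = det (Q y)" for y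
  proof -
    have *: "map_mat (\<lambda>q. pcompose q y) (Q X) = Q y"
      using e by (intro eq_matI)
        (auto simp: Q_def E_def X_def pcompose_add pcompose_mult pcompose_diff pcompose_pCons pcompose_1)
    show ?thesis unfolding R_def using * comm_ring_hom.hom_det[OF pcompose_hom.comm_ring_hom_axioms] by metis
  qed
  define r where "r = coeff R"
  have orth: "r i * r j = (if i = j then r i else 0)" for i j
    unfolding r_def
  proof (rule idempotent_coeffs)
    show "pcompose R x * pcompose R y = pcompose R (x * y)" for x y
      unfolding comp using det_mult[of "Q x" n "Q y"] scaling_along_idempotent_mult[of E n x y]
      by (simp add: Q_def EE minus_carrier_mat)
  qed
  have rc: "r j * c k = (if j \<le> k then r j * coeff C (k - j) else 0)" for j k
  proof -
    have "r j * c k = (\<Sum>i\<le>k. (r j * r i) * coeff C (k - i))"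
      by (simp add: c_def char_coeff_def chi coeff_mult r_def sum_distrib_left mult.assoc)
    also have "\<dots> = (\<Sum>i\<le>k. if i = j then r j * coeff C (k - j) else 0)"
      by (intro sum.cong) (auto simp: orth)
    finally show ?thesis by simp
  qed
  have r_beyond: "r j = 0" if "n < j" for j
    using rc[of j n] char_coeff_top[OF U] that by (simp add: c_def)
  have "poly R 1 = 1"
  proof -
    have *: "map_mat (\<lambda>q. poly q 1) (Q X) = 1\<^sub>m n"
      using e by (intro eq_matI) (auto simp: Q_def E_def X_def)
    show ?thesis using * comm_ring_hom.hom_det[OF poly_hom.comm_ring_hom_axioms, of 1 "Q X"] by (simp add: R_def)
  qed
  moreover have "poly R 1 = (\<Sum>j\<le>n. r j)"
  proof -
    have "poly R 1 = (\<Sum>j\<le>degree R + n. r j)"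
      unfolding poly_altdef r_def by (simp, rule sum.mono_neutral_left) (auto simp: coeff_eq_0)
    also have "\<dots> = (\<Sum>j\<le>n. r j)"
      by (rule sum.mono_neutral_right) (auto simp: r_beyond)
    finally show ?thesis .
  qed
  ultimately have sum1: "(\<Sum>j\<le>n. r j) = 1" by simp
  \<comment> \<open>\<open>C(0) = det (1 - e - u)\<close> is a unit: an explicit right inverse is \<open>(1 - e + e w e) (1 - 2 e)\<close>.\<close>
  define g where "g = 1\<^sub>m n - e"
  have g: "g \<in> carrier_mat n n" using e by (simp add: g_def minus_carrier_mat)
  have zero': "A - A = 0\<^sub>m n n" "A - 0\<^sub>m n n = A" if "A \<in> carrier_mat n n" for A :: "'a mat"
    using that by (intro eq_matI; auto)+
  have gM: "g * M = M - e * M" and Mg: "M * g = M - M * e" if "M \<in> carrier_mat n n" for M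
    unfolding g_def using minus_mult_distrib_mat[of "1\<^sub>m n" n n e M n]
      mult_minus_distrib_mat[of M n n "1\<^sub>m n" n e] that e by simp_all
  have ge: "g * e = 0\<^sub>m n n" and eg: "e * g = 0\<^sub>m n n" and Ug: "U * g = 0\<^sub>m n n"
    by (simp_all add: gM Mg e U ee Ue zero')
  have gg: "g * g = g" using gM[OF g] eg g by (simp add: zero')
  define Y where "Y = e * (W * e)"
  have Y: "Y \<in> carrier_mat n n" using e W by (simp add: Y_def)
  have gY: "g * Y = 0\<^sub>m n n"
    using assoc_mult_mat[OF g e, of "W * e" n] ge W e by (simp add: Y_def)
  have UY: "U * Y = e"
  proof -
    have "U * Y = U * (W * e)" using assoc_mult_mat[OF U e, of "W * e" n] Ue W e by (simp add: Y_def)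
    also have "\<dots> = e" using assoc_mult_mat[OF U W e] by (simp add: e_def[symmetric] ee)
    finally show ?thesis .
  qed
  have "(g - U) * (g + Y) = g - e"
  proof -
    have "(g - U) * (g + Y) = g * (g + Y) - U * (g + Y)"
      using minus_mult_distrib_mat[OF g U, of "g + Y" n] g Y by simp
    also have "g * (g + Y) = g"
      using mult_add_distrib_mat[OF g g Y] gg gY g by simp
    also have "U * (g + Y) = e"
      using mult_add_distrib_mat[OF U g Y] Ug UY e by simp
    finally show ?thesis .
  qed
  moreover have "(g - e) * (g - e) = 1\<^sub>m n"
  proof -
    have "(g - e) * (g - e) = g * (g - e) - e * (g - e)"
      using minus_mult_distrib_mat[OF g e, of "g - e" n] g e by (simp add: minus_carrier_mat)
    also have "g * (g - e) = g" using mult_minus_distrib_mat[OF g g e] gg ge g by (simp add: zero')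
    also have "e * (g - e) = - e" using mult_minus_distrib_mat[OF e g e] eg ee e
      by (simp) (intro eq_matI, auto)
    also have "g - - e = 1\<^sub>m n" using e by (intro eq_matI) (auto simp: g_def)
    finally show ?thesis .
  qed
  ultimately have "(g - U) * ((g + Y) * (g - e)) = 1\<^sub>m n"
    using assoc_mult_mat[of "g - U" n n "g + Y" n "g - e" n] g U Y e by (simp add: minus_carrier_mat)
  then have "det (g - U) * det ((g + Y) * (g - e)) = 1"
    using det_mult[of "g - U" n "(g + Y) * (g - e)"] g U Y e
    by (simp add: minus_carrier_mat mult_carrier_mat[of _ n n])
  moreover have "coeff C 0 = det (g - U)"
  proof -
    have *: "map_mat (\<lambda>q. poly q 0) F = g - U"
      using e U by (intro eq_matI) (auto simp: F_def f_def g_def E_def V_def X_def)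
    show ?thesis using * comm_ring_hom.hom_det[OF poly_hom.comm_ring_hom_axioms, of 0 F] by (simp add: C_def poly_0_coeff_0)
  qed
  ultimately have unit: "coeff C 0 * det ((g + Y) * (g - e)) = 1" by simp
  have "(\<Sum>m\<le>n - j. r j * c (j + m) * mat_power_entry U (Suc m) a b) = 0"
    if j: "j \<le> n" and ab: "a < n" "b < n" for j a b
  proof -
    \<comment> \<open>\<open>S l\<close> is \<open>r\<^sub>j (c\<^sub>j u\<^sup>l + c\<^sub>j\<^sub>+\<^sub>1 u\<^sup>l\<^sup>+\<^sup>1 + \<dots>)\<close>.  Cayley-Hamilton is \<open>S j = 0\<close>; multiplication by \<open>u\<close> gives \<open>S (j + 1) = 0\<close>, so that the descent to \<open>S 1\<close> also covers \<open>j = 0\<close>.\<close>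
    define S where "S = (\<lambda>l a b. \<Sum>m\<le>n - j. r j * c (j + m) * mat_power_entry U (m + l) a b)"
    have Sj: "S j a b = 0" if "a < n" "b < n" for a b
    proof -
      have "0 = r j * (\<Sum>m\<le>n. c m * mat_power_entry U m a b)"
        using Cayley_Hamilton_entry[OF U that] by (simp add: c_def)
      also have "\<dots> = (\<Sum>m\<le>n. r j * c m * mat_power_entry U m a b)"
        by (simp add: sum_distrib_left mult.assoc)
      also have "\<dots> = (\<Sum>m\<in>{j..n}. r j * c m * mat_power_entry U m a b)"
        by (rule sum.mono_neutral_right) (auto simp: rc)
      also have "\<dots> = S j a b"
        unfolding S_def using j
        by (intro sum.reindex_bij_witness[of _ "\<lambda>m. j + m" "\<lambda>m. m - j"]) (auto simp: add.commute)
      finally show ?thesis by simp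
    qed
    have up: "S (Suc l) a b = (\<Sum>k<n. U $$ (a, k) * S l k b)" for l a b
      using U unfolding S_def
      by (simp add: sum_distrib_left mult.left_commute mult.assoc) (rule sum.swap)
    have down: "S (Suc l) a b = (\<Sum>k<n. S (Suc (Suc l)) a k * W $$ (k, b))" if "a < n" "b < n" for l a b
      unfolding S_def sum_distrib_right
      using mat_power_entry_cancel[OF U U W UUW that]
      by (subst sum.swap) (simp add: mult.assoc sum_distrib_left[symmetric] del: mat_power_entry.simps(2))
    have "\<forall>a<n. \<forall>b<n. S (Suc l) a b = 0" if "l \<le> j" for l
      using that
    proof (induction rule: inc_induct)
      case base
      then show ?case using Sj by (simp add: up)
    next
      case (step l)
      show ?case
      proof (intro allI impI)
        fix a b assume ab: "a < n" "b < n"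
        show "S (Suc l) a b = 0" unfolding down[OF ab] using step.IH ab by simp
      qed
    qed
    then have "S (Suc 0) a b = 0" using ab by blast
    then show ?thesis by (simp add: S_def del: mat_power_entry.simps(2))
  qed
  then show ?thesis
    unfolding rank_idempotents_def
    using sum1 orth unit rc by (intro exI[of _ r] exI[of _ "coeff C 0"] exI) auto
qed

section \<open>Rings in which 0 and 1 may coincide\<close>

text \<open>
  The algebra above concerns rings with \<open>0 \<noteq> 1\<close>.  Adjoining a new unit (Dorroh extension)
  embeds any ring \<open>R\<close> as an ideal into the nonzero ring \<open>R \<times> \<int>\<close>.  If \<open>R\<close> has a unit, the projection
  \<open>base\<close> is a unital ring homomorphism, so identities proved in the extension for lifted
  matrices project to identities in \<open>R\<close>.
\<close>

datatype 'a unital_ext = Unital_Ext (base: 'a) (aug: int)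

instantiation unital_ext :: ("{comm_ring, comm_monoid_mult}") comm_ring_1
begin

definition "0 = Unital_Ext 0 0"
definition "1 = Unital_Ext 1 1"
definition "x + y = Unital_Ext (base x + base y) (aug x + aug y)"
definition "x - y = Unital_Ext (base x - base y) (aug x - aug y)"
definition "- x = Unital_Ext (- base x) (- aug x)"
definition "x * y = Unital_Ext (base x * base y) (aug x * aug y)"

lemmas unital_ext_defs = zero_unital_ext_def one_unital_ext_def plus_unital_ext_def
  minus_unital_ext_def uminus_unital_ext_def times_unital_ext_def

instance
  by standard (auto simp: unital_ext_defs unital_ext.expand algebra_simps)

end

lemma base_simps [simp]:
  "base 0 = 0" "base 1 = 1" "base (x + y) = base x + base y" "base (x - y) = base x - base y"
  "base (x * y) = base x * base y"
  by (simp_all add: unital_ext_defs)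

lemma base_sum [simp]: "base (sum f S) = (\<Sum>x\<in>S. base (f x))"
  by (induction S rule: infinite_finite_induct) auto

definition incl :: "'a :: {comm_ring, comm_monoid_mult} \<Rightarrow> 'a unital_ext" where
  "incl a = Unital_Ext a 0"

lemma incl_simps [simp]:
  "base (incl a) = a" "incl (a * b) = incl a * incl b"
  "incl (a + b) = incl a + incl b" "incl 0 = 0"
  by (simp_all add: incl_def unital_ext_defs)

lemma incl_sum: "incl (sum f S) = (\<Sum>x\<in>S. incl (f x))"
  by (induction S rule: infinite_finite_induct) auto

lemma map_mat_incl_mult:
  assumes "A \<in> carrier_mat n m" "B \<in> carrier_mat m k"
  shows "map_mat incl (A * B) = map_mat incl A * map_mat incl B"
  using assms by (intro eq_matI) (auto simp: scalar_prod_def incl_sum intro!: sum.cong)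

lemma base_mat_power_entry:
  assumes "M \<in> carrier_mat n n" "i < n"
  shows "base (mat_power_entry M l i j) = mat_power_entry (map_mat base M) l i j"
  using assms(2)
  by (induction l arbitrary: i) (use assms(1) in auto)

lemma base_leading_block:
  assumes "A \<in> carrier_mat n n" "k \<le> n"
  shows "map_mat base (leading_block (map_mat incl A) k) = leading_block A k"
  using assms by (intro eq_matI) auto

text \<open>
  \<open>block_char_coeff A k m\<close> is the coefficient of \<open>s\<^sup>k\<^sup>-\<^sup>m\<close> in the characteristic polynomial of the
  leading block of size \<open>k\<close>, obtained by solving the system of \<open>char_coeff_leading_block\<close> for
  the larger block.  Counting coefficients from the leading one makes the system triangular.
\<close>

function block_char_coeff ::
  "'a :: {comm_ring, comm_monoid_mult} mat \<Rightarrow> nat \<Rightarrow> nat \<Rightarrow> 'a" where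
  "block_char_coeff A 0 m = (if m = 0 then 1 else 0)"
| "block_char_coeff A (Suc k) m = (if m \<le> k then block_char_coeff A k m else 0)
     - (\<Sum>l<m. block_char_coeff A (Suc k) (m - Suc l)
                * mat_power_entry (leading_block A (Suc k)) (Suc l) k k)"
  by pat_completeness auto
termination
  by (relation "inv_image (less_than <*lex*> less_than) (\<lambda>(A, k, m). (k, m))") auto

declare block_char_coeff.simps(2) [simp del]

lemma block_char_coeff_correct:
  assumes "A \<in> carrier_mat n n" "k \<le> n" "m \<le> k"
  shows "block_char_coeff A k m = base (char_coeff (leading_block (map_mat incl A) k) (k - m))"
  using assms
proof (induction A k m rule: block_char_coeff.induct)
  case (1 A m)
  then show ?case using char_coeff_top[of "leading_block (map_mat incl A) 0" 0] by simp
next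
  case (2 A k m)
  define L where "L = leading_block (map_mat incl A) (Suc k)"
  have power: "mat_power_entry (leading_block A (Suc k)) l k k = base (mat_power_entry L l k k)" for l
    using base_mat_power_entry[of L "Suc k" k l k] base_leading_block[OF 2(3), of "Suc k"] 2(4)
    by (simp add: L_def)
  have "(if m \<le> k then char_coeff (leading_block (map_mat incl A) k) (k - m) else 0)
    = (\<Sum>l<Suc m. char_coeff L (Suc k - (m - l)) * mat_power_entry L l k k)"
    unfolding char_coeff_leading_block[OF 2(5)] L_def lessThan_Suc_atMost ..
  also have "\<dots> = char_coeff L (Suc k - m)
      + (\<Sum>l<m. char_coeff L (Suc k - (m - Suc l)) * mat_power_entry L (Suc l) k k)"
    by (subst sum.lessThan_Suc_shift) (simp del: mat_power_entry.simps(2))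
  finally have eq: "(if m \<le> k then char_coeff (leading_block (map_mat incl A) k) (k - m) else 0) = \<dots>" .
  have "base (char_coeff L (Suc k - m))
    = (if m \<le> k then base (char_coeff (leading_block (map_mat incl A) k) (k - m)) else 0)
      - (\<Sum>l<m. base (char_coeff L (Suc k - (m - Suc l))) * base (mat_power_entry L (Suc l) k k))"
    (is "_ = ?x - ?y")
    using arg_cong[OF eq, of base] unfolding base_simps base_sum
    by (cases "m \<le> k") (simp_all add: eq_neg_iff_add_eq_0 del: mat_power_entry.simps(2))
  also have "?x = (if m \<le> k then block_char_coeff A k m else 0)"
    using 2(1,3,4) by simp
  also have "?y = (\<Sum>l<m. block_char_coeff A (Suc k) (m - Suc l)
                * mat_power_entry (leading_block A (Suc k)) (Suc l) k k)"
    using 2(2-5) unfolding power L_def by (intro sum.cong) (auto simp del: mat_power_entry.simps(2))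
  finally show ?case by (simp only: L_def block_char_coeff.simps(2)[of A k m])
qed

lemma group_invertible_idempotents_base:
  fixes u w :: "'a :: {comm_ring, comm_monoid_mult} mat"
  assumes u: "u \<in> carrier_mat n n" and w: "w \<in> carrier_mat n n"
    and uuw: "u * (u * w) = u" and uwu: "u * w * u = u"
  defines "c \<equiv> \<lambda>k. block_char_coeff u n (n - k)"
  shows "\<exists>r d d'. rank_idempotents u n c r d d'"
proof -
  define U W where "U = map_mat incl u" and "W = map_mat incl w"
  have U: "U \<in> carrier_mat n n" and W: "W \<in> carrier_mat n n" using u w by (simp_all add: U_def W_def)
  have "U * (U * W) = U" "U * W * U = U"
    using map_mat_incl_mult[OF u w] map_mat_incl_mult[OF u, of "u * w" n]
      map_mat_incl_mult[of "u * w" n n u n] u w uuw uwu by (simp_all add: U_def W_def)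
  from group_invertible_idempotents[OF U W this] obtain r d d' where
    "rank_idempotents U n (char_coeff U) r d d'" by blast
  note * = this[unfolded rank_idempotents_def]
  have *: "d * d' = 1" "(\<Sum>j\<le>n. r j) = 1"
    "\<And>i j. r i * r j = (if i = j then r i else 0)"
    "\<And>j k. k < j \<Longrightarrow> k \<le> n \<Longrightarrow> r j * char_coeff U k = 0"
    "\<And>j. j \<le> n \<Longrightarrow> r j * char_coeff U j = r j * d"
    "\<And>j a b. j \<le> n \<Longrightarrow> a < n \<Longrightarrow> b < n \<Longrightarrow>
       (\<Sum>m\<le>n - j. r j * char_coeff U (j + m) * mat_power_entry U (Suc m) a b) = 0"
    using * by blast+
  have c: "c k = base (char_coeff U k)" if "k \<le> n" for k
    using block_char_coeff_correct[OF u, of n "n - k"] leading_block_full[OF U] that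
    by (simp add: c_def U_def)
  have u': "map_mat base U = u" using u by (intro eq_matI) (auto simp: U_def)
  show ?thesis
    unfolding rank_idempotents_def
  proof (rule exI[of _ "\<lambda>j. base (r j)"], rule exI[of _ "base d"], rule exI[of _ "base d'"],
      intro conjI allI impI)
    show "base d * base d' = 1" using arg_cong[OF *(1), of base] by simp
    show "(\<Sum>j\<le>n. base (r j)) = 1" using arg_cong[OF *(2), of base] by simp
    show "base (r i) * base (r j) = (if i = j then base (r i) else 0)" for i j
      using arg_cong[OF *(3)[of i j], of base] by (simp split: if_splits)
    show "base (r j) * c k = 0" if "k < j" "k \<le> n" for j k
      using arg_cong[OF *(4)[OF that], of base] c[OF that(2)] by simp
    show "base (r j) * c j = base (r j) * base d" if "j \<le> n" for j
      using arg_cong[OF *(5)[OF that], of base] c[OF that] by simp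
    show "(\<Sum>m\<le>n - j. base (r j) * c (j + m) * mat_power_entry u (Suc m) a b) = 0"
      if j: "j \<le> n" and ab: "a < n" "b < n" for j a b
    proof -
      have "(\<Sum>m\<le>n - j. base (r j) * c (j + m) * mat_power_entry u (Suc m) a b)
        = base (\<Sum>m\<le>n - j. r j * char_coeff U (j + m) * mat_power_entry U (Suc m) a b)"
        unfolding base_sum using j
        by (intro sum.cong) (auto simp: c base_mat_power_entry[OF U ab(1)] u' simp del: mat_power_entry.simps(2))
      then show ?thesis by (simp only: *(6)[OF j ab] base_simps)
    qed
  qed
qed

section \<open>Coefficients of the certificate\<close>

text \<open>
  In the next definitions \<open>c k\<close> stands for the coefficient of \<open>s\<^sup>k\<close> in the characteristic polynomial.  For
  crossed maps, \<open>remaining dt c k\<close> is \<open>1 - r\<^sub>0 - \<dots> - r\<^sub>k\<^sub>-\<^sub>1\<close>, and \<open>local_inverse dt c k\<close> is \<open>r\<^sub>k d\<^sup>-\<^sup>1\<close>.  The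
  value 0 after a failed test is arbitrary: such a failure shows that the maps are not crossed,
  and the verification detects this.
\<close>

definition guess_quotient :: "('a :: {comm_ring, comm_monoid_mult} \<Rightarrow> 'a \<Rightarrow> 'a option) \<Rightarrow> 'a \<Rightarrow> 'a" where
  "guess_quotient dt y = (case dt y (y * y) of None \<Rightarrow> 0 | Some z \<Rightarrow> z)"

primrec remaining :: "('a :: {comm_ring, comm_monoid_mult} \<Rightarrow> 'a \<Rightarrow> 'a option) \<Rightarrow> (nat \<Rightarrow> 'a) \<Rightarrow> nat \<Rightarrow> 'a" where
  "remaining dt c 0 = 1"
| "remaining dt c (Suc k) = remaining dt c k
     - guess_quotient dt (remaining dt c k * c k) * (remaining dt c k * c k)"

definition local_inverse :: "('a :: {comm_ring, comm_monoid_mult} \<Rightarrow> 'a \<Rightarrow> 'a option) \<Rightarrow> (nat \<Rightarrow> 'a) \<Rightarrow> nat \<Rightarrow> 'a" where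
  "local_inverse dt c k = (let y = remaining dt c k * c k; z = guess_quotient dt y in z * (z * y))"

definition inverse_coeff ::
  "('a :: {comm_ring, comm_monoid_mult} \<Rightarrow> 'a \<Rightarrow> 'a option) \<Rightarrow> (nat \<Rightarrow> 'a) \<Rightarrow> nat \<Rightarrow> nat \<Rightarrow> 'a" where
  "inverse_coeff dt c n m = - (\<Sum>k<n - m. local_inverse dt c k * c (Suc (k + m)))"

text \<open>
  With \<open>y = r\<^sub>k d\<close>, the square is \<open>y\<^sup>2 = r\<^sub>k d\<^sup>2\<close>, so \<open>y\<close> is a multiple of \<open>y\<^sup>2\<close> and the test succeeds.  The
  quotient \<open>z\<close> is not unique, but \<open>y = z y\<^sup>2\<close> determines \<open>r\<^sub>k z = r\<^sub>k d\<^sup>-\<^sup>1\<close>.  For this reason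
  \<open>local_inverse\<close> is \<open>z\<^sup>2 y = r\<^sub>k z\<close> and not \<open>z\<close>.
\<close>

lemma greedy_step:
  fixes c r :: "nat \<Rightarrow> 'a :: {comm_ring, comm_monoid_mult}"
  assumes dt: "explicit_divisibility_test dt"
    and d: "d * d' = 1" and sum1: "(\<Sum>j\<le>n. r j) = 1"
    and orth: "\<And>i j. r i * r j = (if i = j then r i else 0)"
    and low: "\<And>j k. k < j \<Longrightarrow> k \<le> n \<Longrightarrow> r j * c k = 0"
    and lead: "\<And>j. j \<le> n \<Longrightarrow> r j * c j = r j * d"
    and k: "k \<le> n"
  shows "remaining dt c k = 1 - (\<Sum>j<k. r j)" "local_inverse dt c k = r k * d'"
proof -
  have cancel: "d' * (d * x) = x" for x using d by (simp add: mult.assoc[symmetric] mult.commute[of d'])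
  have step: "remaining dt c k * c k = r k * d \<and>
      guess_quotient dt (r k * d) * r k = r k * d'"
    if k: "k \<le> n" and rem: "remaining dt c k = 1 - (\<Sum>j<k. r j)" for k
  proof
    have "{..n} = {..<k} \<union> {k..n}" using k by auto
    then have "(\<Sum>j<k. r j) + (\<Sum>j=k..n. r j) = 1"
      unfolding sum1[symmetric] by (subst sum.union_disjoint[symmetric]) auto
    then have "1 - (\<Sum>j<k. r j) = (\<Sum>j=k..n. r j)"
      by (metis add_diff_cancel_left')
    then have "remaining dt c k * c k = (\<Sum>j=k..n. r j * c k)"
      unfolding rem by (simp only: sum_distrib_right)
    also have "\<dots> = (\<Sum>j\<in>{k}. r j * c k)"
      by (rule sum.mono_neutral_right) (use k low in auto)
    finally show y: "remaining dt c k * c k = r k * d" using lead[OF k] by simp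
    define y where "y = r k * d"
    have "y * y = (r k * r k) * (d * d)"
      unfolding y_def by (simp only: ac_simps)
    then have yy: "y * y = r k * (d * d)" using orth[of k k] by simp
    have "d' * (y * y) = r k * (d' * (d * d))" unfolding yy by (simp only: ac_simps)
    then have y1: "d' * (y * y) = y" by (simp only: cancel y_def)
    then have "y * y dvd y" by (metis dvd_def mult.commute)
    then obtain z where z: "dt y (y * y) = Some z" "y = z * (y * y)"
      using dt unfolding explicit_divisibility_test_def by (cases "dt y (y * y)") (force split: option.splits)+
    have "z * (y * y) * (d' * d') = z * r k * (d' * (d' * (d * d)))"
      unfolding yy by (simp only: ac_simps)
    then have "z * r k = z * (y * y) * (d' * d')" using cancel d by (simp add: mult.commute)
    also have "\<dots> = r k * (d' * (d * d'))"
      unfolding z(2)[symmetric] unfolding y_def by (simp only: ac_simps)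
    also have "\<dots> = r k * d'" by (simp add: d)
    finally show "guess_quotient dt (r k * d) * r k = r k * d'"
      using z(1) by (simp add: guess_quotient_def y_def)
  qed
  have take: "guess_quotient dt (r k * d) * (r k * d) = r k"
    if *: "guess_quotient dt (r k * d) * r k = r k * d'" for k
  proof -
    have "guess_quotient dt (r k * d) * (r k * d) = r k * d' * d"
      by (simp only: mult.assoc[symmetric] *)
    also have "\<dots> = d' * (d * r k)" by (simp only: ac_simps)
    finally show ?thesis by (simp only: cancel)
  qed
  show rem: "remaining dt c k = 1 - (\<Sum>j<k. r j)"
    using k
  proof (induction k)
    case (Suc k)
    then have "remaining dt c (Suc k) = 1 - (\<Sum>j<k. r j) - r k"
      using step[of k] take[of k] by simp
    then show ?case by simp
  qed simp
  show "local_inverse dt c k = r k * d'"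
    using conjunct1[OF step[OF k rem]] conjunct2[OF step[OF k rem]] take[OF conjunct2[OF step[OF k rem]]]
    by (simp only: local_inverse_def Let_def)
qed

lemma index_mult_mat_sum:
  assumes "A \<in> carrier_mat n k" "B \<in> carrier_mat k m" "i < n" "j < m"
  shows "(A * B) $$ (i, j) = (\<Sum>l<k. A $$ (i, l) * B $$ (l, j))"
  using assms by (auto simp: scalar_prod_def atLeast0LessThan intro!: sum.cong)

lemma mat_power_entry_Suc:
  "A \<in> carrier_mat n n \<Longrightarrow>
    (\<Sum>k<n. A $$ (i, k) * mat_power_entry A l k j) = mat_power_entry A (Suc l) i j"
  by simp

text \<open>
  \<open>poly_act u a Y l\<close> is \<open>(a\<^sub>0 + a\<^sub>1 u + \<dots> + a\<^sub>l\<^sub>-\<^sub>1 u\<^sup>l\<^sup>-\<^sup>1) Y\<close>, evaluated by Horner's rule.  Applying the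
  polynomial to \<open>Y\<close> instead of forming it keeps the identity matrix out of the calculations.
\<close>

primrec poly_act :: "'a :: {comm_ring, comm_monoid_mult} mat \<Rightarrow> (nat \<Rightarrow> 'a) \<Rightarrow> 'a mat \<Rightarrow> nat \<Rightarrow> 'a mat" where
  "poly_act u a Y 0 = 0\<^sub>m (dim_row Y) (dim_col Y)"
| "poly_act u a Y (Suc m) = u * poly_act u (\<lambda>i. a (Suc i)) Y m + a 0 \<cdot>\<^sub>m Y"

lemma poly_act_carrier [simp]:
  "Y \<in> carrier_mat n m \<Longrightarrow> u \<in> carrier_mat n n \<Longrightarrow> poly_act u a Y l \<in> carrier_mat n m"
  by (induction l arbitrary: a) auto

lemma smult_mult_mat:
  fixes Y Z :: "'a :: {comm_ring, comm_monoid_mult} mat"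
  assumes "Y \<in> carrier_mat n k" "Z \<in> carrier_mat k m"
  shows "a \<cdot>\<^sub>m Y * Z = a \<cdot>\<^sub>m (Y * Z)" "Y * (a \<cdot>\<^sub>m Z) = a \<cdot>\<^sub>m (Y * Z)"
  using assms by (intro eq_matI; auto simp: scalar_prod_def sum_distrib_left ac_simps)+

lemma poly_act_mult_right:
  assumes u: "u \<in> carrier_mat n n" and Y: "Y \<in> carrier_mat n k" and Z: "Z \<in> carrier_mat k m"
  shows "poly_act u a Y l * Z = poly_act u a (Y * Z) l"
proof (induction l arbitrary: a)
  case 0
  then show ?case using Y Z by simp
next
  case (Suc l)
  have "poly_act u a Y (Suc l) * Z
    = u * poly_act u (\<lambda>i. a (Suc i)) Y l * Z + a 0 \<cdot>\<^sub>m Y * Z"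
    unfolding poly_act.simps using u Y Z
    by (intro add_mult_distrib_mat[of _ n k]) (auto intro!: mult_carrier_mat[of _ n n])
  also have "u * poly_act u (\<lambda>i. a (Suc i)) Y l * Z = u * (poly_act u (\<lambda>i. a (Suc i)) Y l * Z)"
    by (rule assoc_mult_mat) (use u Y Z in auto)
  finally show ?case using Suc smult_mult_mat(1)[OF Y Z] by simp
qed

lemma mult_poly_act:
  assumes u: "u \<in> carrier_mat n n" and Y: "Y \<in> carrier_mat n k"
  shows "u * poly_act u a Y l = poly_act u a (u * Y) l"
proof (induction l arbitrary: a)
  case 0
  then show ?case using u Y by simp
next
  case (Suc l)
  have "u * poly_act u a Y (Suc l)
    = u * (u * poly_act u (\<lambda>i. a (Suc i)) Y l) + u * (a 0 \<cdot>\<^sub>m Y)"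
    unfolding poly_act.simps using u Y
    by (intro mult_add_distrib_mat[of _ n n]) (auto intro!: mult_carrier_mat[of _ n n])
  then show ?case using Suc smult_mult_mat(2)[OF u Y] by simp
qed

lemma poly_act_self_entry:
  assumes u: "u \<in> carrier_mat n n" and "i < n" "j < n"
  shows "poly_act u a u l $$ (i, j) = (\<Sum>m<l. a m * mat_power_entry u (Suc m) i j)"
  using assms(2)
proof (induction l arbitrary: a i)
  case 0
  then show ?case using assms by simp
next
  case (Suc l)
  let ?b = "\<lambda>i. a (Suc i)"
  have one: "mat_power_entry u (Suc 0) i j = u $$ (i, j)"
    using u Suc.prems assms(3) by (simp add: if_distrib[of "\<lambda>x. _ * x"] sum.delta cong: if_cong) 
  have "poly_act u a u (Suc l) $$ (i, j) = (u * poly_act u ?b u l) $$ (i, j) + a 0 * u $$ (i, j)"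
    using u Suc.prems assms(3) by simp
  also have "(u * poly_act u ?b u l) $$ (i, j) = (\<Sum>k<n. u $$ (i, k) * poly_act u ?b u l $$ (k, j))"
    by (rule index_mult_mat_sum) (use u Suc.prems assms(3) in auto)
  also have "\<dots> = (\<Sum>k<n. \<Sum>m<l. ?b m * (u $$ (i, k) * mat_power_entry u (Suc m) k j))"
    using Suc.IH by (simp add: sum_distrib_left ac_simps del: mat_power_entry.simps(2))
  also have "\<dots> = (\<Sum>m<l. a (Suc m) * mat_power_entry u (Suc (Suc m)) i j)"
    by (subst sum.swap) (simp only: sum_distrib_left[symmetric] mat_power_entry_Suc[OF u])
  finally show ?case
    unfolding sum.lessThan_Suc_shift using one by (simp add: add.commute del: mat_power_entry.simps(2))
qed

lemma sum_triangle:
  fixes f :: "nat \<Rightarrow> nat \<Rightarrow> 'b :: comm_monoid_add"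
  shows "(\<Sum>m<n. \<Sum>k<n - m. f m k) = (\<Sum>k<n. \<Sum>m<n - k. f m k)"
proof -
  have "(\<Sum>m<n. \<Sum>k<n - m. f m k) = (\<Sum>m<n. \<Sum>k<n. if m + k < n then f m k else 0)"
    by (intro sum.cong sum.mono_neutral_cong_left) auto
  also have "\<dots> = (\<Sum>k<n. \<Sum>m<n. if m + k < n then f m k else 0)" by (rule sum.swap)
  also have "\<dots> = (\<Sum>k<n. \<Sum>m<n - k. f m k)"
    by (intro sum.cong sum.mono_neutral_cong_right) auto
  finally show ?thesis .
qed

text \<open>
  After exchanging the sums, the claim is \<open>- \<Sum>\<^sub>k r\<^sub>k d\<^sup>-\<^sup>1 (c\<^sub>k\<^sub>+\<^sub>1 u\<^sup>2 + c\<^sub>k\<^sub>+\<^sub>2 u\<^sup>3 + \<dots>) = u\<close>.  By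
  Cayley-Hamilton on each component, the \<open>k\<close>-th summand contributes \<open>r\<^sub>k d\<^sup>-\<^sup>1 c\<^sub>k u = r\<^sub>k u\<close>.
\<close>

lemma poly_act_greedy:
  fixes u w :: "'a :: {comm_ring, comm_monoid_mult} mat"
  assumes dt: "explicit_divisibility_test dt"
    and u: "u \<in> carrier_mat n n" and w: "w \<in> carrier_mat n n"
    and uuw: "u * (u * w) = u" and uwu: "u * w * u = u"
  defines "c \<equiv> \<lambda>k. block_char_coeff u n (n - k)"
  shows "u * poly_act u (inverse_coeff dt c n) u n = u"
proof -
  from group_invertible_idempotents_base[OF u w uuw uwu] obtain r d d' where
    "rank_idempotents u n c r d d'" unfolding c_def by blast
  note * = this[unfolded rank_idempotents_def]
  have d: "d * d' = 1" and sum1: "(\<Sum>j\<le>n. r j) = 1"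
    and orth: "\<And>i j. r i * r j = (if i = j then r i else 0)"
    and low: "\<And>j k. k < j \<Longrightarrow> k \<le> n \<Longrightarrow> r j * c k = 0"
    and lead: "\<And>j. j \<le> n \<Longrightarrow> r j * c j = r j * d"
    and CH: "\<And>j a b. j \<le> n \<Longrightarrow> a < n \<Longrightarrow> b < n \<Longrightarrow>
      (\<Sum>m\<le>n - j. r j * c (j + m) * mat_power_entry u (Suc m) a b) = 0"
    using * by blast+
  define be where "be = local_inverse dt c"
  define al where "al = inverse_coeff dt c n"
  have be: "be k = r k * d'" if "k \<le> n" for k
    unfolding be_def by (rule greedy_step(2)[OF dt d sum1 orth low lead that]) auto
  have bec: "be k * c k = r k" if "k \<le> n" for k
  proof -
    have "be k * c k = (r k * c k) * d'" using be[OF that] by (simp add: ac_simps)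
    then show ?thesis using lead[OF that] d by (simp add: mult.assoc)
  qed
  show ?thesis unfolding al_def[symmetric]
  proof (rule eq_matI)
    fix i j assume "i < dim_row u" "j < dim_col u"
    then have ij: "i < n" "j < n" using u by auto
    define P where "P = (\<lambda>l. mat_power_entry u l i j)"
    have rel: "be k * c k * P (Suc 0) = - (\<Sum>m<n - k. be k * c (Suc (k + m)) * P (Suc (Suc m)))" if "k \<le> n" for k
    proof -
      have "0 = d' * (\<Sum>m<Suc (n - k). r k * c (k + m) * P (Suc m))"
        using CH[OF that ij] by (simp only: P_def lessThan_Suc_atMost) simp
      also have "\<dots> = (\<Sum>m<Suc (n - k). be k * c (k + m) * P (Suc m))"
        by (simp only: be[OF that] sum_distrib_left ac_simps)
      also have "\<dots> = be k * c k * P (Suc 0) + (\<Sum>m<n - k. be k * c (Suc (k + m)) * P (Suc (Suc m)))"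
        by (subst sum.lessThan_Suc_shift) simp
      finally show ?thesis by (simp add: eq_neg_iff_add_eq_0)
    qed
    have carr: "poly_act u al u n \<in> carrier_mat n n" using u by simp
    have "(u * poly_act u al u n) $$ (i, j) = (\<Sum>k<n. u $$ (i, k) * poly_act u al u n $$ (k, j))"
      by (rule index_mult_mat_sum[OF u carr ij])
    also have "\<dots> = (\<Sum>k<n. \<Sum>m<n. al m * (u $$ (i, k) * mat_power_entry u (Suc m) k j))"
      using poly_act_self_entry[OF u _ ij(2), of _ al n]
      by (simp add: sum_distrib_left ac_simps del: mat_power_entry.simps(2))
    also have "\<dots> = (\<Sum>m<n. al m * P (Suc (Suc m)))"
      unfolding P_def by (subst sum.swap) (simp only: sum_distrib_left[symmetric] mat_power_entry_Suc[OF u])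
    also have "\<dots> = - (\<Sum>m<n. \<Sum>k<n - m. be k * c (Suc (k + m)) * P (Suc (Suc m)))"
      by (simp add: al_def inverse_coeff_def be_def sum_distrib_right sum_negf)
    also have "\<dots> = - (\<Sum>k<n. \<Sum>m<n - k. be k * c (Suc (k + m)) * P (Suc (Suc m)))"
      by (subst sum_triangle) simp
    also have "\<dots> = (\<Sum>k<Suc n. be k * c k * P (Suc 0))"
      by (simp add: rel sum_negf)
    also have "\<dots> = (\<Sum>k\<le>n. r k) * P (Suc 0)"
      unfolding sum_distrib_right lessThan_Suc_atMost by (intro sum.cong) (auto simp: bec)
    also have "\<dots> = u $$ (i, j)"
      using poly_act_self_entry[OF u ij, of "\<lambda>_. 1" "Suc 0"] u ij
      by (simp add: sum1 P_def del: mat_power_entry.simps(2))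
    finally show "(u * poly_act u al u n) $$ (i, j) = u $$ (i, j)" .
  qed (use u carrier_matD[OF poly_act_carrier[OF u u, of al n]] in auto)
qed

section \<open>Crossed maps between images of projections\<close>

lemma image_module_simps [simp]:
  "carrier (image_module P) = (\<lambda>v. P *\<^sub>v v) ` carrier_vec (dim_col P)"
  "zero (image_module P) = 0\<^sub>v (dim_row P)"
  "add (image_module P) = (+)"
  "c \<odot>\<^bsub>image_module P\<^esub> v = c \<cdot>\<^sub>v v"
  by (simp_all add: image_module_def)

lemma mem_image_projection:
  assumes P: "projection_mat n P"
  shows "x \<in> carrier (image_module P) \<longleftrightarrow> x \<in> carrier_vec n \<and> P *\<^sub>v x = x"
proof -
  have PP: "P \<in> carrier_mat n n" "P * P = P" using P by (simp_all add: projection_mat_def)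
  have "P *\<^sub>v (P *\<^sub>v v) = P *\<^sub>v v" if "v \<in> carrier_vec n" for v
    using assoc_mult_mat_vec[OF PP(1) PP(1) that] PP(2) by simp
  then show ?thesis using PP(1) by (auto intro!: image_eqI[of x _ x])
qed

lemma mult_mat_vec_smult:
  fixes A :: "'a :: {comm_ring, comm_monoid_mult} mat"
  assumes "A \<in> carrier_mat m n" "v \<in> carrier_vec n"
  shows "A *\<^sub>v (c \<cdot>\<^sub>v v) = c \<cdot>\<^sub>v (A *\<^sub>v v)"
  using assms by (intro eq_vecI) (auto simp: scalar_prod_def sum_distrib_left mult.left_commute)

lemma mult_mat_zero_vec:
  fixes A :: "'a :: {comm_ring, comm_monoid_mult} mat"
  assumes "A \<in> carrier_mat m n"
  shows "A *\<^sub>v 0\<^sub>v n = 0\<^sub>v m"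
  using assms by (intro eq_vecI) (auto simp: scalar_prod_def)

lemma mult_mat_vec_diff:
  fixes A :: "'a :: {comm_ring, comm_monoid_mult} mat"
  assumes "A \<in> carrier_mat m n" "v \<in> carrier_vec n" "w \<in> carrier_vec n"
  shows "A *\<^sub>v (v - w) = A *\<^sub>v v - A *\<^sub>v w"
  using assms by (intro eq_vecI) (auto simp: scalar_prod_def right_diff_distrib sum_subtractf)

lemma vec_diff_eq_zero:
  fixes v w :: "'a :: ab_group_add vec"
  assumes "v \<in> carrier_vec n" "w \<in> carrier_vec n"
  shows "v - w = 0\<^sub>v n \<longleftrightarrow> v = w"
  using assms by (auto simp: vec_eq_iff)

lemma represents_mapD:
  assumes "projection_mat n P" "projection_mat m Q" "represents_map P Q A"
  shows "A \<in> carrier_mat m n" "A * P = A" "Q * A = A"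
proof -
  have c: "P \<in> carrier_mat n n" "Q \<in> carrier_mat m m" and i: "P * P = P" "Q * Q = Q"
    using assms(1,2) by (simp_all add: projection_mat_def)
  show A: "A \<in> carrier_mat m n" using assms(3) c by (auto simp: represents_map_def)
  have A': "Q * A * P = A" using assms(3) by (simp add: represents_map_def)
  have "Q * A * P * P = Q * A * (P * P)" by (rule assoc_mult_mat) (use c A in auto)
  then show AP: "A * P = A" by (simp only: A' i)
  with A' AP assoc_mult_mat[OF c(2) A c(1)] show "Q * A = A" by argo
qed

lemma represents_mapI:
  assumes "projection_mat n P" "projection_mat m Q" "A \<in> carrier_mat m n" "A * P = A" "Q * A = A"
  shows "represents_map P Q A"
  using assms by (auto simp: represents_map_def projection_mat_def)

context
  fixes p q :: nat and P Q A B :: "'a :: {comm_ring, comm_monoid_mult} mat"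
  assumes P: "projection_mat p P" and Q: "projection_mat q Q"
    and A: "represents_map P Q A" and B: "represents_map Q P B"
begin

text \<open>
  Since \<open>A = A P\<close> and \<open>B = B Q\<close>, all conditions can be stated for arbitrary vectors instead of
  elements of the two images.  In a decomposition \<open>y = A x + k\<close> only \<open>B y = B A x\<close> matters,
  because \<open>k\<close> can then be recovered as \<open>y - A x\<close>.
\<close>

lemma direct_sum_image_kernel:
  shows "internal_direct_sum (image_module Q) ((\<lambda>x. A *\<^sub>v x) ` carrier (image_module P))
      (a_kernel (image_module Q) (image_module P) (\<lambda>y. B *\<^sub>v y))
    \<longleftrightarrow> (\<forall>y\<in>carrier_vec q. \<exists>x\<in>carrier_vec p. B *\<^sub>v y = B *\<^sub>v (A *\<^sub>v x)) \<and>
      (\<forall>x\<in>carrier_vec p. B *\<^sub>v (A *\<^sub>v x) = 0\<^sub>v p \<longrightarrow> A *\<^sub>v x = 0\<^sub>v q)" (is "?D \<longleftrightarrow> ?S \<and> ?I")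
proof -
  note cA = represents_mapD[OF P Q A] and cB = represents_mapD[OF Q P B]
  have cP: "P \<in> carrier_mat p p" and cQ: "Q \<in> carrier_mat q q"
    using P Q by (simp_all add: projection_mat_def)
  note memE = mem_image_projection[OF P] and memF = mem_image_projection[OF Q]
  let ?U = "(\<lambda>x. A *\<^sub>v x) ` carrier (image_module P)"
  let ?V = "a_kernel (image_module Q) (image_module P) (\<lambda>y. B *\<^sub>v y)"
  have AP: "A *\<^sub>v (P *\<^sub>v x) = A *\<^sub>v x" if "x \<in> carrier_vec p" for x
    using assoc_mult_mat_vec[OF cA(1) cP that] cA(2) by simp
  have BQ: "B *\<^sub>v (Q *\<^sub>v y) = B *\<^sub>v y" if "y \<in> carrier_vec q" for y
    using assoc_mult_mat_vec[OF cB(1) cQ that] cB(2) by simp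
  have QA: "Q *\<^sub>v (A *\<^sub>v x) = A *\<^sub>v x" if "x \<in> carrier_vec p" for x
    using assoc_mult_mat_vec[OF cQ cA(1) that] cA(3) by simp
  have QQ: "Q *\<^sub>v (Q *\<^sub>v y) = Q *\<^sub>v y" if "y \<in> carrier_vec q" for y
    using assoc_mult_mat_vec[OF cQ cQ that] Q by (simp add: projection_mat_def)
  have U: "?U = (\<lambda>x. A *\<^sub>v x) ` carrier_vec p"
  proof (intro equalityI image_subsetI)
    fix x :: "'a vec" assume "x \<in> carrier_vec p"
    then show "A *\<^sub>v x \<in> ?U"
      using AP[of x] cP by (intro image_eqI[of _ _ "P *\<^sub>v x"]) auto
  qed (use memE in auto)
  have V: "?V = {y \<in> carrier_vec q. Q *\<^sub>v y = y \<and> B *\<^sub>v y = 0\<^sub>v p}"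
    using memF cP by (auto simp: a_kernel_def')
  have sumUV: "?U <+>\<^bsub>image_module Q\<^esub> ?V = {A *\<^sub>v x + k |x k. x \<in> carrier_vec p \<and> k \<in> ?V}"
    unfolding U by (auto simp: set_add_def')
  show ?thesis
  proof (intro iffI conjI ballI impI)
    assume ?D
    then have sum: "?U <+>\<^bsub>image_module Q\<^esub> ?V = carrier (image_module Q)"
      and int: "?U \<inter> ?V = {0\<^sub>v q}"
      using cQ by (auto simp: internal_direct_sum_def)
    show "\<exists>x\<in>carrier_vec p. B *\<^sub>v y = B *\<^sub>v (A *\<^sub>v x)" if y: "y \<in> carrier_vec q" for y
    proof -
      have "Q *\<^sub>v y \<in> carrier (image_module Q)" using y cQ by auto
      then obtain x k where x: "x \<in> carrier_vec p" and k: "k \<in> ?V" and eq: "Q *\<^sub>v y = A *\<^sub>v x + k"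
        unfolding sum[symmetric] sumUV by blast
      have k': "k \<in> carrier_vec q" "B *\<^sub>v k = 0\<^sub>v p" using k unfolding V by auto
      have Ax: "A *\<^sub>v x \<in> carrier_vec q" using cA x by auto
      have "B *\<^sub>v y = B *\<^sub>v (A *\<^sub>v x) + B *\<^sub>v k"
        using BQ[OF y] mult_add_distrib_mat_vec[OF cB(1) Ax k'(1)] eq by simp
      then have "B *\<^sub>v y = B *\<^sub>v (A *\<^sub>v x)" using k'(2) cB Ax by simp
      then show ?thesis using x by blast
    qed
    show "A *\<^sub>v x = 0\<^sub>v q" if x: "x \<in> carrier_vec p" and BA: "B *\<^sub>v (A *\<^sub>v x) = 0\<^sub>v p" for x
    proof -
      have "A *\<^sub>v x \<in> ?U \<inter> ?V" unfolding U V using x BA QA cA by auto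
      then show ?thesis using int by blast
    qed
  next
    assume SI: "?S \<and> ?I"
    have "?U <+>\<^bsub>image_module Q\<^esub> ?V = carrier (image_module Q)"
    proof (intro equalityI subsetI)
      fix y assume "y \<in> ?U <+>\<^bsub>image_module Q\<^esub> ?V"
      then obtain x k where x: "x \<in> carrier_vec p" and k: "k \<in> ?V" and eq: "y = A *\<^sub>v x + k"
        unfolding sumUV by blast
      have k': "k \<in> carrier_vec q" "Q *\<^sub>v k = k" using k unfolding V by auto
      have Ax: "A *\<^sub>v x \<in> carrier_vec q" using cA x by auto
      show "y \<in> carrier (image_module Q)"
        unfolding memF eq using mult_add_distrib_mat_vec[OF cQ Ax k'(1)] QA[OF x] k' Ax by simp
    next
      fix y assume "y \<in> carrier (image_module Q)"
      then have y: "y \<in> carrier_vec q" "Q *\<^sub>v y = y" unfolding memF by auto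
      obtain x where x: "x \<in> carrier_vec p" and eq: "B *\<^sub>v y = B *\<^sub>v (A *\<^sub>v x)" using SI y by blast
      have Ax: "A *\<^sub>v x \<in> carrier_vec q" using cA x by auto
      define k where "k = y - A *\<^sub>v x"
      have k: "k \<in> carrier_vec q" unfolding k_def using y Ax by auto
      have "Q *\<^sub>v k = k" unfolding k_def mult_mat_vec_diff[OF cQ y(1) Ax] QA[OF x] y(2) ..
      moreover have "B *\<^sub>v k = 0\<^sub>v p"
        unfolding k_def mult_mat_vec_diff[OF cB(1) y(1) Ax] eq using cB Ax by auto
      ultimately have "k \<in> ?V" unfolding V using k by simp
      moreover have "y = A *\<^sub>v x + k" unfolding k_def using y Ax cA(1) by (intro eq_vecI) auto
      ultimately show "y \<in> ?U <+>\<^bsub>image_module Q\<^esub> ?V" unfolding sumUV using x by blast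
    qed
    moreover have "?U \<inter> ?V = {0\<^sub>v q}"
    proof -
      have "0\<^sub>v q \<in> ?U" unfolding U using mult_mat_zero_vec[OF cA(1)]
        by (intro image_eqI[of _ _ "0\<^sub>v p"]) auto
      moreover have "0\<^sub>v q \<in> ?V" unfolding V using mult_mat_zero_vec[OF cQ] mult_mat_zero_vec[OF cB(1)] by simp
      moreover have "y = 0\<^sub>v q" if "y \<in> ?U" "y \<in> ?V" for y
        using that SI unfolding U V by auto
      ultimately show ?thesis by blast
    qed
    ultimately show ?D using cQ by (simp add: internal_direct_sum_def)
  qed
qed

end

lemma internal_direct_sum_commute:
  assumes "projection_mat n P" "U \<subseteq> carrier (image_module P)" "V \<subseteq> carrier (image_module P)"
  shows "internal_direct_sum (image_module P) U V \<longleftrightarrow> internal_direct_sum (image_module P) V U"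
proof -
  have "u + v = v + u" if "u \<in> U" "v \<in> V" for u v
    using that assms mem_image_projection[OF assms(1)] by (intro comm_add_vec[of _ n]) auto
  then have "U <+>\<^bsub>image_module P\<^esub> V = (\<Union>u\<in>U. \<Union>v\<in>V. {v + u})"
    unfolding set_add_def' image_module_simps by (intro SUP_cong refl) simp
  also have "\<dots> = V <+>\<^bsub>image_module P\<^esub> U"
    by (auto simp: set_add_def')
  finally have "U <+>\<^bsub>image_module P\<^esub> V = V <+>\<^bsub>image_module P\<^esub> U" .
  then show ?thesis by (simp add: internal_direct_sum_def Int_commute)
qed

lemma crossed_iff:
  fixes A B :: "'a :: {comm_ring, comm_monoid_mult} mat"
  assumes P: "projection_mat p P" and Q: "projection_mat q Q"
    and A: "represents_map P Q A" and B: "represents_map Q P B"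
  shows "crossed (image_module P) (image_module Q) (\<lambda>x. A *\<^sub>v x) (\<lambda>y. B *\<^sub>v y) \<longleftrightarrow>
    (\<forall>y\<in>carrier_vec q. \<exists>x\<in>carrier_vec p. B *\<^sub>v y = B *\<^sub>v (A *\<^sub>v x)) \<and>
    (\<forall>x\<in>carrier_vec p. B *\<^sub>v (A *\<^sub>v x) = 0\<^sub>v p \<longrightarrow> A *\<^sub>v x = 0\<^sub>v q) \<and>
    (\<forall>x\<in>carrier_vec p. \<exists>y\<in>carrier_vec q. A *\<^sub>v x = A *\<^sub>v (B *\<^sub>v y)) \<and>
    (\<forall>y\<in>carrier_vec q. A *\<^sub>v (B *\<^sub>v y) = 0\<^sub>v q \<longrightarrow> B *\<^sub>v y = 0\<^sub>v p)"
proof -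
  have cP: "P \<in> carrier_mat p p" and cQ: "Q \<in> carrier_mat q q"
    using P Q by (simp_all add: projection_mat_def)
  note cB = represents_mapD[OF Q P B]
  have "(\<lambda>y. B *\<^sub>v y) ` carrier (image_module Q) \<subseteq> carrier (image_module P)"
  proof (rule image_subsetI)
    fix y assume "y \<in> carrier (image_module Q)"
    then have y: "y \<in> carrier_vec q" using mem_image_projection[OF Q] by blast
    show "B *\<^sub>v y \<in> carrier (image_module P)"
      unfolding mem_image_projection[OF P] using assoc_mult_mat_vec[OF cP cB(1) y] cB y by simp
  qed
  moreover have "a_kernel (image_module P) (image_module Q) (\<lambda>x. A *\<^sub>v x) \<subseteq> carrier (image_module P)"
    by (auto simp: a_kernel_def')
  ultimately show ?thesis
    unfolding crossed_def direct_sum_image_kernel[OF P Q A B, symmetric]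
      internal_direct_sum_commute[OF P, of "a_kernel (image_module P) (image_module Q) (\<lambda>x. A *\<^sub>v x)"]
    using direct_sum_image_kernel[OF Q P B A] direct_sum_image_kernel[OF P Q A B]
      internal_direct_sum_commute[OF P] by blast
qed

text \<open>
  The standard basis vectors, over rings in which 0 and 1 may coincide.
\<close>

definition indicator_vec :: "nat \<Rightarrow> nat \<Rightarrow> 'a :: {comm_ring, comm_monoid_mult} vec" where
  "indicator_vec n j = vec n (\<lambda>l. if l = j then 1 else 0)"

lemma indicator_vec_carrier [simp]: "indicator_vec n j \<in> carrier_vec n"
  by (simp add: indicator_vec_def)

lemma mult_mat_indicator_vec:
  assumes "M \<in> carrier_mat m n" "j < n"
  shows "M *\<^sub>v indicator_vec n j = col M j"
proof (rule eq_vecI)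
  fix i assume "i < dim_vec (col M j)"
  then have i: "i < m" using assms by auto
  have "(M *\<^sub>v indicator_vec n j) $ i = (\<Sum>l<n. M $$ (i, l) * (if l = j then 1 else 0))"
    using assms i by (auto simp: scalar_prod_def atLeast0LessThan indicator_vec_def intro!: sum.cong)
  also have "\<dots> = (\<Sum>l<n. if l = j then M $$ (i, l) else 0)"
    by (intro sum.cong) auto
  finally show "(M *\<^sub>v indicator_vec n j) $ i = col M j $ i" using assms i by simp
qed (use assms in auto)

lemma mat_eq_by_mult_vec:
  fixes M N :: "'a :: {comm_ring, comm_monoid_mult} mat"
  assumes M: "M \<in> carrier_mat m n" and N: "N \<in> carrier_mat m n"
    and eq: "\<And>v. v \<in> carrier_vec n \<Longrightarrow> M *\<^sub>v v = N *\<^sub>v v"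
  shows "M = N"
proof (rule eq_matI)
  fix i j assume "i < dim_row N" "j < dim_col N"
  then have ij: "i < m" "j < n" using N by auto
  have "col M j = col N j"
    using eq[of "indicator_vec n j"] mult_mat_indicator_vec[OF M ij(2)] mult_mat_indicator_vec[OF N ij(2)]
    by simp
  then have "col M j $ i = col N j $ i" by simp
  then show "M $$ (i, j) = N $$ (i, j)" using M N ij by simp
qed (use M N in auto)

lemma range_factor:
  fixes M N :: "'a :: {comm_ring, comm_monoid_mult} mat"
  assumes M: "M \<in> carrier_mat m n" and N: "N \<in> carrier_mat m k"
    and range: "\<And>v. v \<in> carrier_vec n \<Longrightarrow> \<exists>x\<in>carrier_vec k. M *\<^sub>v v = N *\<^sub>v x"
  shows "\<exists>W\<in>carrier_mat k n. M = N * W"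
proof -
  have "\<forall>j. \<exists>x\<in>carrier_vec k. M *\<^sub>v indicator_vec n j = N *\<^sub>v x"
    using range by simp
  then obtain x where x: "\<And>j. x j \<in> carrier_vec k" "\<And>j. M *\<^sub>v indicator_vec n j = N *\<^sub>v x j"
    by metis
  define W where "W = mat k n (\<lambda>(i, j). x j $ i)"
  have "M = N * W"
  proof (rule eq_matI)
    fix i j assume "i < dim_row (N * W)" "j < dim_col (N * W)"
    then have ij: "i < m" "j < n" using N by (auto simp: W_def)
    have "col W j = x j" using ij x(1)[of j] by (auto simp: W_def)
    then have "(N * W) $$ (i, j) = (N *\<^sub>v x j) $ i" using N ij by (simp add: W_def)
    also have "\<dots> = M $$ (i, j)" unfolding x(2)[symmetric] mult_mat_indicator_vec[OF M ij(2)] using M ij by simp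
    finally show "M $$ (i, j) = (N * W) $$ (i, j)" ..
  qed (use M N in \<open>auto simp: W_def\<close>)
  then show ?thesis by (intro bexI[of _ W]) (auto simp: W_def)
qed

lemma poly_act_kernel:
  assumes u: "u \<in> carrier_mat n n" and Y: "Y \<in> carrier_mat n k" and v: "v \<in> carrier_vec k"
    and zero: "Y *\<^sub>v v = 0\<^sub>v n"
  shows "poly_act u a Y l *\<^sub>v v = 0\<^sub>v n"
proof (induction l arbitrary: a)
  case 0
  then show ?case using Y v by (auto simp: scalar_prod_def)
next
  case (Suc l)
  let ?R = "poly_act u (\<lambda>i. a (Suc i)) Y l"
  have R: "?R \<in> carrier_mat n k" using u Y by simp
  have "poly_act u a Y (Suc l) *\<^sub>v v = (u * ?R) *\<^sub>v v + (a 0 \<cdot>\<^sub>m Y) *\<^sub>v v"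
    unfolding poly_act.simps using u R Y v by (intro add_mult_distrib_mat_vec[of _ n k]) auto
  also have "(u * ?R) *\<^sub>v v = 0\<^sub>v n"
    using assoc_mult_mat_vec[OF u R v] Suc mult_mat_zero_vec[OF u] by simp
  also have "(a 0 \<cdot>\<^sub>m Y) *\<^sub>v v = a 0 \<cdot>\<^sub>v (Y *\<^sub>v v)"
    using Y v by (intro eq_vecI) (auto simp: scalar_prod_def sum_distrib_left mult.assoc)
  also have "a 0 \<cdot>\<^sub>v (Y *\<^sub>v v) = 0\<^sub>v n" unfolding zero by (intro eq_vecI) auto
  finally show ?case by simp
qed

text \<open>
  Crossedness gives \<open>B y \<in> u E\<close> for all \<open>y\<close> and \<open>u E = u\<^sup>2 E\<close>, hence \<open>u = u\<^sup>2 w\<close>; and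
  \<open>ker u\<^sup>2 = ker u\<close> turns this into \<open>u w u = u\<close>.  Then \<open>u e = u\<close> by \<open>poly_act_greedy\<close>, and \<open>e\<close>
  fixes the image of \<open>B\<close>, which is that of \<open>u\<close>.  Since \<open>e\<close> kills the kernel of \<open>A\<close>, the decomposition
  \<open>E = ker A \<oplus> im B\<close> yields \<open>A e = A\<close>.
\<close>

lemma poly_act_crossed:
  fixes A B :: "'a :: {comm_ring, comm_monoid_mult} mat"
  assumes dt: "explicit_divisibility_test dt"
    and P: "projection_mat p P" and Q: "projection_mat q Q"
    and A: "represents_map P Q A" and B: "represents_map Q P B"
    and crossed: "crossed (image_module P) (image_module Q) (\<lambda>x. A *\<^sub>v x) (\<lambda>y. B *\<^sub>v y)"
  defines "u \<equiv> B * A"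
  defines "e \<equiv> poly_act u (inverse_coeff dt (\<lambda>k. block_char_coeff u p (p - k)) p) u p"
  shows "A * e = A \<and> e * B = B"
proof -
  note cA = represents_mapD(1)[OF P Q A] and cB = represents_mapD(1)[OF Q P B]
  have u: "u \<in> carrier_mat p p" using cA cB by (simp add: u_def)
  have uv: "u *\<^sub>v v = B *\<^sub>v (A *\<^sub>v v)" if "v \<in> carrier_vec p" for v
    unfolding u_def by (rule assoc_mult_mat_vec[OF cB cA that])
  have cr: "\<And>y. y \<in> carrier_vec q \<Longrightarrow> \<exists>x\<in>carrier_vec p. B *\<^sub>v y = u *\<^sub>v x"
    "\<And>x. x \<in> carrier_vec p \<Longrightarrow> u *\<^sub>v x = 0\<^sub>v p \<Longrightarrow> A *\<^sub>v x = 0\<^sub>v q"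
    "\<And>x. x \<in> carrier_vec p \<Longrightarrow> \<exists>y\<in>carrier_vec q. A *\<^sub>v x = A *\<^sub>v (B *\<^sub>v y)"
    "\<And>y. y \<in> carrier_vec q \<Longrightarrow> A *\<^sub>v (B *\<^sub>v y) = 0\<^sub>v q \<Longrightarrow> B *\<^sub>v y = 0\<^sub>v p"
    using crossed unfolding crossed_iff[OF P Q A B] by (auto simp: uv)
  have uu: "u * u \<in> carrier_mat p p" using u by simp
  have "\<exists>x\<in>carrier_vec p. u *\<^sub>v v = (u * u) *\<^sub>v x" if v: "v \<in> carrier_vec p" for v
  proof -
    obtain y where y: "y \<in> carrier_vec q" "A *\<^sub>v v = A *\<^sub>v (B *\<^sub>v y)" using cr(3)[OF v] by blast
    obtain x where x: "x \<in> carrier_vec p" "B *\<^sub>v y = u *\<^sub>v x" using cr(1)[OF y(1)] by blast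
    have "u *\<^sub>v v = u *\<^sub>v (u *\<^sub>v x)" 
      unfolding uv[OF v] y(2) x(2) by (rule uv[symmetric]) (use u x(1) in simp)
    then show ?thesis using assoc_mult_mat_vec[OF u u x(1)] x(1) by (intro bexI[of _ x]) simp_all
  qed
  from range_factor[OF u uu this] obtain w where w: "w \<in> carrier_mat p p" and "u = u * u * w" by blast
  then have uuw: "u * (u * w) = u" using assoc_mult_mat[OF u u w] by simp
  have ker: "u *\<^sub>v z = 0\<^sub>v p" if z: "z \<in> carrier_vec p" and uuz: "u *\<^sub>v (u *\<^sub>v z) = 0\<^sub>v p" for z
  proof -
    have "A *\<^sub>v (u *\<^sub>v z) = 0\<^sub>v q" using cr(2)[of "u *\<^sub>v z"] u z uuz by simp
    then have "A *\<^sub>v (B *\<^sub>v (A *\<^sub>v z)) = 0\<^sub>v q" using uv[OF z] by simp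
    then show ?thesis using cr(4)[of "A *\<^sub>v z"] cA z uv[OF z] by simp
  qed
  have uwu: "u * w * u = u"
  proof (rule mat_eq_by_mult_vec[of _ p p])
    fix v :: "'a vec" assume v: "v \<in> carrier_vec p"
    define z where "z = w *\<^sub>v (u *\<^sub>v v)"
    have z: "z \<in> carrier_vec p" unfolding z_def using u w v by simp
    have uz: "u * w * u *\<^sub>v v = u *\<^sub>v z"
      using assoc_mult_mat_vec[of "u * w" p p u p v] assoc_mult_mat_vec[OF u w, of "u *\<^sub>v v"] u w v
      by (simp add: z_def)
    have "u *\<^sub>v (u *\<^sub>v z) = (u * (u * w)) *\<^sub>v (u *\<^sub>v v)"
      unfolding z_def using assoc_mult_mat_vec[OF u, of "u * w" p "u *\<^sub>v v"]
        assoc_mult_mat_vec[OF u w, of "u *\<^sub>v v"] u w v by simp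
    then have "u *\<^sub>v (u *\<^sub>v (z - v)) = 0\<^sub>v p"
      unfolding uuw mult_mat_vec_diff[OF u z v]
      using mult_mat_vec_diff[OF u, of "u *\<^sub>v z" "u *\<^sub>v v"] u z v by simp
    then have "u *\<^sub>v (z - v) = 0\<^sub>v p" using ker[of "z - v"] z v by simp
    then show "u * w * u *\<^sub>v v = u *\<^sub>v v"
      unfolding uz mult_mat_vec_diff[OF u z v] using vec_diff_eq_zero[of "u *\<^sub>v z" p "u *\<^sub>v v"] u z v by simp
  qed (use u w in auto)
  have e: "e \<in> carrier_mat p p" using u by (simp add: e_def)
  have ue: "u * e = u" unfolding e_def by (rule poly_act_greedy[OF dt u w uuw uwu])
  have eu: "e * u = u" unfolding e_def poly_act_mult_right[OF u u u]
    using mult_poly_act[OF u u] ue by (simp add: e_def)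
  have eB: "e * B = B"
  proof (rule mat_eq_by_mult_vec[of _ p q])
    fix y :: "'a vec" assume y: "y \<in> carrier_vec q"
    obtain x where x: "x \<in> carrier_vec p" "B *\<^sub>v y = u *\<^sub>v x" using cr(1)[OF y] by blast
    show "e * B *\<^sub>v y = B *\<^sub>v y"
      unfolding assoc_mult_mat_vec[OF e cB y] x(2) assoc_mult_mat_vec[OF e u x(1), symmetric] eu ..
  qed (use e cB in auto)
  moreover have "A * e = A"
  proof (rule mat_eq_by_mult_vec[of _ q p])
    fix v :: "'a vec" assume v: "v \<in> carrier_vec p"
    obtain y where y: "y \<in> carrier_vec q" "A *\<^sub>v v = A *\<^sub>v (B *\<^sub>v y)" using cr(3)[OF v] by blast
    have By: "B *\<^sub>v y \<in> carrier_vec p" using cB y by simp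
    have "u *\<^sub>v (v - B *\<^sub>v y) = 0\<^sub>v p"
      unfolding mult_mat_vec_diff[OF u v By] uv[OF v] uv[OF By] y(2) using cA cB y(1) by auto
    then have "e *\<^sub>v (v - B *\<^sub>v y) = 0\<^sub>v p"
      unfolding e_def using v By by (intro poly_act_kernel[OF u u]) auto
    then have "e *\<^sub>v v = e *\<^sub>v (B *\<^sub>v y)"
      unfolding mult_mat_vec_diff[OF e v By] using vec_diff_eq_zero[of "e *\<^sub>v v" p "e *\<^sub>v (B *\<^sub>v y)"] e v By by simp
    also have "\<dots> = B *\<^sub>v y" using assoc_mult_mat_vec[OF e cB y(1)] eB by simp
    finally show "A * e *\<^sub>v v = A *\<^sub>v v"
      unfolding assoc_mult_mat_vec[OF cA e v] y(2) by simp
  qed (use e cA in auto)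
  ultimately show ?thesis by simp
qed

text \<open>
  The factorisation \<open>G = C B\<close> says that \<open>G\<close> vanishes on the kernel of \<open>B\<close>, which is the part of the
  condition on \<open>A G\<close> that the equations between matrices do not express.
\<close>

lemma is_Ig_matI:
  fixes A B G C :: "'a :: {comm_ring, comm_monoid_mult} mat"
  assumes P: "projection_mat p P" and Q: "projection_mat q Q"
    and A: "represents_map P Q A" and B: "represents_map Q P B" and G: "represents_map Q P G"
    and C: "C \<in> carrier_mat p p"
    and AGA: "A * (G * A) = A" and GAG: "G * (A * G) = G" and GAB: "G * (A * B) = B" and GCB: "G = C * B"
  shows "is_Ig class_ring (image_module P) (image_module Q) (\<lambda>x. A *\<^sub>v x) (\<lambda>y. B *\<^sub>v y) (\<lambda>y. G *\<^sub>v y)"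
proof -
  note memE = mem_image_projection[OF P] and memF = mem_image_projection[OF Q]
  have cP: "P \<in> carrier_mat p p" and cQ: "Q \<in> carrier_mat q q"
    using P Q by (simp_all add: projection_mat_def)
  note cA = represents_mapD(1)[OF P Q A] and cB = represents_mapD(1)[OF Q P B]
    and cG = represents_mapD(1)[OF Q P G]
  have mult3: "M *\<^sub>v (N *\<^sub>v (K *\<^sub>v v)) = (M * (N * K)) *\<^sub>v v"
    if "M \<in> carrier_mat a b" "N \<in> carrier_mat b c" "K \<in> carrier_mat c d" "v \<in> carrier_vec d"
    for M N K :: "'a mat" and v a b c d
    using assoc_mult_mat_vec[OF that(1), of "N * K" d v] assoc_mult_mat_vec[OF that(2-4)] that by simp
  have kerA: "a_kernel (image_module P) (image_module Q) (\<lambda>x. A *\<^sub>v x)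
      = {x. x \<in> carrier_vec p \<and> P *\<^sub>v x = x \<and> A *\<^sub>v x = 0\<^sub>v q}"
    using memE cQ by (auto simp: a_kernel_def')
  have kerB: "a_kernel (image_module Q) (image_module P) (\<lambda>y. B *\<^sub>v y)
      = {y. y \<in> carrier_vec q \<and> Q *\<^sub>v y = y \<and> B *\<^sub>v y = 0\<^sub>v p}"
    using memF cP by (auto simp: a_kernel_def')
  show ?thesis
    unfolding is_Ig_def
  proof (intro conjI ballI)
    show "(\<lambda>y. G *\<^sub>v y) \<in> LinearCombinations.module_hom class_ring (image_module Q) (image_module P)"
    proof -
      have "G *\<^sub>v y \<in> carrier (image_module P)" if "y \<in> carrier (image_module Q)" for y
      proof -
        have y: "y \<in> carrier_vec q" using that memF by blast
        show ?thesis unfolding memE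
          using assoc_mult_mat_vec[OF cP cG y] represents_mapD(3)[OF Q P G] cG y by simp
      qed
      moreover have "G *\<^sub>v (y + z) = G *\<^sub>v y + G *\<^sub>v z"
        if "y \<in> carrier (image_module Q)" "z \<in> carrier (image_module Q)" for y z
        using that memF mult_add_distrib_mat_vec[OF cG] by blast
      moreover have "G *\<^sub>v (c \<cdot>\<^sub>v y) = c \<cdot>\<^sub>v (G *\<^sub>v y)" if "y \<in> carrier (image_module Q)" for c y
        using that memF mult_mat_vec_smult[OF cG] by blast
      ultimately show ?thesis
        unfolding LinearCombinations.module_hom_def image_module_simps(2-) by blast
    qed
    show "projection_onto_along (image_module Q) ((\<lambda>x. A *\<^sub>v x) ` carrier (image_module P))
      (a_kernel (image_module Q) (image_module P) (\<lambda>y. B *\<^sub>v y)) ((\<lambda>x. A *\<^sub>v x) \<circ> (\<lambda>y. G *\<^sub>v y))"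
      unfolding projection_onto_along_def kerB o_def
    proof (intro ballI)
      fix w k assume "w \<in> (\<lambda>x. A *\<^sub>v x) ` carrier (image_module P)"
        and k: "k \<in> {y. y \<in> carrier_vec q \<and> Q *\<^sub>v y = y \<and> B *\<^sub>v y = 0\<^sub>v p}"
      then obtain x where x: "x \<in> carrier_vec p" and w: "w = A *\<^sub>v x" using memE by blast
      have wq: "w \<in> carrier_vec q" using w cA x by simp
      have k: "k \<in> carrier_vec q" "B *\<^sub>v k = 0\<^sub>v p" using k by auto
      have "G *\<^sub>v k = 0\<^sub>v p"
        unfolding GCB assoc_mult_mat_vec[OF C cB k(1)] k(2) by (rule mult_mat_zero_vec[OF C])
      then have "G *\<^sub>v (w + k) = G *\<^sub>v w"
        unfolding mult_add_distrib_mat_vec[OF cG wq k(1)] using cG wq by simp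
      then show "A *\<^sub>v (G *\<^sub>v (w \<oplus>\<^bsub>image_module Q\<^esub> k)) = w"
        unfolding image_module_simps using mult3[OF cA cG cA x] AGA w by simp
    qed
    show "projection_onto_along (image_module P) ((\<lambda>y. B *\<^sub>v y) ` carrier (image_module Q))
      (a_kernel (image_module P) (image_module Q) (\<lambda>x. A *\<^sub>v x)) ((\<lambda>y. G *\<^sub>v y) \<circ> (\<lambda>x. A *\<^sub>v x))"
      unfolding projection_onto_along_def kerA o_def
    proof (intro ballI)
      fix w k assume "w \<in> (\<lambda>y. B *\<^sub>v y) ` carrier (image_module Q)"
        and k: "k \<in> {x. x \<in> carrier_vec p \<and> P *\<^sub>v x = x \<and> A *\<^sub>v x = 0\<^sub>v q}"
      then obtain y where y: "y \<in> carrier_vec q" and w: "w = B *\<^sub>v y" using memF by blast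
      have wp: "w \<in> carrier_vec p" using w cB y by simp
      have k: "k \<in> carrier_vec p" "A *\<^sub>v k = 0\<^sub>v q" using k by auto
      have "A *\<^sub>v (w + k) = A *\<^sub>v w"
        unfolding mult_add_distrib_mat_vec[OF cA wp k(1)] k(2) using cA wp by simp
      then show "G *\<^sub>v (A *\<^sub>v (w \<oplus>\<^bsub>image_module P\<^esub> k)) = w"
        unfolding image_module_simps using mult3[OF cG cA cB y] GAB w by simp
    qed
    show "A *\<^sub>v (G *\<^sub>v (A *\<^sub>v x)) = A *\<^sub>v x" if "x \<in> carrier (image_module P)" for x
      using that memE mult3[OF cA cG cA] AGA by metis
    show "G *\<^sub>v (A *\<^sub>v (G *\<^sub>v y)) = G *\<^sub>v y" if "y \<in> carrier (image_module Q)" for y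
      using that memF mult3[OF cG cA cG] GAG by metis
  qed
qed

text \<open>
  The certificate equations give \<open>u e = e u = u\<close>.  Any polynomial in \<open>u\<close> commutes with \<open>u\<close>, so
  \<open>u x = x u = e\<close> and \<open>e x = x e = x\<close>: the matrix \<open>x\<close> is the group inverse of \<open>u\<close>.  All claims
  follow from these identities, for arbitrary coefficients \<open>a\<close>.
\<close>

lemma certificate_sound:
  fixes A B :: "'a :: {comm_ring, comm_monoid_mult} mat" and a l
  assumes P: "projection_mat p P" and Q: "projection_mat q Q"
    and A: "represents_map P Q A" and B: "represents_map Q P B"
  defines "u \<equiv> B * A"
  defines "e \<equiv> poly_act u a u l"
  defines "x \<equiv> poly_act u a e l"
  assumes Ae: "A * e = A" and eB: "e * B = B"
  shows "crossed (image_module P) (image_module Q) (\<lambda>x. A *\<^sub>v x) (\<lambda>y. B *\<^sub>v y)"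
    "represents_map Q P (x * B)"
    "is_Ig class_ring (image_module P) (image_module Q) (\<lambda>x. A *\<^sub>v x) (\<lambda>y. B *\<^sub>v y) (\<lambda>y. (x * B) *\<^sub>v y)"
    "represents_map P Q (A * x)"
    "is_Ig class_ring (image_module Q) (image_module P) (\<lambda>y. B *\<^sub>v y) (\<lambda>x. A *\<^sub>v x) (\<lambda>v. (A * x) *\<^sub>v v)"
proof -
  have cP: "P \<in> carrier_mat p p" and cQ: "Q \<in> carrier_mat q q"
    using P Q by (simp_all add: projection_mat_def)
  note A' = represents_mapD[OF P Q A] and B' = represents_mapD[OF Q P B]
  note cA = A'(1) and cB = B'(1)
  have u: "u \<in> carrier_mat p p" using cA cB by (simp add: u_def)
  have e: "e \<in> carrier_mat p p" using u by (simp add: e_def)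
  have x: "x \<in> carrier_mat p p" using u e by (simp add: x_def)
  have eu: "e * u = u" using assoc_mult_mat[OF e cB cA] eB by (simp add: u_def)
  have ue: "u * e = u" using assoc_mult_mat[OF cB cA e] Ae by (simp add: u_def)
  have ee: "e * e = e"
    using poly_act_mult_right[OF u u e, of a l] by (simp add: ue e_def[symmetric])
  have xu: "x * u = e"
    using poly_act_mult_right[OF u e u, of a l] by (simp add: eu x_def[symmetric] e_def[symmetric])
  have ux: "u * x = e"
    using mult_poly_act[OF u e, of a l] by (simp add: ue x_def[symmetric] e_def[symmetric])
  have xe: "x * e = x"
    using poly_act_mult_right[OF u e e, of a l] by (simp add: ee x_def[symmetric])
  have ex: "e * x = x"
    using assoc_mult_mat[OF x u x] by (simp add: xu ux xe)
  have Pu: "P * u = u" using assoc_mult_mat[OF cP cB cA] B'(3) by (simp add: u_def)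
  have uP: "u * P = u" using assoc_mult_mat[OF cB cA cP] A'(2) by (simp add: u_def)
  have xx: "x * x \<in> carrier_mat p p" using x by simp
  have x1: "u * (x * x) = x" using assoc_mult_mat[OF u x x] by (simp add: ux ex)
  have x2: "x * x * u = x" using assoc_mult_mat[OF x x u] by (simp add: xu xe)
  have Px: "P * x = x" using assoc_mult_mat[OF cP u xx] by (simp add: Pu x1)
  have xP: "x * P = x" using assoc_mult_mat[OF xx u cP] by (simp add: uP x2)
  have cxB: "x * B \<in> carrier_mat p q" and cAx: "A * x \<in> carrier_mat q p" using x cA cB by simp_all
  have xBA: "x * B * A = e" using assoc_mult_mat[OF x cB cA] xu by (simp add: u_def)
  have BAx: "B * (A * x) = e" using assoc_mult_mat[OF cB cA x] ux by (simp add: u_def)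
  have ABx: "B * A = u" by (simp add: u_def)
  show repG: "represents_map Q P (x * B)"
    using assoc_mult_mat[OF x cB cQ] assoc_mult_mat[OF cP x cB] Px B'(2)
    by (intro represents_mapI[OF Q P cxB]) simp_all
  show repH: "represents_map P Q (A * x)"
    using assoc_mult_mat[OF cA x cP] assoc_mult_mat[OF cQ cA x] xP A'(3)
    by (intro represents_mapI[OF P Q cAx]) simp_all
  show "is_Ig class_ring (image_module P) (image_module Q) (\<lambda>x. A *\<^sub>v x) (\<lambda>y. B *\<^sub>v y) (\<lambda>y. (x * B) *\<^sub>v y)"
  proof (rule is_Ig_matI[OF P Q A B repG x])
    show "A * (x * B * A) = A" by (simp add: xBA Ae)
    show "x * B * (A * (x * B)) = x * B"
      using assoc_mult_mat[OF cxB cA cxB] assoc_mult_mat[OF e x cB] by (simp add: xBA ex)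
    show "x * B * (A * B) = B"
      using assoc_mult_mat[OF cxB cA cB] by (simp add: xBA eB)
  qed simp
  show "is_Ig class_ring (image_module Q) (image_module P) (\<lambda>y. B *\<^sub>v y) (\<lambda>x. A *\<^sub>v x) (\<lambda>v. (A * x) *\<^sub>v v)"
  proof (rule is_Ig_matI[OF Q P B A repH])
    show cC: "A * (x * x * B) \<in> carrier_mat q q" using x cA cB by simp
    show "B * (A * x * B) = B"
      using assoc_mult_mat[OF cB cAx cB] by (simp add: BAx eB)
    show "A * x * (B * (A * x)) = A * x"
      using assoc_mult_mat[OF cA x e] by (simp add: BAx xe)
    show "A * x * (B * A) = A"
      using assoc_mult_mat[OF cA x u] by (simp add: ABx xu Ae)
    have "A * (x * x * B) * A = A * (x * x * B * A)"
      by (rule assoc_mult_mat[of _ q p _ q]) (use cA cB x in auto)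
    also have "x * x * B * A = x"
      using assoc_mult_mat[OF xx cB cA] by (simp add: ABx x2)
    finally show "A * x = A * (x * x * B) * A" ..
  qed
  show "crossed (image_module P) (image_module Q) (\<lambda>x. A *\<^sub>v x) (\<lambda>y. B *\<^sub>v y)"
    unfolding crossed_iff[OF P Q A B]
  proof (intro conjI ballI impI)
    have By: "B *\<^sub>v y = x *\<^sub>v (B *\<^sub>v (A *\<^sub>v (B *\<^sub>v y)))" if y: "y \<in> carrier_vec q" for y
    proof -
      have "B *\<^sub>v y \<in> carrier_vec p" using cB y by simp
      then show ?thesis
        using assoc_mult_mat_vec[OF e cB y] assoc_mult_mat_vec[OF x u, of "B *\<^sub>v y"]
          assoc_mult_mat_vec[OF cB cA, of "B *\<^sub>v y", folded u_def] by (simp add: eB xu)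
    qed
    have Av: "A *\<^sub>v v = A *\<^sub>v (x *\<^sub>v (B *\<^sub>v (A *\<^sub>v v)))" if v: "v \<in> carrier_vec p" for v
      using assoc_mult_mat_vec[OF cA e v] assoc_mult_mat_vec[OF x u v] assoc_mult_mat_vec[OF cB cA v, folded u_def]
      by (simp add: Ae xu)
    show "\<exists>v\<in>carrier_vec p. B *\<^sub>v y = B *\<^sub>v (A *\<^sub>v v)" if y: "y \<in> carrier_vec q" for y
    proof (rule bexI[of _ "x *\<^sub>v (B *\<^sub>v y)"])
      have By: "B *\<^sub>v y \<in> carrier_vec p" using cB y by simp
      show "B *\<^sub>v y = B *\<^sub>v (A *\<^sub>v (x *\<^sub>v (B *\<^sub>v y)))"
        using assoc_mult_mat_vec[OF e cB y] assoc_mult_mat_vec[OF cB cAx By] assoc_mult_mat_vec[OF cA x By]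
        by (simp add: eB BAx)
      show "x *\<^sub>v (B *\<^sub>v y) \<in> carrier_vec p" using x By by simp
    qed
    show "A *\<^sub>v v = 0\<^sub>v q" if "v \<in> carrier_vec p" "B *\<^sub>v (A *\<^sub>v v) = 0\<^sub>v p" for v
      using Av[OF that(1)] unfolding that(2) mult_mat_zero_vec[OF x] mult_mat_zero_vec[OF cA] .
    show "\<exists>y\<in>carrier_vec q. A *\<^sub>v v = A *\<^sub>v (B *\<^sub>v y)" if v: "v \<in> carrier_vec p" for v
    proof (rule bexI[of _ "A *\<^sub>v (x *\<^sub>v v)"])
      show "A *\<^sub>v v = A *\<^sub>v (B *\<^sub>v (A *\<^sub>v (x *\<^sub>v v)))"
        using assoc_mult_mat_vec[OF cA e v] assoc_mult_mat_vec[OF cB cAx v] assoc_mult_mat_vec[OF cA x v]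
        by (simp add: Ae BAx)
      show "A *\<^sub>v (x *\<^sub>v v) \<in> carrier_vec q" using cA x v by simp
    qed
    show "B *\<^sub>v y = 0\<^sub>v p" if "y \<in> carrier_vec q" "A *\<^sub>v (B *\<^sub>v y) = 0\<^sub>v q" for y
      using By[OF that(1)] unfolding that(2) mult_mat_zero_vec[OF x] mult_mat_zero_vec[OF cB] .
  qed
qed

section \<open>Cost bounds and frames read off from the program text\<close>

text \<open>
  All loops of the programs below run at most \<open>n + 1\<close> times, which is visible from their text: the
  bounds are built from the two dimensions and the counters of enclosing loops.  For such programs
  (\<open>short_loops V\<close>, where \<open>V\<close> contains the variables known to be at most \<open>n\<close>) the following bounds
  hold regardless of what the program computes.  The branches of a conditional are added up.
\<close>

primrec ops_bound :: "com \<Rightarrow> nat \<Rightarrow> nat" where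
  "ops_bound Skip n = 0"
| "ops_bound (Seq c d) n = ops_bound c n + ops_bound d n"
| "ops_bound (ISet x e) n = 0"
| "ops_bound (IfLess a b c d) n = ops_bound c n + ops_bound d n"
| "ops_bound (For x e c) n = Suc n * ops_bound c n"
| "ops_bound (RSet k i j e) n = rcost e"
| "ops_bound (IfDivides a b k i j c d) n = rcost a + rcost b + ops_bound c n + ops_bound d n"

primrec tests_bound :: "com \<Rightarrow> nat \<Rightarrow> nat" where
  "tests_bound Skip n = 0"
| "tests_bound (Seq c d) n = tests_bound c n + tests_bound d n"
| "tests_bound (ISet x e) n = 0"
| "tests_bound (IfLess a b c d) n = tests_bound c n + tests_bound d n"
| "tests_bound (For x e c) n = Suc n * tests_bound c n"
| "tests_bound (RSet k i j e) n = 0"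
| "tests_bound (IfDivides a b k i j c d) n = 1 + tests_bound c n + tests_bound d n"

fun short_bound :: "nat set \<Rightarrow> iexp \<Rightarrow> bool" where
  "short_bound V (IVar v) \<longleftrightarrow> v \<in> V"
| "short_bound V (IAdd (IVar v) (INum c)) \<longleftrightarrow> v \<in> V \<and> c \<le> 1"
| "short_bound V (ISub (IVar v) e) \<longleftrightarrow> v \<in> V"
| "short_bound V _ \<longleftrightarrow> False"

primrec short_loops :: "nat set \<Rightarrow> com \<Rightarrow> bool" where
  "short_loops V Skip \<longleftrightarrow> True"
| "short_loops V (Seq c d) \<longleftrightarrow> short_loops V c \<and> short_loops V d"
| "short_loops V (ISet x e) \<longleftrightarrow> x \<notin> V"
| "short_loops V (IfLess a b c d) \<longleftrightarrow> short_loops V c \<and> short_loops V d"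
| "short_loops V (For x e c) \<longleftrightarrow> short_bound V e \<and> short_loops (insert x V) c"
| "short_loops V (RSet k i j e) \<longleftrightarrow> True"
| "short_loops V (IfDivides a b k i j c d) \<longleftrightarrow> short_loops V c \<and> short_loops V d"

lemma short_bound_le:
  "short_bound V e \<Longrightarrow> \<forall>v\<in>V. w v \<le> n \<Longrightarrow> ieval e w \<le> Suc n"
  by (induction V e rule: short_bound.induct) force+

lemma cost_fold:
  assumes step: "\<And>i s. i \<le> n \<Longrightarrow> I s \<Longrightarrow>
      I (b i s) \<and> ops (b i s) \<le> ops s + f \<and> tests s \<le> tests (b i s) \<and> tests (b i s) \<le> tests s + g"
    and "\<forall>i\<in>set xs. i \<le> n" "I s"
  shows "I (fold b xs s) \<and> ops (fold b xs s) \<le> ops s + length xs * f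
    \<and> tests s \<le> tests (fold b xs s) \<and> tests (fold b xs s) \<le> tests s + length xs * g"
  using assms(2,3)
proof (induction xs arbitrary: s)
  case (Cons i xs)
  then show ?case using step[of i s] Cons.IH[of "b i s"] by force
qed simp

lemma cost_exec:
  assumes "short_loops V c" "\<forall>v\<in>V. idx s v \<le> n"
  shows "(\<forall>v\<in>V. idx (exec dt c s) v \<le> n) \<and> ops (exec dt c s) \<le> ops s + ops_bound c n
    \<and> tests s \<le> tests (exec dt c s) \<and> tests (exec dt c s) \<le> tests s + tests_bound c n"
  using assms
proof (induction c arbitrary: V s)
  case (Seq c d)
  then show ?case using Seq.IH(1)[of V s] Seq.IH(2)[of V "exec dt c s"] by force
next
  case (IfLess a b c d)
  then show ?case using IfLess.IH(1)[of V s] IfLess.IH(2)[of V s] by force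
next
  case (For x e c)
  define N where "N = ieval e (idx s)"
  have N: "N \<le> Suc n" using short_bound_le[of V e "idx s" n] For.prems by (simp add: N_def)
  have "(\<forall>v\<in>V. idx (exec dt (For x e c) s) v \<le> n)
    \<and> ops (exec dt (For x e c) s) \<le> ops s + length [0..<N] * ops_bound c n
    \<and> tests s \<le> tests (exec dt (For x e c) s)
    \<and> tests (exec dt (For x e c) s) \<le> tests s + length [0..<N] * tests_bound c n"
    unfolding exec.simps N_def[symmetric]
  proof (rule cost_fold[where n = n])
    fix i and t :: "'a state"
    assume i: "i \<le> n" and t: "\<forall>v\<in>V. idx t v \<le> n"
    let ?t = "t\<lparr>idx := (idx t)(x := i)\<rparr>"
    have "\<forall>v\<in>insert x V. idx ?t v \<le> n" using i t by simp
    from For.IH[OF _ this] For.prems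
    show "(\<forall>v\<in>V. idx (exec dt c ?t) v \<le> n) \<and> ops (exec dt c ?t) \<le> ops t + ops_bound c n
      \<and> tests t \<le> tests (exec dt c ?t) \<and> tests (exec dt c ?t) \<le> tests t + tests_bound c n" by simp
  qed (use N For.prems in auto)
  moreover have "N * ops_bound c n \<le> Suc n * ops_bound c n" "N * tests_bound c n \<le> Suc n * tests_bound c n"
    using N by (intro mult_right_mono; simp)+
  ultimately show ?case by simp
next
  case (IfDivides a b k i j c d)
  let ?s = "s\<lparr>ops := ops s + rcost a + rcost b, tests := tests s + 1\<rparr>"
  show ?case
  proof (cases "dt (reval a s) (reval b s)")
    case None
    then show ?thesis using IfDivides.prems IfDivides.IH(2)[of V ?s] by (simp add: Let_def)
  next
    case (Some z)
    then show ?thesis using IfDivides.prems IfDivides.IH(1)[of V "store k i j z ?s"]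
      by (simp add: Let_def store_def)
  qed
qed (auto simp: store_def)

text \<open>
  The matrices and index variables outside these sets are left unchanged, which disposes of all
  frame conditions.
\<close>

primrec writes :: "com \<Rightarrow> nat set" where
  "writes Skip = {}"
| "writes (Seq c d) = writes c \<union> writes d"
| "writes (ISet x e) = {}"
| "writes (IfLess a b c d) = writes c \<union> writes d"
| "writes (For x e c) = writes c"
| "writes (RSet k i j e) = {k}"
| "writes (IfDivides a b k i j c d) = insert k (writes c \<union> writes d)"

primrec assigns :: "com \<Rightarrow> nat set" where
  "assigns Skip = {}"
| "assigns (Seq c d) = assigns c \<union> assigns d"
| "assigns (ISet x e) = {x}"
| "assigns (IfLess a b c d) = assigns c \<union> assigns d"
| "assigns (For x e c) = insert x (assigns c)"
| "assigns (RSet k i j e) = {}"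
| "assigns (IfDivides a b k i j c d) = assigns c \<union> assigns d"

lemma exec_For_invariant:
  assumes "I 0 s"
    and "\<And>i t. i < ieval e (idx s) \<Longrightarrow> I i t \<Longrightarrow> I (Suc i) (exec dt c (t\<lparr>idx := (idx t)(x := i)\<rparr>))"
  shows "I (ieval e (idx s)) (exec dt (For x e c) s)"
proof -
  have "I m (fold (\<lambda>i t. exec dt c (t\<lparr>idx := (idx t)(x := i)\<rparr>)) [0..<m] s)" if "m \<le> ieval e (idx s)" for m
    using that by (induction m) (use assms in auto)
  then show ?thesis by (simp add: exec.simps(5))
qed

declare exec.simps(5) [simp del]

lemma frame:
  "(\<forall>k i j. k \<notin> writes c \<longrightarrow> mem (exec dt c s) (k, i, j) = mem s (k, i, j)) \<and>
   (\<forall>x. x \<notin> assigns c \<longrightarrow> idx (exec dt c s) x = idx s x)"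
proof (induction c arbitrary: s)
  case (For x e c)
  show ?case
    by (rule exec_For_invariant[where I = "\<lambda>_ t.
      (\<forall>k i j. k \<notin> writes (For x e c) \<longrightarrow> mem t (k, i, j) = mem s (k, i, j)) \<and>
      (\<forall>y. y \<notin> assigns (For x e c) \<longrightarrow> idx t y = idx s y)"])
      (use For in auto)
next
  case (IfDivides a b k i j c d)
  then show ?case by (auto simp: Let_def store_def split: option.splits)
qed (auto simp: store_def)

lemmas frame_mem = frame[THEN conjunct1, rule_format]
lemmas frame_idx = frame[THEN conjunct2, rule_format]

lemma holds_mat_frame:
  "k \<notin> writes c \<Longrightarrow> holds_mat s k M \<Longrightarrow> holds_mat (exec dt c s) k M"
  by (simp add: holds_mat_def frame_mem)

section \<open>Loops\<close>

text \<open>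
  The last assumption on the body lets it read the old content of the cells not yet overwritten.
\<close>

lemma exec_fill_row:
  fixes s :: "'a :: {comm_ring, comm_monoid_mult} state"
  assumes v: "v \<notin> assigns b"
    and body: "\<And>i t. i < ieval e (idx s) \<Longrightarrow> idx t v = i \<Longrightarrow>
      (\<And>x. x \<noteq> v \<Longrightarrow> x \<notin> assigns b \<Longrightarrow> idx t x = idx s x) \<Longrightarrow>
      (\<And>k' a j. k' \<noteq> k \<or> a \<noteq> r \<Longrightarrow> mem t (k', a, j) = mem s (k', a, j)) \<Longrightarrow>
      (\<And>j. i \<le> j \<Longrightarrow> mem t (k, r, j) = mem s (k, r, j)) \<Longrightarrow>
      mem (exec dt b t) = (mem t)((k, r, i) := f i)"
  shows "mem (exec dt (For v e b) s) =
    (\<lambda>(k', a, j). if k' = k \<and> a = r \<and> j < ieval e (idx s) then f j else mem s (k', a, j))"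
proof -
  define I where "I = (\<lambda>n (t :: 'a state). mem t = (\<lambda>(k', a, j). if k' = k \<and> a = r \<and> j < n then f j else mem s (k', a, j)) \<and>
      (\<forall>x. x \<noteq> v \<longrightarrow> x \<notin> assigns b \<longrightarrow> idx t x = idx s x))"
  have "I (ieval e (idx s)) (exec dt (For v e b) s)"
  proof (rule exec_For_invariant)
    show "I 0 s" by (auto simp: I_def)
    fix i t assume i: "i < ieval e (idx s)" and I: "I i t"
    let ?t = "t\<lparr>idx := (idx t)(v := i)\<rparr>"
    have "mem (exec dt b ?t) = (mem ?t)((k, r, i) := f i)"
      by (rule body[OF i]) (use I in \<open>auto simp: I_def\<close>)
    then show "I (Suc i) (exec dt b ?t)"
      using I frame_idx[of _ b dt ?t] by (auto simp: I_def fun_eq_iff less_Suc_eq)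
  qed
  then show ?thesis by (simp add: I_def)
qed

lemma exec_fill_matrix:
  fixes s :: "'a :: {comm_ring, comm_monoid_mult} state"
  assumes v: "v \<notin> assigns b" "w \<notin> assigns b" "v \<noteq> w" "writes b \<subseteq> {k}"
    and e': "\<And>t :: 'a state. (\<And>x. x \<noteq> v \<Longrightarrow> x \<noteq> w \<Longrightarrow> x \<notin> assigns b \<Longrightarrow> idx t x = idx s x) \<Longrightarrow> ieval e' (idx t) = ieval e' (idx s)"
    and body: "\<And>i j t. i < ieval e (idx s) \<Longrightarrow> j < ieval e' (idx s) \<Longrightarrow> idx t v = i \<Longrightarrow> idx t w = j \<Longrightarrow>
      (\<And>x. x \<noteq> v \<Longrightarrow> x \<noteq> w \<Longrightarrow> x \<notin> assigns b \<Longrightarrow> idx t x = idx s x) \<Longrightarrow>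
      (\<And>k' a j. k' \<noteq> k \<Longrightarrow> mem t (k', a, j) = mem s (k', a, j)) \<Longrightarrow>
      mem (exec dt b t) = (mem t)((k, i, j) := f i j)"
  shows "\<forall>i<ieval e (idx s). \<forall>j<ieval e' (idx s). mem (exec dt (For v e (For w e' b)) s) (k, i, j) = f i j"
proof -
  define I where "I = (\<lambda>n (t :: 'a state). (\<forall>i<n. \<forall>j<ieval e' (idx s). mem t (k, i, j) = f i j) \<and>
      (\<forall>x. x \<noteq> v \<longrightarrow> x \<noteq> w \<longrightarrow> x \<notin> assigns b \<longrightarrow> idx t x = idx s x) \<and>
      (\<forall>k' a j. k' \<noteq> k \<longrightarrow> mem t (k', a, j) = mem s (k', a, j)))"
  have "I (ieval e (idx s)) (exec dt (For v e (For w e' b)) s)"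
  proof (rule exec_For_invariant)
    show "I 0 s" by (auto simp: I_def)
    fix i t assume i: "i < ieval e (idx s)" and I: "I i t"
    let ?t = "t\<lparr>idx := (idx t)(v := i)\<rparr>"
    have N: "ieval e' (idx ?t) = ieval e' (idx s)"
      by (rule e') (use I in \<open>auto simp: I_def\<close>)
    have "mem (exec dt (For w e' b) ?t) =
      (\<lambda>(k', a, j). if k' = k \<and> a = i \<and> j < ieval e' (idx ?t) then f i j else mem ?t (k', a, j))"
    proof (rule exec_fill_row[OF v(2)])
      fix j and t' :: "'a state"
      assume "j < ieval e' (idx ?t)" and "idx t' w = j"
        and "\<And>x. x \<noteq> w \<Longrightarrow> x \<notin> assigns b \<Longrightarrow> idx t' x = idx ?t x"
        and "\<And>k' a j. k' \<noteq> k \<or> a \<noteq> i \<Longrightarrow> mem t' (k', a, j) = mem ?t (k', a, j)"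
      then show "mem (exec dt b t') = (mem t')((k, i, j) := f i j)"
        using I v i N by (intro body) (auto simp: I_def)
    qed
    then show "I (Suc i) (exec dt (For w e' b) ?t)"
      using I N frame_idx[of _ "For w e' b" dt ?t] by (auto simp: I_def less_Suc_eq)
  qed
  then show ?thesis by (simp add: I_def)
qed

lemma exec_accumulate:
  fixes s :: "'a :: {comm_ring, comm_monoid_mult} state"
  assumes ij: "\<And>l. ieval i ((idx s)(v := l)) = i'" "\<And>l. ieval j ((idx s)(v := l)) = j'"
    and step: "\<And>l t. l < ieval e (idx s) \<Longrightarrow> idx t = (idx s)(v := l) \<Longrightarrow>
      (\<And>x. x \<noteq> (k, i', j') \<Longrightarrow> mem t x = mem s x) \<Longrightarrow> reval r t = mem t (k, i', j') + f l"
  shows "mem (exec dt (For v e (RSet k i j r)) s)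
    = (mem s)((k, i', j') := mem s (k, i', j') + (\<Sum>l<ieval e (idx s). f l))"
proof -
  define I where "I = (\<lambda>n (t :: 'a state). mem t = (mem s)((k, i', j') := mem s (k, i', j') + (\<Sum>l<n. f l)) \<and>
    (\<forall>x. x \<noteq> v \<longrightarrow> idx t x = idx s x))"
  have "I (ieval e (idx s)) (exec dt (For v e (RSet k i j r)) s)"
  proof (rule exec_For_invariant)
    show "I 0 s" by (auto simp: I_def)
    fix l t assume l: "l < ieval e (idx s)" and I: "I l t"
    let ?t = "t\<lparr>idx := (idx t)(v := l)\<rparr>"
    have idx: "idx ?t = (idx s)(v := l)" using I by (auto simp: I_def)
    have "reval r ?t = mem ?t (k, i', j') + f l"
      by (rule step[OF l idx]) (use I in \<open>auto simp: I_def\<close>)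
    then show "I (Suc l) (exec dt (RSet k i j r) ?t)"
      using I idx by (auto simp: I_def store_def ij add.assoc)
  qed
  then show ?thesis by (simp add: I_def)
qed

section \<open>The programs\<close>

text \<open>
  Use of the memory, besides the input in 0 to 3 and the output in 4 and 5: matrix 6 is \<open>u\<close>; row 0 of
  matrix 7 holds the coefficients \<open>block_char_coeff\<close>; row \<open>l\<close> of matrix 8 is the last column of the
  \<open>l\<close>-th power of the current leading block; row 0 of matrix 9 holds the coefficients of the
  certificate; row 0 of matrix 10 holds scalars (the remaining idempotent in cell 0, the quotients
  returned by the final tests in cell 5); matrix 11 is \<open>e\<close>, 12 is scratch space of the Horner
  scheme, 13 is \<open>x\<close>, 14 and 15 are \<open>A e\<close> and \<open>e B\<close>.  Loop counters are the variables from 10 on.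
\<close>

definition sum_cell :: "nat \<Rightarrow> iexp \<Rightarrow> iexp \<Rightarrow> nat \<Rightarrow> iexp \<Rightarrow> rexp \<Rightarrow> com" where
  "sum_cell k i j v e r = Seq (RSet k i j RZero) (For v e (RSet k i j (RAdd (RCell k i j) r)))"

definition mult_prog :: "nat \<Rightarrow> nat \<Rightarrow> nat \<Rightarrow> nat \<Rightarrow> nat \<Rightarrow> nat \<Rightarrow> com" where
  "mult_prog r m c k a b = For 10 (IVar r) (For 11 (IVar c)
     (sum_cell k (IVar 10) (IVar 11) 12 (IVar m)
       (RMul (RCell a (IVar 10) (IVar 12)) (RCell b (IVar 12) (IVar 11)))))"

lemma exec_sum_cell:
  fixes s :: "'a :: {comm_ring, comm_monoid_mult} state"
  assumes ij: "\<And>l. ieval i ((idx s)(v := l)) = i'" "\<And>l. ieval j ((idx s)(v := l)) = j'"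
    and step: "\<And>l t. l < ieval e (idx s) \<Longrightarrow> idx t = (idx s)(v := l) \<Longrightarrow>
      (\<And>x. x \<noteq> (k, i', j') \<Longrightarrow> mem t x = mem s x) \<Longrightarrow> reval r t = f l"
  shows "mem (exec dt (sum_cell k i j v e r) s) = (mem s)((k, i', j') := \<Sum>l<ieval e (idx s). f l)"
proof -
  let ?s = "exec dt (RSet k i j RZero) s"
  have s: "idx ?s = idx s" "mem ?s = (mem s)((k, i', j') := 0)"
    using ij[of "idx s v"] by (simp_all add: store_def)
  have "mem (exec dt (For v e (RSet k i j (RAdd (RCell k i j) r))) ?s)
    = (mem ?s)((k, i', j') := mem ?s (k, i', j') + (\<Sum>l<ieval e (idx ?s). f l))"
  proof (rule exec_accumulate)
    fix l and t :: "'a state"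
    assume *: "l < ieval e (idx ?s)" "idx t = (idx ?s)(v := l)"
      "\<And>x. x \<noteq> (k, i', j') \<Longrightarrow> mem t x = mem ?s x"
    have "reval r t = f l" by (rule step) (use * s in auto)
    moreover have "ieval i (idx t) = i'" "ieval j (idx t) = j'" using * s ij by simp_all
    ultimately show "reval (RAdd (RCell k i j) r) t = mem t (k, i', j') + f l" by simp
  qed (use ij s in auto)
  then show ?thesis using s by (simp add: sum_cell_def)
qed

lemma writes_assigns_sum_cell [simp]:
  "writes (sum_cell k i j v e r) = {k}" "assigns (sum_cell k i j v e r) = {v}"
  by (simp_all add: sum_cell_def)

lemma writes_assigns_mult_prog [simp]:
  "writes (mult_prog r m c k a b) = {k}" "assigns (mult_prog r m c k a b) = {10, 11, 12}"
  by (auto simp: mult_prog_def)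

lemma exec_mult_prog:
  assumes M: "holds_mat s a M" "M \<in> carrier_mat (idx s r) (idx s m)"
    and N: "holds_mat s b N" "N \<in> carrier_mat (idx s m) (idx s c)"
    and "k \<noteq> a" "k \<noteq> b" "r < 10" "m < 10" "c < 10"
  shows "holds_mat (exec dt (mult_prog r m c k a b) s) k (M * N)"
proof -
  have "\<forall>i<ieval (IVar r) (idx s). \<forall>j<ieval (IVar c) (idx s).
    mem (exec dt (mult_prog r m c k a b) s) (k, i, j) = (M * N) $$ (i, j)"
    unfolding mult_prog_def
  proof (rule exec_fill_matrix)
    fix i j and t :: "'a state"
    assume ij: "i < ieval (IVar r) (idx s)" "j < ieval (IVar c) (idx s)" "idx t 10 = i" "idx t 11 = j"
      and idx: "\<And>x. x \<noteq> 10 \<Longrightarrow> x \<noteq> 11 \<Longrightarrow>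
        x \<notin> assigns (sum_cell k (IVar 10) (IVar 11) 12 (IVar m)
          (RMul (RCell a (IVar 10) (IVar 12)) (RCell b (IVar 12) (IVar 11)))) \<Longrightarrow> idx t x = idx s x"
      and mem: "\<And>k' a j. k' \<noteq> k \<Longrightarrow> mem t (k', a, j) = mem s (k', a, j)"
    have m: "idx t m = idx s m" using idx assms(8) by simp
    have "mem (exec dt (sum_cell k (IVar 10) (IVar 11) 12 (IVar m)
        (RMul (RCell a (IVar 10) (IVar 12)) (RCell b (IVar 12) (IVar 11)))) t)
      = (mem t)((k, i, j) := \<Sum>l<ieval (IVar m) (idx t). M $$ (i, l) * N $$ (l, j))"
    proof (rule exec_sum_cell)
      fix l and t' :: "'a state"
      assume "l < ieval (IVar m) (idx t)" "idx t' = (idx t)(12 := l)"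
        "\<And>x. x \<noteq> (k, i, j) \<Longrightarrow> mem t' x = mem t x"
      then show "reval (RMul (RCell a (IVar 10) (IVar 12)) (RCell b (IVar 12) (IVar 11))) t'
          = M $$ (i, l) * N $$ (l, j)"
        using ij assms mem m by (simp add: holds_mat_def)
    qed (use ij in simp_all)
    also have "(\<Sum>l<ieval (IVar m) (idx t). M $$ (i, l) * N $$ (l, j)) = (M * N) $$ (i, j)"
      using index_mult_mat_sum[OF M(2) N(2)] ij m by simp
    finally show "mem (exec dt (sum_cell k (IVar 10) (IVar 11) 12 (IVar m)
        (RMul (RCell a (IVar 10) (IVar 12)) (RCell b (IVar 12) (IVar 11)))) t)
      = (mem t)((k, i, j) := (M * N) $$ (i, j))" .
  qed (use assms in auto)
  then show ?thesis using M N by (simp add: holds_mat_def)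
qed

text \<open>
  Variable 13 holds \<open>k\<close>, where the leading block of size \<open>k + 1\<close> is being added.
\<close>

definition powers_prog :: com where
  "powers_prog = Seq
     (For 10 (IAdd (IVar 13) (INum 1)) (IfLess (IVar 10) (IVar 13)
        (RSet 8 (INum 0) (IVar 10) RZero) (RSet 8 (INum 0) (IVar 10) ROne)))
     (For 14 (IAdd (IVar 13) (INum 1)) (For 10 (IAdd (IVar 13) (INum 1))
        (sum_cell 8 (IAdd (IVar 14) (INum 1)) (IVar 10) 11 (IAdd (IVar 13) (INum 1))
          (RMul (RCell 6 (IVar 10) (IVar 11)) (RCell 8 (IVar 14) (IVar 11))))))"

text \<open>
  The update from size \<open>k\<close> to size \<open>k + 1\<close> works in place: position \<open>m + 1\<close> uses new values at
  positions up to \<open>m\<close> and its own old value.  Position 0 always contains 1.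
\<close>

definition extend_prog :: com where
  "extend_prog = For 14 (IAdd (IVar 13) (INum 1)) (For 11 (IAdd (IVar 14) (INum 1))
     (RSet 7 (INum 0) (IAdd (IVar 14) (INum 1))
       (RSub (RCell 7 (INum 0) (IAdd (IVar 14) (INum 1)))
         (RMul (RCell 7 (INum 0) (ISub (IVar 14) (IVar 11)))
           (RCell 8 (IAdd (IVar 11) (INum 1)) (IVar 13))))))"

definition char_poly_prog :: com where
  "char_poly_prog = Seq
     (Seq (For 10 (IAdd (IVar 0) (INum 1)) (RSet 7 (INum 0) (IVar 10) RZero))
       (RSet 7 (INum 0) (INum 0) ROne))
     (For 13 (IVar 0) (Seq powers_prog extend_prog))"

lemma writes_assigns_char_poly [simp]:
  "writes powers_prog = {8}" "assigns powers_prog = {10, 11, 14}"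
  "writes extend_prog = {7}" "assigns extend_prog = {11, 14}"
  "writes char_poly_prog = {7, 8}" "assigns char_poly_prog = {10, 11, 13, 14}"
  by (auto simp: powers_prog_def extend_prog_def char_poly_prog_def)

lemma exec_powers_prog:
  assumes u: "holds_mat s 6 u" "u \<in> carrier_mat p p" and k: "idx s 13 = k" "k < p"
    and l: "l \<le> Suc k" and i: "i \<le> k"
  shows "mem (exec dt powers_prog s) (8, l, i) = mat_power_entry (leading_block u (Suc k)) l i k"
proof -
  define L where "L = leading_block u (Suc k)"
  let ?c = "For 10 (IAdd (IVar 13) (INum 1)) (IfLess (IVar 10) (IVar 13)
        (RSet 8 (INum 0) (IVar 10) RZero) (RSet 8 (INum 0) (IVar 10) ROne))"
  let ?r = "RMul (RCell 6 (IVar 10) (IVar 11)) (RCell 8 (IVar 14) (IVar 11))"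
  let ?a = "sum_cell 8 (IAdd (IVar 14) (INum 1)) (IVar 10) 11 (IAdd (IVar 13) (INum 1)) ?r"
  let ?b = "For 10 (IAdd (IVar 13) (INum 1)) ?a"
  let ?s = "exec dt ?c s"
  have "mem ?s = (\<lambda>(k', a, j). if k' = 8 \<and> a = 0 \<and> j < ieval (IAdd (IVar 13) (INum 1)) (idx s)
      then (if j = k then 1 else 0) else mem s (k', a, j))"
    by (rule exec_fill_row) (use k in \<open>auto simp: store_def\<close>)
  then have s0: "mem ?s (8, 0, i) = mat_power_entry L 0 i k" if "i \<le> k" for i
    using that k by simp
  have s6: "holds_mat ?s 6 u" using u by (intro holds_mat_frame) auto
  have s13: "idx ?s 13 = k" using k by (subst frame_idx) auto
  define I where "I = (\<lambda>n (t :: 'a state). holds_mat t 6 u \<and> idx t 13 = k \<and>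
    (\<forall>l\<le>n. \<forall>i\<le>k. mem t (8, l, i) = mat_power_entry L l i k))"
  have "I (ieval (IAdd (IVar 13) (INum 1)) (idx ?s)) (exec dt (For 14 (IAdd (IVar 13) (INum 1)) ?b) ?s)"
  proof (rule exec_For_invariant)
    show "I 0 ?s" using s0 s6 s13 by (simp add: I_def)
    fix l t assume I: "I l t"
    let ?t = "t\<lparr>idx := (idx t)(14 := l)\<rparr>"
    have t: "idx ?t 13 = k" using I by (simp add: I_def)
    have "mem (exec dt ?b ?t) = (\<lambda>(k', a, j). if k' = 8 \<and> a = Suc l \<and>
      j < ieval (IAdd (IVar 13) (INum 1)) (idx ?t) then mat_power_entry L (Suc l) j k else mem ?t (k', a, j))"
    proof (rule exec_fill_row)
      fix i and t' :: "'a state"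
      assume i: "i < ieval (IAdd (IVar 13) (INum 1)) (idx ?t)" "idx t' 10 = i"
        and idx: "\<And>x. x \<noteq> 10 \<Longrightarrow> x \<notin> assigns ?a \<Longrightarrow> idx t' x = idx ?t x"
        and mem: "\<And>k' a j. k' \<noteq> 8 \<or> a \<noteq> Suc l \<Longrightarrow> mem t' (k', a, j) = mem ?t (k', a, j)"
      have idx': "idx t' 13 = k" "idx t' 14 = l" using idx t by auto
      have i': "i \<le> k" using i t by simp
      have "mem (exec dt ?a t') = (mem t')((8, Suc l, i) :=
        \<Sum>j<ieval (IAdd (IVar 13) (INum 1)) (idx t'). L $$ (i, j) * mat_power_entry L l j k)"
      proof (rule exec_sum_cell)
        fix j and t'' :: "'a state"
        assume "j < ieval (IAdd (IVar 13) (INum 1)) (idx t')" "idx t'' = (idx t')(11 := j)"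
          "\<And>x. x \<noteq> (8, Suc l, i) \<Longrightarrow> mem t'' x = mem t' x"
        then show "reval ?r t'' = L $$ (i, j) * mat_power_entry L l j k"
          using i i' idx' mem I k u by (simp add: I_def holds_mat_def L_def)
      qed (use i idx' in simp_all)
      then show "mem (exec dt ?a t') = (mem t')((8, Suc l, i) := mat_power_entry L (Suc l) i k)"
        using idx' by (simp add: L_def)
    qed simp
    then have "mem (exec dt ?b ?t) = (\<lambda>(k', a, j). if k' = 8 \<and> a = Suc l \<and>
      j < Suc k then mat_power_entry L (Suc l) j k else mem t (k', a, j))" using t by (simp add: fun_eq_iff)
    moreover have "holds_mat (exec dt ?b ?t) 6 u"
      using I by (intro holds_mat_frame) (auto simp: I_def holds_mat_def)
    moreover have "idx (exec dt ?b ?t) 13 = k"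
      using t by (subst frame_idx) auto
    ultimately show "I (Suc l) (exec dt ?b ?t)"
      using I by (auto simp: I_def le_Suc_eq simp del: mat_power_entry.simps)
  qed
  then show ?thesis
    using l i s13 by (simp add: powers_prog_def I_def L_def del: mat_power_entry.simps)
qed

lemma exec_extend_prog:
  assumes k: "idx s 13 = k"
    and old: "\<And>m. m \<le> Suc k \<Longrightarrow> mem s (7, 0, m) = (if m \<le> k then block_char_coeff u k m else 0)"
    and powers: "\<And>l. l \<le> Suc k \<Longrightarrow> mem s (8, l, k) = mat_power_entry (leading_block u (Suc k)) l k k"
  shows "m \<le> Suc k \<Longrightarrow> mem (exec dt extend_prog s) (7, 0, m) = block_char_coeff u (Suc k) m"
    "Suc k < m \<Longrightarrow> mem (exec dt extend_prog s) (7, 0, m) = mem s (7, 0, m)"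
proof -
  let ?S = "\<lambda>l. mat_power_entry (leading_block u (Suc k)) l k k"
  let ?r = "RSub (RCell 7 (INum 0) (IAdd (IVar 14) (INum 1)))
         (RMul (RCell 7 (INum 0) (ISub (IVar 14) (IVar 11))) (RCell 8 (IAdd (IVar 11) (INum 1)) (IVar 13)))"
  let ?b = "For 11 (IAdd (IVar 14) (INum 1)) (RSet 7 (INum 0) (IAdd (IVar 14) (INum 1)) ?r)"
  define I where "I = (\<lambda>n (t :: 'a state). idx t 13 = k \<and>
    (\<forall>k' i j. k' \<noteq> 7 \<longrightarrow> mem t (k', i, j) = mem s (k', i, j)) \<and>
    (\<forall>m. mem t (7, 0, m) = (if m \<le> n then block_char_coeff u (Suc k) m else mem s (7, 0, m))))"
  have "I (ieval (IAdd (IVar 13) (INum 1)) (idx s)) (exec dt extend_prog s)"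
    unfolding extend_prog_def
  proof (rule exec_For_invariant)
    have "block_char_coeff u (Suc k) 0 = block_char_coeff u k 0"
      by (subst block_char_coeff.simps(2)) simp
    then show "I 0 s" using old[of 0] k by (simp add: I_def)
    fix n t assume n: "n < ieval (IAdd (IVar 13) (INum 1)) (idx s)" and I: "I n t"
    let ?t = "t\<lparr>idx := (idx t)(14 := n)\<rparr>"
    have n: "n \<le> k" using n k by simp
    have acc: "mem (exec dt ?b ?t) = (mem ?t)((7, 0, Suc n) := mem ?t (7, 0, Suc n)
      + (\<Sum>l<ieval (IAdd (IVar 14) (INum 1)) (idx ?t).
          - (block_char_coeff u (Suc k) (n - l) * ?S (Suc l))))"
    proof (rule exec_accumulate)
      fix l and t' :: "'a state"
      assume l: "l < ieval (IAdd (IVar 14) (INum 1)) (idx ?t)" and idx: "idx t' = (idx ?t)(11 := l)"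
        and mem: "\<And>x. x \<noteq> (7, 0, Suc n) \<Longrightarrow> mem t' x = mem ?t x"
      show "reval ?r t' = mem t' (7, 0, Suc n) + - (block_char_coeff u (Suc k) (n - l) * ?S (Suc l))"
        using l idx mem I n powers[of "Suc l"] by (simp add: I_def del: mat_power_entry.simps)
    qed simp_all
    have val: "mem ?t (7, 0, Suc n) + (\<Sum>l<ieval (IAdd (IVar 14) (INum 1)) (idx ?t).
          - (block_char_coeff u (Suc k) (n - l) * ?S (Suc l))) = block_char_coeff u (Suc k) (Suc n)"
      using I old[of "Suc n"] n
      by (simp add: I_def block_char_coeff.simps(2)[of _ _ "Suc n"] sum_negf del: mat_power_entry.simps)
    have m: "mem (exec dt ?b ?t) = (mem t)((7, 0, Suc n) := block_char_coeff u (Suc k) (Suc n))"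
      unfolding acc val by simp
    have "idx (exec dt ?b ?t) 13 = k"
      using I by (subst frame_idx) (auto simp: I_def)
    then show "I (Suc n) (exec dt ?b ?t)"
      unfolding I_def m using I by (auto simp: I_def)
  qed
  then show "m \<le> Suc k \<Longrightarrow> mem (exec dt extend_prog s) (7, 0, m) = block_char_coeff u (Suc k) m"
    "Suc k < m \<Longrightarrow> mem (exec dt extend_prog s) (7, 0, m) = mem s (7, 0, m)"
    using k by (simp_all add: I_def)
qed

lemma exec_char_poly_prog:
  assumes u: "holds_mat s 6 u" "u \<in> carrier_mat p p" and p: "idx s 0 = p" and m: "m \<le> p"
  shows "mem (exec dt char_poly_prog s) (7, 0, m) = block_char_coeff u p m"
proof -
  let ?c = "For 10 (IAdd (IVar 0) (INum 1)) (RSet 7 (INum 0) (IVar 10) RZero)"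
  let ?s = "exec dt (Seq ?c (RSet 7 (INum 0) (INum 0) ROne)) s"
  let ?b = "Seq powers_prog extend_prog"
  have "mem (exec dt ?c s) = (\<lambda>(k', a, j). if k' = 7 \<and> a = 0 \<and> j < ieval (IAdd (IVar 0) (INum 1)) (idx s)
      then 0 else mem s (k', a, j))"
    by (rule exec_fill_row) (auto simp: store_def)
  then have s7: "mem ?s (7, 0, m) = (if m = 0 then 1 else 0)" if "m \<le> p" for m
    using that p by (simp add: store_def)
  have s6: "holds_mat ?s 6 u" using u by (intro holds_mat_frame) auto
  have s0: "idx ?s 0 = p" using p by (subst frame_idx) auto
  define I where "I = (\<lambda>k (t :: 'a state). holds_mat t 6 u \<and>
    (\<forall>m\<le>p. mem t (7, 0, m) = (if m \<le> k then block_char_coeff u k m else 0)))"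
  have "I (ieval (IVar 0) (idx ?s)) (exec dt (For 13 (IVar 0) ?b) ?s)"
  proof (rule exec_For_invariant)
    show "I 0 ?s" using s6 s7 by (simp add: I_def)
    fix k t assume k: "k < ieval (IVar 0) (idx ?s)" and I: "I k t"
    let ?t = "t\<lparr>idx := (idx t)(13 := k)\<rparr>"
    let ?t' = "exec dt powers_prog ?t"
    have k: "k < p" using k s0 by simp
    have t6: "holds_mat ?t 6 u" using I by (simp add: I_def holds_mat_def)
    have "idx ?t' 13 = k" by (subst frame_idx) auto
    moreover have "mem ?t' (7, 0, m) = (if m \<le> k then block_char_coeff u k m else 0)" if "m \<le> p" for m
      using I that by (subst frame_mem) (auto simp: I_def)
    moreover have "mem ?t' (8, l, k) = mat_power_entry (leading_block u (Suc k)) l k k" if "l \<le> Suc k" for l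
      by (rule exec_powers_prog[OF t6 u(2)]) (use k that in auto)
    ultimately have "mem (exec dt extend_prog ?t') (7, 0, m)
      = (if m \<le> Suc k then block_char_coeff u (Suc k) m else 0)" if "m \<le> p" for m
      using exec_extend_prog[of ?t' k u] that k by simp
    moreover have "holds_mat (exec dt ?b ?t) 6 u" using t6 by (intro holds_mat_frame) auto
    ultimately show "I (Suc k) (exec dt ?b ?t)" by (simp add: I_def)
  qed
  then show ?thesis using s0 m by (simp add: char_poly_prog_def I_def)
qed

text \<open>
  Cells of row 0 of matrix 10: cell 1 is \<open>y\<close>, cell 2 the quotient \<open>z\<close>, and cell 3 first the
  idempotent \<open>z y\<close> and then the local inverse \<open>z (z y)\<close>.
\<close>

definition greedy_step_prog :: com where
  "greedy_step_prog =
     Seq (RSet 10 (INum 0) (INum 1) (RMul (RCell 10 (INum 0) (INum 0)) (RCell 7 (INum 0) (ISub (IVar 0) (IVar 13)))))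
     (Seq (IfDivides (RCell 10 (INum 0) (INum 1)) (RMul (RCell 10 (INum 0) (INum 1)) (RCell 10 (INum 0) (INum 1)))
        10 (INum 0) (INum 2) Skip (RSet 10 (INum 0) (INum 2) RZero))
     (Seq (RSet 10 (INum 0) (INum 3) (RMul (RCell 10 (INum 0) (INum 2)) (RCell 10 (INum 0) (INum 1))))
     (Seq (RSet 10 (INum 0) (INum 0) (RSub (RCell 10 (INum 0) (INum 0)) (RCell 10 (INum 0) (INum 3))))
       (RSet 10 (INum 0) (INum 3) (RMul (RCell 10 (INum 0) (INum 2)) (RCell 10 (INum 0) (INum 3)))))))"

definition greedy_update_prog :: com where
  "greedy_update_prog = For 10 (ISub (IVar 0) (IVar 13)) (RSet 9 (INum 0) (IVar 10)
     (RSub (RCell 9 (INum 0) (IVar 10)) (RMul (RCell 10 (INum 0) (INum 3))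
       (RCell 7 (INum 0) (ISub (ISub (IVar 0) (IVar 13)) (IAdd (IVar 10) (INum 1)))))))"

definition greedy_prog :: com where
  "greedy_prog = Seq
     (Seq (For 10 (IVar 0) (RSet 9 (INum 0) (IVar 10) RZero)) (RSet 10 (INum 0) (INum 0) ROne))
     (For 13 (IAdd (IVar 0) (INum 1)) (Seq greedy_step_prog greedy_update_prog))"

lemma writes_assigns_greedy [simp]:
  "writes greedy_step_prog = {10}" "assigns greedy_step_prog = {}"
  "writes greedy_update_prog = {9}" "assigns greedy_update_prog = {10}"
  "writes greedy_prog = {9, 10}" "assigns greedy_prog = {10, 13}"
  by (auto simp: greedy_step_prog_def greedy_update_prog_def greedy_prog_def)

lemma exec_greedy_step_prog:
  assumes s: "mem s (10, 0, 0) = remaining dt c k" "mem s (7, 0, idx s 0 - idx s 13) = c k"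
  shows "mem (exec dt greedy_step_prog s) (10, 0, 0) = remaining dt c (Suc k)"
    "mem (exec dt greedy_step_prog s) (10, 0, 3) = local_inverse dt c k"
proof -
  define y where "y = remaining dt c k * c k"
  let ?c1 = "RSet 10 (INum 0) (INum 1) (RMul (RCell 10 (INum 0) (INum 0)) (RCell 7 (INum 0) (ISub (IVar 0) (IVar 13))))"
  let ?c2 = "IfDivides (RCell 10 (INum 0) (INum 1)) (RMul (RCell 10 (INum 0) (INum 1)) (RCell 10 (INum 0) (INum 1)))
        10 (INum 0) (INum 2) Skip (RSet 10 (INum 0) (INum 2) RZero)"
  let ?s1 = "exec dt ?c1 s"
  let ?s2 = "exec dt ?c2 ?s1"
  have 1: "mem ?s1 (10, 0, 0) = remaining dt c k" "mem ?s1 (10, 0, 1) = y"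
    using s by (simp_all add: store_def y_def)
  have 2: "mem ?s2 (10, 0, 0) = remaining dt c k" "mem ?s2 (10, 0, 1) = y" "mem ?s2 (10, 0, 2) = guess_quotient dt y"
    using 1 by (simp_all add: store_def Let_def guess_quotient_def del: exec.simps(6) split: option.split)
      (simp_all add: store_def)
  show "mem (exec dt greedy_step_prog s) (10, 0, 0) = remaining dt c (Suc k)"
    "mem (exec dt greedy_step_prog s) (10, 0, 3) = local_inverse dt c k"
    unfolding greedy_step_prog_def exec.simps(2)
    using 2 by (simp_all add: store_def local_inverse_def Let_def y_def[symmetric] del: exec.simps(7))
qed

lemma exec_greedy_prog:
  assumes d: "\<And>m. m \<le> p \<Longrightarrow> mem s (7, 0, m) = c (p - m)" and p: "idx s 0 = p" and m: "m < p"
  shows "mem (exec dt greedy_prog s) (9, 0, m) = inverse_coeff dt c p m"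
proof -
  let ?c = "For 10 (IVar 0) (RSet 9 (INum 0) (IVar 10) RZero)"
  let ?s = "exec dt (Seq ?c (RSet 10 (INum 0) (INum 0) ROne)) s"
  let ?b = "Seq greedy_step_prog greedy_update_prog"
  have "mem (exec dt ?c s) = (\<lambda>(k', a, j). if k' = 9 \<and> a = 0 \<and> j < ieval (IVar 0) (idx s)
      then 0 else mem s (k', a, j))"
    by (rule exec_fill_row) (auto simp: store_def)
  then have s9: "mem ?s (9, 0, m) = 0" if "m < p" for m
    using that p by (simp add: store_def)
  have s10: "mem ?s (10, 0, 0) = 1" by (simp add: store_def)
  have s0: "idx ?s 0 = p" using p by (subst frame_idx) auto
  have s7: "mem ?s (7, 0, m) = c (p - m)" if "m \<le> p" for m
    using d[OF that] by (subst frame_mem) auto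
  define I where "I = (\<lambda>k (t :: 'a state). idx t 0 = p \<and> (\<forall>m\<le>p. mem t (7, 0, m) = c (p - m)) \<and>
    mem t (10, 0, 0) = remaining dt c k \<and>
    (\<forall>m<p. mem t (9, 0, m) = - (\<Sum>i<min k (p - m). local_inverse dt c i * c (Suc (i + m)))))"
  have "I (ieval (IAdd (IVar 0) (INum 1)) (idx ?s)) (exec dt (For 13 (IAdd (IVar 0) (INum 1)) ?b) ?s)"
  proof (rule exec_For_invariant)
    show "I 0 ?s" using s0 s7 s9 s10 by (simp add: I_def)
    fix k t assume k: "k < ieval (IAdd (IVar 0) (INum 1)) (idx ?s)" and I: "I k t"
    let ?t = "t\<lparr>idx := (idx t)(13 := k)\<rparr>"
    let ?t' = "exec dt greedy_step_prog ?t"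
    have k: "k \<le> p" using k s0 by simp
    have t': "mem ?t' (10, 0, 0) = remaining dt c (Suc k)" "mem ?t' (10, 0, 3) = local_inverse dt c k"
      using I k by (intro exec_greedy_step_prog; simp add: I_def)+
    have idx': "idx ?t' 0 = p" "idx ?t' 13 = k"
      using I frame_idx[of _ greedy_step_prog dt ?t] by (auto simp: I_def)
    have t'7: "mem ?t' (7, 0, m) = c (p - m)" if "m \<le> p" for m
      using I that by (subst frame_mem) (auto simp: I_def)
    have t'9: "mem ?t' (9, 0, m) = mem t (9, 0, m)" for m
      by (subst frame_mem) auto
    have "mem (exec dt greedy_update_prog ?t') = (\<lambda>(k', a, j). if k' = 9 \<and> a = 0 \<and>
      j < ieval (ISub (IVar 0) (IVar 13)) (idx ?t')
      then mem t (9, 0, j) - local_inverse dt c k * c (Suc (k + j)) else mem ?t' (k', a, j))"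
      unfolding greedy_update_prog_def
    proof (rule exec_fill_row)
      fix i and t'' :: "'a state"
      assume i: "i < ieval (ISub (IVar 0) (IVar 13)) (idx ?t')" "idx t'' 10 = i"
        and idx: "\<And>x. x \<noteq> 10 \<Longrightarrow> x \<notin> assigns (RSet 9 (INum 0) (IVar 10)
     (RSub (RCell 9 (INum 0) (IVar 10)) (RMul (RCell 10 (INum 0) (INum 3))
       (RCell 7 (INum 0) (ISub (ISub (IVar 0) (IVar 13)) (IAdd (IVar 10) (INum 1))))))) \<Longrightarrow> idx t'' x = idx ?t' x"
        and mem: "\<And>k' a j. k' \<noteq> 9 \<or> a \<noteq> 0 \<Longrightarrow> mem t'' (k', a, j) = mem ?t' (k', a, j)"
        and mem9: "\<And>j. i \<le> j \<Longrightarrow> mem t'' (9, 0, j) = mem ?t' (9, 0, j)"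
      have "idx t'' 0 = p" "idx t'' 13 = k" using idx idx' by simp_all
      moreover have "mem t'' (7, 0, p - k - Suc i) = c (Suc (k + i))"
        using mem t'7[of "p - k - Suc i"] i idx' by simp
      moreover have "mem t'' (10, 0, 3) = local_inverse dt c k" using mem t' by simp
      moreover have "mem t'' (9, 0, i) = mem t (9, 0, i)" using mem9[of i] t'9 by simp
      ultimately show "mem (exec dt (RSet 9 (INum 0) (IVar 10)
     (RSub (RCell 9 (INum 0) (IVar 10)) (RMul (RCell 10 (INum 0) (INum 3))
       (RCell 7 (INum 0) (ISub (ISub (IVar 0) (IVar 13)) (IAdd (IVar 10) (INum 1))))))) t'')
       = (mem t'')((9, 0, i) := mem t (9, 0, i) - local_inverse dt c k * c (Suc (k + i)))"
        using i by (simp add: store_def)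
    qed simp
    then have mem: "mem (exec dt ?b ?t) = (\<lambda>(k', a, j). if k' = 9 \<and> a = 0 \<and> j < p - k
      then mem t (9, 0, j) - local_inverse dt c k * c (Suc (k + j)) else mem ?t' (k', a, j))"
      using idx' by (simp add: fun_eq_iff)
    have "idx (exec dt ?b ?t) 0 = p"
      using I by (subst frame_idx) (auto simp: I_def)
    moreover have "mem (exec dt ?b ?t) (9, 0, m)
        = - (\<Sum>i<min (Suc k) (p - m). local_inverse dt c i * c (Suc (i + m)))" if m: "m < p" for m
    proof (cases "m < p - k")
      case True
      then have "min k (p - m) = k" "min (Suc k) (p - m) = Suc k" by auto
      then show ?thesis using I m True unfolding mem by (simp add: I_def)
    next
      case False
      then have "min k (p - m) = min (Suc k) (p - m)" by auto
      then show ?thesis using I m False t'9 unfolding mem by (simp add: I_def)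
    qed
    ultimately show "I (Suc k) (exec dt ?b ?t)"
      using t' t'7 mem by (simp add: I_def)
  qed
  moreover have "min (Suc p) (p - m) = p - m" by simp
  ultimately show ?thesis using s0 m by (simp add: greedy_prog_def I_def inverse_coeff_def)
qed

text \<open>
  The coefficients are consumed from the last one, so after \<open>m\<close> rounds the matrix \<open>k\<close> contains
  the polynomial with the \<open>m\<close> last coefficients, applied to \<open>Y\<close>.
\<close>

definition horner_prog :: "nat \<Rightarrow> nat \<Rightarrow> com" where
  "horner_prog k y = Seq
     (For 10 (IVar 0) (For 11 (IVar 0) (RSet k (IVar 10) (IVar 11) RZero)))
     (For 13 (IVar 0) (Seq (mult_prog 0 0 0 12 6 k)
       (For 10 (IVar 0) (For 11 (IVar 0) (RSet k (IVar 10) (IVar 11)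
         (RAdd (RCell 12 (IVar 10) (IVar 11))
           (RMul (RCell 9 (INum 0) (ISub (IVar 0) (IAdd (IVar 13) (INum 1)))) (RCell y (IVar 10) (IVar 11)))))))))"

lemma writes_assigns_horner [simp]:
  "writes (horner_prog k y) = {k, 12}" "assigns (horner_prog k y) = {10, 11, 12, 13}"
  by (auto simp: horner_prog_def)

lemma exec_horner_prog:
  assumes u: "holds_mat s 6 u" "u \<in> carrier_mat p p" and Y: "holds_mat s y Y" "Y \<in> carrier_mat p p"
    and a: "\<And>m. m < p \<Longrightarrow> mem s (9, 0, m) = a m" and p: "idx s 0 = p"
    and k: "k \<notin> {6, 9, 12, y}" "y \<noteq> 12"
  shows "holds_mat (exec dt (horner_prog k y) s) k (poly_act u a Y p)"
proof -
  let ?c = "For 10 (IVar 0) (For 11 (IVar 0) (RSet k (IVar 10) (IVar 11) RZero))"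
  let ?r = "RSet k (IVar 10) (IVar 11) (RAdd (RCell 12 (IVar 10) (IVar 11))
           (RMul (RCell 9 (INum 0) (ISub (IVar 0) (IAdd (IVar 13) (INum 1)))) (RCell y (IVar 10) (IVar 11))))"
  let ?d = "For 10 (IVar 0) (For 11 (IVar 0) ?r)"
  let ?s = "exec dt ?c s"
  have "\<forall>i<ieval (IVar 0) (idx s). \<forall>j<ieval (IVar 0) (idx s). mem ?s (k, i, j) = 0"
    by (rule exec_fill_matrix) (auto simp: store_def)
  then have sk: "holds_mat ?s k (0\<^sub>m p p)" using p by (simp add: holds_mat_def)
  define J where "J = (\<lambda>t :: 'a state. holds_mat t 6 u \<and> holds_mat t y Y \<and> idx t 0 = p \<and>
    (\<forall>m<p. mem t (9, 0, m) = a m))"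
  have J_frame: "J (exec dt c t)" if "J t" "{6, y, 9} \<inter> writes c = {}" "0 \<notin> assigns c" for c t
    using that unfolding J_def by (auto simp: holds_mat_frame frame_idx frame_mem)
  have Js: "J ?s" by (rule J_frame) (use u Y a p k in \<open>auto simp: J_def\<close>)
  define I where "I = (\<lambda>m t. J t \<and> holds_mat t k (poly_act u (\<lambda>i. a (p - m + i)) Y m))"
  have "I (ieval (IVar 0) (idx ?s)) (exec dt (For 13 (IVar 0) (Seq (mult_prog 0 0 0 12 6 k) ?d)) ?s)"
  proof (rule exec_For_invariant)
    show "I 0 ?s" using Js sk Y by (simp add: I_def)
    fix m t assume m: "m < ieval (IVar 0) (idx ?s)" and I: "I m t"
    let ?t = "t\<lparr>idx := (idx t)(13 := m)\<rparr>"
    let ?t' = "exec dt (mult_prog 0 0 0 12 6 k) ?t"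
    let ?W = "poly_act u (\<lambda>i. a (p - m + i)) Y m"
    have m: "m < p" using m Js by (simp add: J_def)
    have Jt: "J ?t" using I by (simp add: I_def J_def holds_mat_def)
    have Jt': "J ?t'" by (rule J_frame[OF Jt]) (use k in auto)
    have W: "?W \<in> carrier_mat p p" using u Y by simp
    have "holds_mat ?t k ?W" using I by (simp add: I_def holds_mat_def)
    then have t'12: "holds_mat ?t' 12 (u * ?W)"
      using Jt u W k by (intro exec_mult_prog) (auto simp: J_def)
    have t'13: "idx ?t' 13 = m" by (subst frame_idx) auto
    have "\<forall>i<ieval (IVar 0) (idx ?t'). \<forall>j<ieval (IVar 0) (idx ?t').
      mem (exec dt ?d ?t') (k, i, j) = (u * ?W) $$ (i, j) + a (p - Suc m) * Y $$ (i, j)"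
    proof (rule exec_fill_matrix)
      fix i j and t'' :: "'a state"
      assume ij: "i < ieval (IVar 0) (idx ?t')" "j < ieval (IVar 0) (idx ?t')" "idx t'' 10 = i" "idx t'' 11 = j"
        and idx: "\<And>x. x \<noteq> 10 \<Longrightarrow> x \<noteq> 11 \<Longrightarrow> x \<notin> assigns ?r \<Longrightarrow> idx t'' x = idx ?t' x"
        and mem: "\<And>k' a j. k' \<noteq> k \<Longrightarrow> mem t'' (k', a, j) = mem ?t' (k', a, j)"
      have idx'': "idx t'' 0 = p" "idx t'' 13 = m" using idx Jt' t'13 by (simp_all add: J_def)
      have ij': "i < p" "j < p" using ij Jt' by (simp_all add: J_def)
      have "mem t'' (12, i, j) = (u * ?W) $$ (i, j)"
        using mem[of 12] t'12 u W ij' k by (simp add: holds_mat_def)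
      moreover have "mem t'' (9, 0, p - Suc m) = a (p - Suc m)"
        using mem[of 9] Jt' m k by (simp add: J_def)
      moreover have "mem t'' (y, i, j) = Y $$ (i, j)"
        using mem[of y] Jt' Y ij' k by (simp add: J_def holds_mat_def)
      ultimately show "mem (exec dt ?r t'')
        = (mem t'')((k, i, j) := (u * ?W) $$ (i, j) + a (p - Suc m) * Y $$ (i, j))"
        using ij idx'' by (simp add: store_def)
    qed auto
    then have "\<forall>i<p. \<forall>j<p. mem (exec dt ?d ?t') (k, i, j) = (u * ?W) $$ (i, j) + a (p - Suc m) * Y $$ (i, j)"
      using Jt' by (simp add: J_def)
    moreover have "poly_act u (\<lambda>i. a (p - Suc m + i)) Y (Suc m) = u * ?W + a (p - Suc m) \<cdot>\<^sub>m Y"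
    proof -
      have "(\<lambda>i. a (p - Suc m + Suc i)) = (\<lambda>i. a (p - m + i))" using m by (simp add: Suc_diff_Suc)
      then show ?thesis by simp
    qed
    ultimately have "holds_mat (exec dt ?d ?t') k (poly_act u (\<lambda>i. a (p - Suc m + i)) Y (Suc m))"
      using u carrier_matD[OF W] Y by (simp add: holds_mat_def del: poly_act.simps)
    moreover have "J (exec dt ?d ?t')" by (rule J_frame[OF Jt']) (use k in auto)
    ultimately show "I (Suc m) (exec dt (Seq (mult_prog 0 0 0 12 6 k) ?d) ?t)"
      by (simp add: I_def del: poly_act.simps)
  qed
  moreover have "ieval (IVar 0) (idx ?s) = p" using Js by (simp add: J_def)
  ultimately have "holds_mat (exec dt (For 13 (IVar 0) (Seq (mult_prog 0 0 0 12 6 k) ?d)) ?s) k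
      (poly_act u (\<lambda>i. a (p - p + i)) Y p)"
    unfolding I_def by metis
  then show ?thesis unfolding horner_prog_def exec.simps(2)[of dt ?c] by simp
qed

text \<open>
  Divisibility by 0 is the equality test.  On success it also stores a quotient.
\<close>

definition compare_prog :: "nat \<Rightarrow> nat \<Rightarrow> nat \<Rightarrow> nat \<Rightarrow> com" where
  "compare_prog r c a b = For 10 (IVar r) (For 11 (IVar c)
     (IfDivides (RSub (RCell a (IVar 10) (IVar 11)) (RCell b (IVar 10) (IVar 11))) RZero
       10 (INum 0) (INum 5) Skip (ISet 2 (INum 0))))"

lemma writes_assigns_compare [simp]:
  "writes (compare_prog r c a b) = {10}" "assigns (compare_prog r c a b) = {2, 10, 11}"
  by (auto simp: compare_prog_def)

lemma divisibility_test_zero: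
  assumes "explicit_divisibility_test dt"
  shows "dt x 0 = None \<longleftrightarrow> x \<noteq> 0"
proof -
  have "case dt x 0 of None \<Rightarrow> \<not> 0 dvd x | Some z \<Rightarrow> x = z * 0"
    using assms unfolding explicit_divisibility_test_def by blast
  then show ?thesis by (cases "dt x 0") (auto simp: dvd_def)
qed

lemma exec_compare_prog:
  fixes s :: "'a :: {comm_ring, comm_monoid_mult} state"
  assumes dt: "explicit_divisibility_test dt"
    and M: "holds_mat s a M" "M \<in> carrier_mat (idx s r) (idx s c)"
    and N: "holds_mat s b N" "N \<in> carrier_mat (idx s r) (idx s c)"
    and "a \<noteq> 10" "b \<noteq> 10" "r < 2" "c < 2"
  shows "idx (exec dt (compare_prog r c a b) s) 2 = 1 \<longleftrightarrow> idx s 2 = 1 \<and> M = N"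
proof -
  let ?b = "IfDivides (RSub (RCell a (IVar 10) (IVar 11)) (RCell b (IVar 10) (IVar 11))) RZero
       10 (INum 0) (INum 5) Skip (ISet 2 (INum 0))"
  define J where "J = (\<lambda>t :: 'a state. holds_mat t a M \<and> holds_mat t b N \<and> idx t r = idx s r \<and> idx t c = idx s c)"
  have J_frame: "J (exec dt d t)" if "J t" "{a, b} \<inter> writes d = {}" "{r, c} \<inter> assigns d = {}" for d t
    using that unfolding J_def by (auto simp: holds_mat_frame frame_idx)
  have J_upd: "J (t\<lparr>idx := (idx t)(x := i)\<rparr>)" if "J t" "2 \<le> x" for t x i
    using that assms(8,9) by (auto simp: J_def holds_mat_def)
  define I where "I = (\<lambda>n t. J t \<and> (idx t 2 = 1 \<longleftrightarrow> idx s 2 = 1 \<and> (\<forall>i<n. \<forall>j<idx s c. M $$ (i, j) = N $$ (i, j))))"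
  have "I (ieval (IVar r) (idx s)) (exec dt (compare_prog r c a b) s)"
    unfolding compare_prog_def
  proof (rule exec_For_invariant)
    show "I 0 s" using M N by (simp add: I_def J_def)
    fix i t assume i: "i < ieval (IVar r) (idx s)" and I: "I i t"
    let ?t = "t\<lparr>idx := (idx t)(10 := i)\<rparr>"
    define I' where "I' = (\<lambda>n t. J t \<and> idx t 10 = i \<and> (idx t 2 = 1 \<longleftrightarrow>
      idx ?t 2 = 1 \<and> (\<forall>j<n. M $$ (i, j) = N $$ (i, j))))"
    have Jt: "J ?t" using I by (intro J_upd) (simp_all add: I_def)
    have "I' (ieval (IVar c) (idx ?t)) (exec dt (For 11 (IVar c) ?b) ?t)"
    proof (rule exec_For_invariant)
      show "I' 0 ?t" using Jt by (simp add: I'_def)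
      fix j t' assume j: "j < ieval (IVar c) (idx ?t)" and I': "I' j t'"
      let ?t' = "t'\<lparr>idx := (idx t')(11 := j)\<rparr>"
      have Jt': "J ?t'" using I' by (intro J_upd) (simp_all add: I'_def)
      have j: "j < idx s c" using j Jt assms(9) by (simp add: J_def)
      have cells: "mem t' (a, i, j) = M $$ (i, j)" "mem t' (b, i, j) = N $$ (i, j)" "idx t' 10 = i"
        using Jt' i j M N I' by (simp_all add: J_def I'_def holds_mat_def)
      have "J (exec dt ?b ?t')" by (rule J_frame[OF Jt']) (use assms in auto)
      moreover have "idx (exec dt ?b ?t') 10 = i" using cells by (subst frame_idx) auto
      moreover have "idx (exec dt ?b ?t') 2 = 1 \<longleftrightarrow> idx t' 2 = 1 \<and> M $$ (i, j) = N $$ (i, j)"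
        using cells divisibility_test_zero[OF dt, of "M $$ (i, j) - N $$ (i, j)"]
        by (auto simp: Let_def store_def split: option.splits)
      ultimately show "I' (Suc j) (exec dt ?b ?t')"
        using I' by (auto simp: I'_def less_Suc_eq)
    qed
    then show "I (Suc i) (exec dt (For 11 (IVar c) ?b) ?t)"
      using I Jt by (auto simp: I_def I'_def J_def less_Suc_eq)
  qed
  moreover have "(\<forall>i<idx s r. \<forall>j<idx s c. M $$ (i, j) = N $$ (i, j)) \<longleftrightarrow> M = N"
    using M(2) N(2) by (auto intro: eq_matI)
  ultimately show ?thesis by (simp add: I_def)
qed

definition certificate_prog :: com where
  "certificate_prog = Seq (mult_prog 0 1 0 6 3 2) (Seq char_poly_prog (Seq greedy_prog (horner_prog 11 6)))"

definition verify_prog :: com where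
  "verify_prog = Seq (mult_prog 1 0 0 14 2 11) (Seq (mult_prog 0 0 1 15 11 3)
     (Seq (ISet 2 (INum 1)) (Seq (compare_prog 1 0 14 2) (compare_prog 0 1 15 3))))"

definition decide_prog :: com where
  "decide_prog = Seq certificate_prog verify_prog"

definition invert_prog :: com where
  "invert_prog = Seq (horner_prog 13 11) (Seq (mult_prog 0 0 1 4 13 3) (mult_prog 1 0 0 5 2 13))"

lemma writes_assigns_certificate_verify [simp]:
  "writes certificate_prog = {6, 7, 8, 9, 10, 11, 12}" "assigns certificate_prog = {10, 11, 12, 13, 14}"
  "writes verify_prog = {10, 14, 15}" "assigns verify_prog = {2, 10, 11, 12}"
  by (auto simp: certificate_prog_def verify_prog_def)

lemmas prog_defs = decide_prog_def invert_prog_def certificate_prog_def verify_prog_def mult_prog_def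
  sum_cell_def char_poly_prog_def powers_prog_def extend_prog_def greedy_prog_def greedy_step_prog_def
  greedy_update_prog_def horner_prog_def compare_prog_def

lemma short_loops_progs: "short_loops {0, 1} decide_prog" "short_loops {0, 1} invert_prog"
  by (simp_all add: prog_defs)

text \<open>
  Since \<open>ops_bound c 0\<close> counts every loop body once, it is the constant factor in front of the power
  of \<open>n + 1\<close> given by the nesting depth.
\<close>

primrec loop_depth :: "com \<Rightarrow> nat" where
  "loop_depth Skip = 0"
| "loop_depth (Seq c d) = max (loop_depth c) (loop_depth d)"
| "loop_depth (ISet x e) = 0"
| "loop_depth (IfLess a b c d) = max (loop_depth c) (loop_depth d)"
| "loop_depth (For x e c) = Suc (loop_depth c)"
| "loop_depth (RSet k i j e) = 0"
| "loop_depth (IfDivides a b k i j c d) = max (loop_depth c) (loop_depth d)"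

lemma ops_bound_power: "loop_depth c \<le> d \<Longrightarrow> ops_bound c n \<le> ops_bound c 0 * Suc n ^ d"
proof (induction c arbitrary: d)
  case (Seq c1 c2)
  then show ?case using add_mono[OF Seq.IH(1)[of d] Seq.IH(2)[of d]] by (simp add: add_mult_distrib)
next
  case (IfLess a b c1 c2)
  then show ?case using add_mono[OF IfLess.IH(1)[of d] IfLess.IH(2)[of d]] by (simp add: add_mult_distrib)
next
  case (For x e c)
  then obtain d' where d: "d = Suc d'" "loop_depth c \<le> d'" by (cases d) auto
  have "Suc n * ops_bound c n \<le> Suc n * (ops_bound c 0 * Suc n ^ d')"
    by (rule mult_left_mono[OF For.IH[OF d(2)]]) simp
  then show ?case by (simp only: d(1) ops_bound.simps power_Suc mult.left_commute One_nat_def[symmetric] mult_1)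
next
  case (RSet k i j e)
  then show ?case using mult_le_mono2[of 1 "Suc n ^ d" "rcost e"] by simp
next
  case (IfDivides a b k i j c1 c2)
  have "(rcost a + rcost b) * 1 \<le> (rcost a + rcost b) * Suc n ^ d" by (rule mult_le_mono2) simp
  then show ?case
    using IfDivides.prems add_mono[OF IfDivides.IH(1)[of d] IfDivides.IH(2)[of d]] by (simp add: add_mult_distrib)
qed simp_all

lemma bigo_power:
  fixes f :: "nat \<Rightarrow> nat"
  assumes "\<And>n. f n \<le> K * Suc n ^ d"
  shows "(\<lambda>n. real (f n)) \<in> O(\<lambda>n. real n ^ d)"
proof (rule bigoI[of _ "real (K * 2 ^ d)"])
  show "\<forall>\<^sub>F n in sequentially. norm (real (f n)) \<le> real (K * 2 ^ d) * norm (real n ^ d)"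
  proof (rule eventually_sequentiallyI[of 1])
    fix n :: nat assume "1 \<le> n"
    then have "Suc n ^ d \<le> (2 * n) ^ d" by (intro power_mono) auto
    then have "f n \<le> K * 2 ^ d * n ^ d"
      using assms[of n] by (metis mult.assoc mult_le_mono2 order_trans power_mult_distrib)
    then have "real (f n) \<le> real (K * 2 ^ d * n ^ d)" by (rule of_nat_mono)
    then show "norm (real (f n)) \<le> real (K * 2 ^ d) * norm (real n ^ d)" by simp
  qed
qed

lemma loop_depth_progs: "loop_depth decide_prog \<le> 4" "loop_depth invert_prog \<le> 4"
  by (simp_all add: prog_defs)

lemma tests_bound_decide: "tests_bound decide_prog n \<le> 3 * Suc n ^ 3"
proof -
  have "tests_bound decide_prog n = Suc n + 2 * Suc n ^ 2"
    by (simp add: prog_defs power2_eq_square)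
  also have "\<dots> \<le> Suc n ^ 3 + 2 * Suc n ^ 3"
    by (intro add_mono mult_le_mono2) (simp_all add: power_increasing self_le_power del: power_Suc)
  finally show ?thesis by simp
qed

lemma tests_bound_invert: "tests_bound invert_prog n = 0"
  by (simp add: prog_defs)

definition input_kept :: "'a state \<Rightarrow> nat \<Rightarrow> nat \<Rightarrow> 'a mat \<Rightarrow> 'a mat \<Rightarrow> bool" where
  "input_kept s p q A B \<longleftrightarrow> idx s 0 = p \<and> idx s 1 = q \<and> holds_mat s 2 A \<and> holds_mat s 3 B"

lemma input_kept_exec:
  "input_kept s p q A B \<Longrightarrow> {2, 3} \<inter> writes c = {} \<Longrightarrow> {0, 1} \<inter> assigns c = {} \<Longrightarrow>
    input_kept (exec dt c s) p q A B"
  by (simp add: input_kept_def holds_mat_frame frame_idx)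

definition certificate_coeff ::
  "('a :: {comm_ring, comm_monoid_mult} \<Rightarrow> 'a \<Rightarrow> 'a option) \<Rightarrow> nat \<Rightarrow> 'a mat \<Rightarrow> nat \<Rightarrow> 'a" where
  "certificate_coeff dt p u = inverse_coeff dt (\<lambda>k. block_char_coeff u p (p - k)) p"

lemma exec_certificate_prog:
  fixes dt :: "'a :: {comm_ring, comm_monoid_mult} \<Rightarrow> 'a \<Rightarrow> 'a option"
  assumes s: "input_kept s p q A B" and A: "A \<in> carrier_mat q p" and B: "B \<in> carrier_mat p q"
  defines "t \<equiv> exec dt certificate_prog s" and "u \<equiv> B * A"
  shows "holds_mat t 6 u" "\<And>m. m < p \<Longrightarrow> mem t (9, 0, m) = certificate_coeff dt p u m"
    "holds_mat t 11 (poly_act u (certificate_coeff dt p u) u p)"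
proof -
  let ?c = "\<lambda>k. block_char_coeff u p (p - k)"
  define s1 where "s1 = exec dt (mult_prog 0 1 0 6 3 2) s"
  define s2 where "s2 = exec dt char_poly_prog s1"
  define s3 where "s3 = exec dt greedy_prog s2"
  have t: "t = exec dt (horner_prog 11 6) s3"
    by (simp add: t_def certificate_prog_def s1_def s2_def s3_def)
  have u: "u \<in> carrier_mat p p" using A B by (simp add: u_def)
  have "holds_mat s1 6 u"
    unfolding s1_def u_def by (rule exec_mult_prog) (use s A B in \<open>auto simp: input_kept_def\<close>)
  moreover have p1: "idx s1 0 = p" using s by (simp add: s1_def input_kept_def frame_idx)
  ultimately have m2: "mem s2 (7, 0, m) = block_char_coeff u p m" if "m \<le> p" for m
    unfolding s2_def using u that by (intro exec_char_poly_prog)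
  have p2: "idx s2 0 = p" using p1 by (simp add: s2_def frame_idx)
  have m3: "mem s3 (9, 0, m) = certificate_coeff dt p u m" if "m < p" for m
    unfolding s3_def certificate_coeff_def by (rule exec_greedy_prog[OF _ p2 that]) (simp add: m2)
  have p3: "idx s3 0 = p" using p2 by (simp add: s3_def frame_idx)
  have u3: "holds_mat s3 6 u" unfolding s3_def s2_def
    using \<open>holds_mat s1 6 u\<close> by (intro holds_mat_frame) simp_all
  show "holds_mat t 6 u" unfolding t using u3 by (intro holds_mat_frame) simp_all
  show "mem t (9, 0, m) = certificate_coeff dt p u m" if "m < p" for m
    unfolding t using m3[OF that] by (simp add: frame_mem)
  show "holds_mat t 11 (poly_act u (certificate_coeff dt p u) u p)"
    unfolding t by (rule exec_horner_prog[OF u3 u u3 u m3 p3]) simp_all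
qed

lemma exec_verify_prog:
  assumes dt: "explicit_divisibility_test dt" and s: "input_kept s p q A B"
    and A: "A \<in> carrier_mat q p" and B: "B \<in> carrier_mat p q"
    and e: "holds_mat s 11 e" "e \<in> carrier_mat p p"
  shows "accepts (exec dt verify_prog s) \<longleftrightarrow> A * e = A \<and> e * B = B"
proof -
  define s1 where "s1 = exec dt (mult_prog 1 0 0 14 2 11) s"
  define s2 where "s2 = exec dt (mult_prog 0 0 1 15 11 3) s1"
  define s3 where "s3 = exec dt (ISet 2 (INum 1)) s2"
  define s4 where "s4 = exec dt (compare_prog 1 0 14 2) s3"
  have s': "exec dt verify_prog s = exec dt (compare_prog 0 1 15 3) s4"
    by (simp add: verify_prog_def s1_def s2_def s3_def s4_def)
  have k1: "input_kept s1 p q A B" unfolding s1_def by (rule input_kept_exec[OF s]) simp_all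
  have k2: "input_kept s2 p q A B" unfolding s2_def by (rule input_kept_exec[OF k1]) simp_all
  have k3: "input_kept s3 p q A B" unfolding s3_def by (rule input_kept_exec[OF k2]) simp_all
  have k4: "input_kept s4 p q A B" unfolding s4_def by (rule input_kept_exec[OF k3]) simp_all
  have h14: "holds_mat s1 14 (A * e)"
    unfolding s1_def by (rule exec_mult_prog) (use s A e in \<open>auto simp: input_kept_def\<close>)
  have e1: "holds_mat s1 11 e" unfolding s1_def using e by (intro holds_mat_frame) simp_all
  have h15: "holds_mat s2 15 (e * B)"
    unfolding s2_def by (rule exec_mult_prog) (use k1 e1 B e in \<open>auto simp: input_kept_def\<close>)
  have "idx s4 2 = 1 \<longleftrightarrow> idx s3 2 = 1 \<and> A * e = A"
    unfolding s4_def
  proof (rule exec_compare_prog[OF dt])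
    show "holds_mat s3 14 (A * e)" unfolding s3_def s2_def using h14 by (intro holds_mat_frame) simp_all
  qed (use k3 A e in \<open>auto simp: input_kept_def\<close>)
  moreover have "idx s3 2 = 1" by (simp add: s3_def)
  moreover have "idx (exec dt (compare_prog 0 1 15 3) s4) 2 = 1 \<longleftrightarrow> idx s4 2 = 1 \<and> e * B = B"
  proof (rule exec_compare_prog[OF dt])
    show "holds_mat s4 15 (e * B)" unfolding s4_def s3_def using h15 by (intro holds_mat_frame) simp_all
  qed (use k4 B e in \<open>auto simp: input_kept_def\<close>)
  ultimately show ?thesis by (simp add: accepts_def s')
qed

lemma exec_invert_prog:
  fixes dt :: "'a :: {comm_ring, comm_monoid_mult} \<Rightarrow> 'a \<Rightarrow> 'a option"
  assumes s: "input_kept s p q A B" and A: "A \<in> carrier_mat q p" and B: "B \<in> carrier_mat p q"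
    and u: "holds_mat s 6 u" "u \<in> carrier_mat p p" and e: "holds_mat s 11 e" "e \<in> carrier_mat p p"
    and a: "\<And>m. m < p \<Longrightarrow> mem s (9, 0, m) = a m"
  defines "t \<equiv> exec dt invert_prog s" and "x \<equiv> poly_act u a e p"
  shows "result_mat t 4 p q = x * B" "result_mat t 5 q p = A * x"
proof -
  define s1 where "s1 = exec dt (horner_prog 13 11) s"
  define s2 where "s2 = exec dt (mult_prog 0 0 1 4 13 3) s1"
  have t: "t = exec dt (mult_prog 1 0 0 5 2 13) s2"
    by (simp add: t_def invert_prog_def s1_def s2_def)
  have x: "x \<in> carrier_mat p p" using u e by (simp add: x_def)
  have k1: "input_kept s1 p q A B" unfolding s1_def by (rule input_kept_exec[OF s]) simp_all
  have k2: "input_kept s2 p q A B" unfolding s2_def by (rule input_kept_exec[OF k1]) simp_all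
  have x1: "holds_mat s1 13 x"
    unfolding s1_def x_def by (rule exec_horner_prog[OF u e a]) (use s in \<open>simp_all add: input_kept_def\<close>)
  have G: "holds_mat s2 4 (x * B)"
    unfolding s2_def by (rule exec_mult_prog) (use k1 x1 B x in \<open>auto simp: input_kept_def\<close>)
  have x2: "holds_mat s2 13 x" unfolding s2_def using x1 by (intro holds_mat_frame) simp_all
  have H: "holds_mat t 5 (A * x)"
    unfolding t by (rule exec_mult_prog) (use k2 x2 A x in \<open>auto simp: input_kept_def\<close>)
  have G': "holds_mat t 4 (x * B)" unfolding t using G by (intro holds_mat_frame) simp_all
  show "result_mat t 4 p q = x * B"
    using G' x B by (intro eq_matI) (auto simp: result_mat_def holds_mat_def)
  show "result_mat t 5 q p = A * x"
    using H x A by (intro eq_matI) (auto simp: result_mat_def holds_mat_def)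
qed

theorem mainTheorem3:
  "\<exists>(decide :: com) (invert :: com) (dops :: nat \<Rightarrow> nat) (dtests :: nat \<Rightarrow> nat) (iops :: nat \<Rightarrow> nat).
     (\<lambda>n. real (dops n)) \<in> O(\<lambda>n. real n ^ 4) \<and>
     (\<lambda>n. real (dtests n)) \<in> O(\<lambda>n. real n ^ 3) \<and>
     (\<lambda>n. real (iops n)) \<in> O(\<lambda>n. real n ^ 4) \<and>
     (\<forall>(dt :: 'a :: {comm_ring, comm_monoid_mult} \<Rightarrow> 'a \<Rightarrow> 'a option) n p q P Q A B s.
        explicit_divisibility_test dt \<longrightarrow>
        p \<le> n \<longrightarrow> q \<le> n \<longrightarrow>
        projection_mat p P \<longrightarrow> projection_mat q Q \<longrightarrow>
        represents_map P Q A \<longrightarrow> represents_map Q P B \<longrightarrow>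
        input_state s P Q A B \<longrightarrow>
        (let E = image_module P; F = image_module Q;
             f = (\<lambda>x. A *\<^sub>v x); g = (\<lambda>y. B *\<^sub>v y);
             s' = exec dt decide s;
             s'' = exec dt invert s';
             G = result_mat s'' 4 p q; H = result_mat s'' 5 q p
         in (accepts s' \<longleftrightarrow> crossed E F f g) \<and>
            ops s' \<le> dops n \<and> tests s' \<le> dtests n \<and>
            (crossed E F f g \<longrightarrow>
               represents_map Q P G \<and> is_Ig class_ring E F f g (\<lambda>y. G *\<^sub>v y) \<and>
               represents_map P Q H \<and> is_Ig class_ring F E g f (\<lambda>x. H *\<^sub>v x) \<and>
               ops s'' \<le> ops s' + iops n \<and> tests s'' = tests s')))"
proof (rule exI[of _ decide_prog], rule exI[of _ invert_prog], rule exI[of _ "ops_bound decide_prog"],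
    rule exI[of _ "tests_bound decide_prog"], rule exI[of _ "ops_bound invert_prog"],
    intro conjI allI impI bigo_power[OF ops_bound_power] bigo_power[OF tests_bound_decide] loop_depth_progs)
  fix dt :: "'a \<Rightarrow> 'a \<Rightarrow> 'a option" and n p q and P Q A B :: "'a mat" and s :: "'a state"
  assume dt: "explicit_divisibility_test dt" and n: "p \<le> n" "q \<le> n"
    and P: "projection_mat p P" and Q: "projection_mat q Q"
    and A: "represents_map P Q A" and B: "represents_map Q P B" and s: "input_state s P Q A B"
  have dims: "dim_row P = p" "dim_row Q = q" using P Q by (auto simp: projection_mat_def)
  note cA = represents_mapD(1)[OF P Q A] and cB = represents_mapD(1)[OF Q P B]
  have s0: "input_kept s p q A B" "ops s = 0" "tests s = 0"
    using s dims by (simp_all add: input_state_def input_kept_def)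
  define u where "u = B * A"
  define a where "a = certificate_coeff dt p u"
  define e where "e = poly_act u a u p"
  define x where "x = poly_act u a e p"
  have u: "u \<in> carrier_mat p p" using cA cB by (simp add: u_def)
  have e: "e \<in> carrier_mat p p" using u by (simp add: e_def)
  define t where "t = exec dt certificate_prog s"
  define s' where "s' = exec dt decide_prog s"
  define s'' where "s'' = exec dt invert_prog s'"
  have s't: "s' = exec dt verify_prog t" by (simp add: s'_def t_def decide_prog_def)
  have kt: "input_kept t p q A B" unfolding t_def by (rule input_kept_exec[OF s0(1)]) simp_all
  note cert = exec_certificate_prog[OF s0(1) cA cB, where dt = dt, folded t_def u_def, folded a_def, folded e_def]
  have accepts: "accepts s' \<longleftrightarrow> A * e = A \<and> e * B = B"
    unfolding s't by (rule exec_verify_prog[OF dt kt cA cB cert(3) e])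
  have complete: "A * e = A \<and> e * B = B"
    if "crossed (image_module P) (image_module Q) (\<lambda>x. A *\<^sub>v x) (\<lambda>y. B *\<^sub>v y)"
    using poly_act_crossed[OF dt P Q A B that] by (simp add: e_def a_def u_def certificate_coeff_def)
  note sound = certificate_sound[OF P Q A B, of a p, folded u_def, folded e_def, folded x_def]
  have ks': "input_kept s' p q A B" unfolding s't by (rule input_kept_exec[OF kt]) simp_all
  have u': "holds_mat s' 6 u" and e': "holds_mat s' 11 e"
    unfolding s't using cert(1,3) by (intro holds_mat_frame; simp)+
  have a': "mem s' (9, 0, m) = a m" if "m < p" for m
    unfolding s't using cert(2)[OF that] by (simp add: frame_mem)
  have results: "result_mat s'' 4 p q = x * B" "result_mat s'' 5 q p = A * x"
    unfolding s''_def x_def by (rule exec_invert_prog[OF ks' cA cB u' u e' e a']; assumption)+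
  have short: "\<forall>v\<in>{0, 1}. idx s v \<le> n" "\<forall>v\<in>{0, 1}. idx s' v \<le> n"
    using s0(1) ks' n by (simp_all add: input_kept_def)
  have cost: "ops s' \<le> ops_bound decide_prog n" "tests s' \<le> tests_bound decide_prog n"
    using cost_exec[OF short_loops_progs(1) short(1), of dt] s0 by (simp_all add: s'_def)
  have cost': "ops s'' \<le> ops s' + ops_bound invert_prog n" "tests s'' = tests s'"
    using cost_exec[OF short_loops_progs(2) short(2), of dt] tests_bound_invert by (simp_all add: s''_def)
  show "let E = image_module P; F = image_module Q;
             f = (\<lambda>x. A *\<^sub>v x); g = (\<lambda>y. B *\<^sub>v y);
             s' = exec dt decide_prog s;
             s'' = exec dt invert_prog s';
             G = result_mat s'' 4 p q; H = result_mat s'' 5 q p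
         in (accepts s' \<longleftrightarrow> crossed E F f g) \<and>
            ops s' \<le> ops_bound decide_prog n \<and> tests s' \<le> tests_bound decide_prog n \<and>
            (crossed E F f g \<longrightarrow>
               represents_map Q P G \<and> is_Ig class_ring E F f g (\<lambda>y. G *\<^sub>v y) \<and>
               represents_map P Q H \<and> is_Ig class_ring F E g f (\<lambda>x. H *\<^sub>v x) \<and>
               ops s'' \<le> ops s' + ops_bound invert_prog n \<and> tests s'' = tests s')"
    unfolding Let_def s'_def[symmetric] s''_def[symmetric] results
    using accepts complete sound cost cost' by blast
qed

end
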